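(* Let the geometric assumption, the CutFEM stability assumption and the covering assumption (all defined in the context) hold, let local and coarse solves be exact, and prescribe $\gamma=\gamma(p)\in(0,1]$ and an admissible $\gamma_D=\gamma_D(p)$. Then the colored sweep with error-propagation operator $E_{\mathrm{col}}$ (defined in the context) satisfies $$\|E_{\mathrm{col}}\|_{A_\ell}^2\le 1-\frac{1}{\bigl(2\,(2^d+3^d)^2+1\bigr)\,C_{\mathrm{sd}}(p)}<1,$$ uniformly in $\ell$ and in the cut configuration.
   Context: Meshes and spaces. $d\in\{2,3\}$, $p\ge1$; $\Omega\subset\mathbb R^d$ is a bounded domain with boundary $\Gamma$ and outward unit normal $n$. $\mathcal M_0,\dots,\mathcal M_L$ are nested Cartesian background grids covering $\Omega$: the cells of $\mathcal M_\ell$ are closed axis-parallel cubes of edge $h_\ell$, and $\mathcal M_\ell$ is the uniform dyadic refinement of $\mathcal M_{\ell-1}$, so $h_\ell=h_{\ell-1}/2$. Active cells: $\mathcal M_{\ell,\Omega}=\{K\in\mathcal M_\ell:K\cap\Omega\ne\emptyset\}$; $\Omega_\ell$ is their union. Cut (intersected) cells are those meeting $\Gamma$. $\mathbb Q_p(K)$: polynomials of degree at most $p$ in each variable. $V_\ell$: continuous functions on $\Omega_\ell$ that are in $\mathbb Q_p(K)$ on each active cell $K$, with nodal (Lagrange) basis $\phi_{\ell,i}$ at the tensor-product Gauss–Lobatto nodes $x_{\ell,i}$. $\mathbb F_G=\mathbb F_G^\ell$ (ghost faces): faces shared by two active cells at least one of which is cut. Forms. $A_\ell=a_\ell+g_\ell$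 with $a_\ell(u,v)=(\nabla u,\nabla v)_\Omega-(\partial_n u,v)_\Gamma-(u,\partial_n v)_\Gamma+\gamma_D h_\ell^{-1}(u,v)_\Gamma$ and $g_\ell(u,v)=\gamma\sum_{F\in\mathbb F_G}\sum_{k=1}^p\frac{h_\ell^{2k-1}}{(k!)^2}(\llbracket\partial_n^k u\rrbracket,\llbracket\partial_n^k v\rrbracket)_F$, $\gamma\in(0,1]$ (on $F$, $n$ is a fixed unit normal and $\llbracket\cdot\rrbracket$ the jump). $\gamma,\gamma_D$ are the same on all levels. $\|v\|_{A_\ell}^2:=A_\ell(v,v)$, and $\|\cdot\|_{A_\ell}$ of an operator on $V_\ell$ is the induced operator norm. The prolongation $\mathcal I_\ell:V_{\ell-1}\to V_\ell$ is restriction of functions to $\Omega_\ell$. Geometric assumption. $\Gamma$ is $C^2$ with positive reach $\delta_0>0$ (the closest-point projection onto $\Gamma$ is well defined and $C^1$ in the tube of radius $\delta_0$). On every level, if $\Gamma$ meets a cell $K$, then $\Gamma\cap K$ is a single curve (surface) intersecting $\partial K$ exactly twice (in a single closed curve if $d=3$), each closed face is intersected at most once, and $K\setminus\Gamma$ has exactly two connected components. $\Gamma$ contains no mesh vertex of any $\mathcal M_\ell$, $\Omega_\ell\subseteq\Omega_{\ell-1}$ for all $\ell$, and $c_R h_{\ell-1}\le\delta_0$ on every level used, with $c_R=24d+10\sqrt d$. CutFEM stability assumption. With $N_\ell(v)^2:=\|\nabla v\|_{0,\Omega}^2+h_\ell\|\partial_n v\|_{0,\Gamma}^2+h_\ell^{-1}\|v\|_{0,\Gamma}^2+g_\ell(v,v)$,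 one has for $u,v\in V_\ell$: $c_A N_\ell(v)^2\le A_\ell(v,v)$, $A_\ell(u,v)\le C_A N_\ell(u)N_\ell(v)$, and $|v|_{1,\Omega_\ell\setminus\Omega}^2\le C(|v|_{1,\Omega}^2+g_\ell(v,v))$, where $c_A,C_A,C>0$ are independent of $\ell$ and of the cut configuration. $\gamma_D$ is admissible if this assumption holds for it. Patches. Admissible vertices $\vartheta_1,\dots,\vartheta_J$ of $\mathcal M_\ell$: all grid vertices in $\Omega$ and all exterior vertices with at least one cut adjacent cell. $\widehat\omega_j$: union of the $2^d$ background cells sharing $\vartheta_j$; $\omega_j$: union of the active cells in $\widehat\omega_j$. For a basis function $\phi_{\ell,i}$, $\omega(i)$ is the union of all active cells containing $x_{\ell,i}$. Local spaces: $V^{\mathrm D}_{\ell,j}=\operatorname{span}\{\phi_{\ell,i}:x_{\ell,i}\in\operatorname{int}\widehat\omega_j\}$ or $V^{\mathrm{FR}}_{\ell,j}=\operatorname{span}\{\phi_{\ell,i}:\omega(i)\subseteq\omega_j\}$; $V_{\ell,j}$ denotes either. $V_{\ell,0}:=\mathcal I_\ell V_{\ell-1}$. $P_j$, $j=0,\dots,J$, is the $A_\ell$-orthogonal projection onto $V_{\ell,j}$. Covering assumption. For each nodal basis function $\phi_{\ell,i}$ of $V_\ell$ there is $j\in\{1,\dots,J\}$ with $\phi_{\ell,i}\in V_{\ell,j}$. Constant $C_{\mathrm{sd}}(p)$: independent of $\ell$ and the cut configuration, such that every $v\in V_\ell$ can be written $v=\sum_{j=0}^Jv_j$, $v_j\in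 V_{\ell,j}$, with $\sum_{j=0}^J\|v_j\|_{A_\ell}^2\le C_{\mathrm{sd}}(p)\|v\|_{A_\ell}^2$ (the paper proves such a constant exists under the stated assumptions). Colored sweep. The patches having a cell that touches a ghost face (i.e. has a face in $\mathbb F_G$), the "cut and collar" patches, are colored with at most $3^d$ colors so that distinct same-color vertices differ by at least three cells in some coordinate direction. The remaining (interior) patches receive the standard $2^d$ geometric colors (parity vector of the integer grid index of the vertex), from a palette disjoint from that of the cut and collar patches. The resulting $N^c\le2^d+3^d$ color classes are processed sequentially after the exact coarse correction $P_0$, with all patch solves within one color performed simultaneously: $E_{\mathrm{col}}:=\Bigl[\prod_c\bigl(I-\sum_{j\in c}P_j\bigr)\Bigr](I-P_0)$, the product over the color classes $c$ in a fixed order. *)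

theory Defs
  imports "HOL-Analysis.Analysis" "HOL-Computational_Algebra.Polynomial"
begin

section \<open>Surface measure\<close>

text \<open>
  The \<open>s\<close>-dimensional Hausdorff measure for \<open>s \<ge> 1\<close>, normalised so that it coincides with
  Lebesgue measure on flat \<open>s\<close>-dimensional pieces. Boundedness of the covering sets is required
  because \<^const>\<open>diameter\<close> is unspecified on unbounded sets. As a metric outer measure,
  \<open>hausdorff_outer\<close> is countably additive on Borel sets, so \<^const>\<open>measure_of\<close> retains its values.
\<close>

definition hausdorff_pre :: "nat \<Rightarrow> real \<Rightarrow> 'a::metric_space set \<Rightarrow> ennreal" where
  "hausdorff_pre s \<delta> A =
     (INF U \<in> {U :: nat \<Rightarrow> 'a set. A \<subseteq> (\<Union>i. U i) \<and> (\<forall>i. bounded (U i) \<and> diameter (U i) \<le> \<delta>)}.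
        (\<Sum>i. ennreal (unit_ball_vol (real s) * (diameter (U i) / 2) ^ s)))"

definition hausdorff_outer :: "nat \<Rightarrow> 'a::metric_space set \<Rightarrow> ennreal" where
  "hausdorff_outer s A = (SUP \<delta> \<in> {0<..}. hausdorff_pre s \<delta> A)"

definition hausdorff_measure :: "nat \<Rightarrow> 'a::metric_space measure" where
  "hausdorff_measure s = measure_of UNIV (sets borel) (hausdorff_outer s)"

abbreviation surface_measure :: "(real ^ 'n::finite) measure" where
  "surface_measure \<equiv> hausdorff_measure (CARD('n) - 1)"

definition L2_surface :: "(real ^ 'n::finite) set \<Rightarrow> (real ^ 'n \<Rightarrow> real) \<Rightarrow> (real ^ 'n \<Rightarrow> real) \<Rightarrow> real" where
  "L2_surface S u v = (LINT x:S|surface_measure. u x * v x)"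

section \<open>Domains with $C^2$ boundary\<close>

definition C1_on :: "'a::real_normed_vector set \<Rightarrow> ('a \<Rightarrow> 'b::real_normed_vector) \<Rightarrow> bool" where
  "C1_on S f \<longleftrightarrow> (\<exists>f' :: 'a \<Rightarrow> 'a \<Rightarrow>\<^sub>L 'b.
     (\<forall>x\<in>S. (f has_derivative blinfun_apply (f' x)) (at x)) \<and> continuous_on S f')"

definition C2_on :: "'a::real_normed_vector set \<Rightarrow> ('a \<Rightarrow> 'b::real_normed_vector) \<Rightarrow> bool" where
  "C2_on S f \<longleftrightarrow> (\<exists>f' :: 'a \<Rightarrow> 'a \<Rightarrow>\<^sub>L 'b.
     (\<forall>x\<in>S. (f has_derivative blinfun_apply (f' x)) (at x)) \<and> C1_on S f')"

definition bounded_domain :: "(real ^ 'n::finite) set \<Rightarrow> bool" where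
  "bounded_domain D \<longleftrightarrow> open D \<and> connected D \<and> D \<noteq> {} \<and> bounded D"

text \<open>
  Locally, up to relabelling and reorienting the coordinate axes, the domain is the set below the
  graph of a $C^2$ function of the remaining \<open>d - 1\<close> coordinates; such a function is represented by
  one on the whole space that does not depend on the distinguished coordinate \<open>k\<close>.
\<close>

definition C2_boundary :: "(real ^ 'n::finite) set \<Rightarrow> bool" where
  "C2_boundary D \<longleftrightarrow> (\<forall>x\<in>frontier D. \<exists>U k \<sigma> f.
     open U \<and> x \<in> U \<and> \<sigma> \<in> {-1, 1 :: real} \<and>
     C2_on UNIV f \<and> (\<forall>y t. f (y + t *\<^sub>R axis k 1) = f y) \<and>
     D \<inter> U = {y \<in> U. \<sigma> * (y $ k - f y) < 0})"

text \<open>The unit vector orthogonal to the tangent space of the boundary that points out of \<open>D\<close>.\<close>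

definition outward_normal :: "(real ^ 'n::finite) set \<Rightarrow> real ^ 'n \<Rightarrow> real ^ 'n" where
  "outward_normal D x = (THE \<nu>. norm \<nu> = 1 \<and>
     ((\<lambda>y. (\<nu> \<bullet> (y - x)) / norm (y - x)) \<longlongrightarrow> 0) (at x within frontier D) \<and>
     (\<forall>\<^sub>F t in at_right 0. x - t *\<^sub>R \<nu> \<in> D \<and> x + t *\<^sub>R \<nu> \<notin> closure D))"

definition has_reach :: "(real ^ 'n::finite) set \<Rightarrow> real \<Rightarrow> bool" where
  "has_reach S \<delta> \<longleftrightarrow>
     (\<forall>x \<in> {x. infdist x S < \<delta>}. \<exists>!y. y \<in> S \<and> dist x y = infdist x S) \<and>
     C1_on {x. infdist x S < \<delta>} (closest_point S)"

section \<open>Grids\<close>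

text \<open>
  A configuration consists of the domain, the origin and the mesh width of the coarsest grid, and
  the number \<open>L\<close> of the finest level. The grid of level \<open>l\<close> is the lattice of closed cubes of edge
  \<open>h\<^sub>0 / 2^l\<close> anchored at the origin; its cells and vertices are addressed by integer vectors, a
  cell by its lower corner. Hence each grid is the uniform dyadic refinement of the previous one.
\<close>

record ('n::finite) config =
  Omega :: "(real ^ 'n) set"
  anchor :: "real ^ 'n"
  width0 :: real
  finest :: nat

abbreviation Gamma_bd :: "('n::finite) config \<Rightarrow> (real ^ 'n) set" where
  "Gamma_bd m \<equiv> frontier (Omega m)"

definition width :: "('n::finite) config \<Rightarrow> nat \<Rightarrow> real" where
  "width m l = width0 m / 2 ^ l"

definition vertex :: "('n::finite) config \<Rightarrow> nat \<Rightarrow> int ^ 'n \<Rightarrow> real ^ 'n" where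
  "vertex m l z = anchor m + width m l *\<^sub>R (\<chi> i. real_of_int (z $ i))"

definition cell :: "('n::finite) config \<Rightarrow> nat \<Rightarrow> int ^ 'n \<Rightarrow> (real ^ 'n) set" where
  "cell m l z = cbox (vertex m l z) (vertex m l (\<chi> i. z $ i + 1))"

definition cell_faces :: "('n::finite) config \<Rightarrow> nat \<Rightarrow> int ^ 'n \<Rightarrow> (real ^ 'n) set set" where
  "cell_faces m l z =
     (\<Union>i. {{x \<in> cell m l z. x $ i = vertex m l z $ i},
           {x \<in> cell m l z. x $ i = vertex m l (z + axis i 1) $ i}})"

definition active_cells :: "('n::finite) config \<Rightarrow> nat \<Rightarrow> (int ^ 'n) set" where
  "active_cells m l = {z. cell m l z \<inter> Omega m \<noteq> {}}"

definition cut_cells :: "('n::finite) config \<Rightarrow> nat \<Rightarrow> (int ^ 'n) set" where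
  "cut_cells m l = {z. cell m l z \<inter> Gamma_bd m \<noteq> {}}"

definition Omega_h :: "('n::finite) config \<Rightarrow> nat \<Rightarrow> (real ^ 'n) set" where
  "Omega_h m l = (\<Union>z\<in>active_cells m l. cell m l z)"

text \<open>The pair \<open>(i, z)\<close> stands for the face between the cells \<open>z\<close> and \<open>z + e\<^sub>i\<close>, with normal \<open>e\<^sub>i\<close>.\<close>

definition ghost_faces :: "('n::finite) config \<Rightarrow> nat \<Rightarrow> ('n \<times> (int ^ 'n)) set" where
  "ghost_faces m l = {(i, z). z \<in> active_cells m l \<and> z + axis i 1 \<in> active_cells m l \<and>
     (z \<in> cut_cells m l \<or> z + axis i 1 \<in> cut_cells m l)}"

definition face :: "('n::finite) config \<Rightarrow> nat \<Rightarrow> 'n \<times> (int ^ 'n) \<Rightarrow> (real ^ 'n) set" where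
  "face m l F = (case F of (i, z) \<Rightarrow> cell m l z \<inter> cell m l (z + axis i 1))"

section \<open>Geometric assumption\<close>

text \<open>
  For \<open>d = 3\<close>, the boundary already being a surface, a single piece in a cell, and at most one
  intersection with a closed face, is expressed by connectedness (the empty set is connected).
\<close>

definition simply_cut :: "('n::finite) config \<Rightarrow> nat \<Rightarrow> int ^ 'n \<Rightarrow> bool" where
  "simply_cut m l z \<longleftrightarrow>
     (let K = cell m l z; G = Gamma_bd m in
       (if CARD('n) = 2
        then (\<exists>g. arc g \<and> path_image g = G \<inter> K) \<and>
             card (G \<inter> frontier K) = 2 \<and>
             (\<forall>F\<in>cell_faces m l z. finite (G \<inter> F) \<and> card (G \<inter> F) \<le> 1)
        else connected (G \<inter> K) \<and>
             (\<exists>g. simple_path g \<and> pathfinish g = pathstart g \<and> path_image g = G \<inter> frontier K) \<and>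
             (\<forall>F\<in>cell_faces m l z. connected (G \<inter> F))) \<and>
       card (components (K - G)) = 2)"

definition reach_factor :: "nat \<Rightarrow> real" where
  "reach_factor d = 24 * real d + 10 * sqrt (real d)"

definition geometric_assumption :: "('n::finite) config \<Rightarrow> bool" where
  "geometric_assumption m \<longleftrightarrow>
     C2_boundary (Omega m) \<and>
     (\<exists>\<delta>\<^sub>0>0. has_reach (Gamma_bd m) \<delta>\<^sub>0 \<and>
        (\<forall>l\<in>{1..finest m}. reach_factor CARD('n) * width m (l - 1) \<le> \<delta>\<^sub>0)) \<and>
     (\<forall>l\<le>finest m. \<forall>z\<in>cut_cells m l. simply_cut m l z) \<and>
     (\<forall>l\<le>finest m. \<forall>z. vertex m l z \<notin> Gamma_bd m) \<and>
     (\<forall>l\<in>{1..finest m}. Omega_h m l \<subseteq> Omega_h m (l - 1))"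

section \<open>Finite element spaces\<close>

definition Q_poly :: "nat \<Rightarrow> (real ^ 'n::finite \<Rightarrow> real) set" where
  "Q_poly p = {q. \<exists>c :: ('n \<Rightarrow> nat) \<Rightarrow> real.
     \<forall>x. q x = (\<Sum>\<alpha> | \<forall>i. \<alpha> i \<le> p. c \<alpha> * (\<Prod>i\<in>UNIV. (x $ i) ^ \<alpha> i))}"

text \<open>
  A function on \<open>\<Omega>\<^sub>l\<close> is represented by its extension by zero to the whole space, so that equality
  of functions in the space is equality on \<open>\<Omega>\<^sub>l\<close>.
\<close>

definition V_space :: "nat \<Rightarrow> ('n::finite) config \<Rightarrow> nat \<Rightarrow> (real ^ 'n \<Rightarrow> real) set" where
  "V_space p m l = {v. continuous_on (Omega_h m l) v \<and>
     (\<forall>z\<in>active_cells m l. \<exists>q\<in>Q_poly p. \<forall>x\<in>cell m l z. v x = q x) \<and>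
     (\<forall>x. x \<notin> Omega_h m l \<longrightarrow> v x = 0)}"

definition prolongation :: "('n::finite) config \<Rightarrow> nat \<Rightarrow> (real ^ 'n \<Rightarrow> real) \<Rightarrow> real ^ 'n \<Rightarrow> real" where
  "prolongation m l v = (\<lambda>x. if x \<in> Omega_h m l then v x else 0)"

definition V_coarse :: "nat \<Rightarrow> ('n::finite) config \<Rightarrow> nat \<Rightarrow> (real ^ 'n \<Rightarrow> real) set" where
  "V_coarse p m l = prolongation m l ` V_space p m (l - 1)"

text \<open>Legendre polynomial by Rodrigues' formula; the \<open>p + 1\<close> Gauss--Lobatto nodes on \<open>[-1, 1]\<close>
  are the end points and the zeros of its derivative (for \<open>p \<ge> 1\<close>).\<close>

definition legendre :: "nat \<Rightarrow> real poly" where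
  "legendre p = smult (1 / (2 ^ p * fact p)) ((pderiv ^^ p) ([:-1, 0, 1:] ^ p))"

definition gauss_lobatto :: "nat \<Rightarrow> real set" where
  "gauss_lobatto p = {-1, 1} \<union> {\<xi>. poly (pderiv (legendre p)) \<xi> = 0}"

definition nodes :: "nat \<Rightarrow> ('n::finite) config \<Rightarrow> nat \<Rightarrow> (real ^ 'n) set" where
  "nodes p m l = {vertex m l z + (width m l / 2) *\<^sub>R (\<chi> i. 1 + \<xi> $ i) | z \<xi>.
     z \<in> active_cells m l \<and> (\<forall>i. \<xi> $ i \<in> gauss_lobatto p)}"

text \<open>Nodes and nodal basis functions are indexed by the position of the node.\<close>

definition nodal_basis :: "nat \<Rightarrow> ('n::finite) config \<Rightarrow> nat \<Rightarrow> real ^ 'n \<Rightarrow> real ^ 'n \<Rightarrow> real" where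
  "nodal_basis p m l y = (THE \<phi>. \<phi> \<in> V_space p m l \<and>
     (\<forall>x\<in>nodes p m l. \<phi> x = (if x = y then 1 else 0)))"

definition nodal_span :: "nat \<Rightarrow> ('n::finite) config \<Rightarrow> nat \<Rightarrow> (real ^ 'n) set \<Rightarrow> (real ^ 'n \<Rightarrow> real) set" where
  "nodal_span p m l Y = {v. \<exists>c. v = (\<lambda>x. \<Sum>y\<in>Y. c y * nodal_basis p m l y x)}"

section \<open>Bilinear forms\<close>

definition grad :: "(real ^ 'n::finite \<Rightarrow> real) \<Rightarrow> real ^ 'n \<Rightarrow> real ^ 'n" where
  "grad v x = (\<chi> i. frechet_derivative v (at x) (axis i 1))"

definition grad_inner :: "(real ^ 'n::finite) set \<Rightarrow> (real ^ 'n \<Rightarrow> real) \<Rightarrow> (real ^ 'n \<Rightarrow> real) \<Rightarrow> real" where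
  "grad_inner S u v = (LINT x:S|lebesgue. grad u x \<bullet> grad v x)"

text \<open>
  Normal derivative on the boundary of \<open>D\<close>, as the one-sided derivative from inside \<open>D\<close>. It equals
  \<open>\<nabla>v \<bullet> n\<close> wherever \<open>v\<close> is differentiable, and is still defined, and linear in \<open>v\<close>, for a piecewise
  polynomial \<open>v\<close> at those boundary points that lie on the mesh skeleton.
\<close>

definition normal_deriv :: "(real ^ 'n::finite) set \<Rightarrow> (real ^ 'n \<Rightarrow> real) \<Rightarrow> real ^ 'n \<Rightarrow> real" where
  "normal_deriv D v x = Lim (at_right 0) (\<lambda>t. (v x - v (x - t *\<^sub>R outward_normal D x)) / t)"

definition a_form :: "real \<Rightarrow> ('n::finite) config \<Rightarrow> nat \<Rightarrow> (real ^ 'n \<Rightarrow> real) \<Rightarrow> (real ^ 'n \<Rightarrow> real) \<Rightarrow> real" where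
  "a_form \<gamma>\<^sub>D m l u v =
     grad_inner (Omega m) u v
     - L2_surface (Gamma_bd m) (normal_deriv (Omega m) u) v
     - L2_surface (Gamma_bd m) u (normal_deriv (Omega m) v)
     + \<gamma>\<^sub>D * inverse (width m l) * L2_surface (Gamma_bd m) u v"

definition cell_poly :: "nat \<Rightarrow> ('n::finite) config \<Rightarrow> nat \<Rightarrow> (real ^ 'n \<Rightarrow> real) \<Rightarrow> int ^ 'n \<Rightarrow> real ^ 'n \<Rightarrow> real" where
  "cell_poly p m l v z = (THE q. q \<in> Q_poly p \<and> (\<forall>x\<in>cell m l z. q x = v x))"

definition axis_deriv :: "nat \<Rightarrow> 'n::finite \<Rightarrow> (real ^ 'n \<Rightarrow> real) \<Rightarrow> real ^ 'n \<Rightarrow> real" where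
  "axis_deriv k i q x = (deriv ^^ k) (\<lambda>t. q (x + t *\<^sub>R axis i 1)) 0"

definition jump :: "nat \<Rightarrow> ('n::finite) config \<Rightarrow> nat \<Rightarrow> nat \<Rightarrow> 'n \<times> (int ^ 'n) \<Rightarrow> (real ^ 'n \<Rightarrow> real) \<Rightarrow> real ^ 'n \<Rightarrow> real" where
  "jump p m l k F v x = (case F of (i, z) \<Rightarrow>
     axis_deriv k i (cell_poly p m l v (z + axis i 1)) x - axis_deriv k i (cell_poly p m l v z) x)"

definition g_form :: "nat \<Rightarrow> real \<Rightarrow> ('n::finite) config \<Rightarrow> nat \<Rightarrow> (real ^ 'n \<Rightarrow> real) \<Rightarrow> (real ^ 'n \<Rightarrow> real) \<Rightarrow> real" where
  "g_form p \<gamma> m l u v = \<gamma> * (\<Sum>F\<in>ghost_faces m l. \<Sum>k=1..p.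
     width m l ^ (2 * k - 1) / (fact k)\<^sup>2 *
     L2_surface (face m l F) (jump p m l k F u) (jump p m l k F v))"

definition A_form :: "nat \<Rightarrow> real \<Rightarrow> real \<Rightarrow> ('n::finite) config \<Rightarrow> nat \<Rightarrow> (real ^ 'n \<Rightarrow> real) \<Rightarrow> (real ^ 'n \<Rightarrow> real) \<Rightarrow> real" where
  "A_form p \<gamma> \<gamma>\<^sub>D m l u v = a_form \<gamma>\<^sub>D m l u v + g_form p \<gamma> m l u v"

definition A_norm :: "nat \<Rightarrow> real \<Rightarrow> real \<Rightarrow> ('n::finite) config \<Rightarrow> nat \<Rightarrow> (real ^ 'n \<Rightarrow> real) \<Rightarrow> real" where
  "A_norm p \<gamma> \<gamma>\<^sub>D m l v = sqrt (A_form p \<gamma> \<gamma>\<^sub>D m l v v)"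

text \<open>As in \<^const>\<open>onorm\<close>, the quotient for \<open>v = 0\<close> is \<open>0 / 0 = 0\<close>. The space is finite-dimensional,
  so the supremum is over a bounded set for linear \<open>E\<close>.\<close>

definition A_onorm :: "nat \<Rightarrow> real \<Rightarrow> real \<Rightarrow> ('n::finite) config \<Rightarrow> nat \<Rightarrow>
    ((real ^ 'n \<Rightarrow> real) \<Rightarrow> (real ^ 'n \<Rightarrow> real)) \<Rightarrow> real" where
  "A_onorm p \<gamma> \<gamma>\<^sub>D m l E =
     (SUP v\<in>V_space p m l. A_norm p \<gamma> \<gamma>\<^sub>D m l (E v) / A_norm p \<gamma> \<gamma>\<^sub>D m l v)"

section \<open>Stability assumption\<close>

definition N_norm :: "nat \<Rightarrow> real \<Rightarrow> ('n::finite) config \<Rightarrow> nat \<Rightarrow> (real ^ 'n \<Rightarrow> real) \<Rightarrow> real" where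
  "N_norm p \<gamma> m l v = sqrt (
     grad_inner (Omega m) v v
     + width m l * L2_surface (Gamma_bd m) (normal_deriv (Omega m) v) (normal_deriv (Omega m) v)
     + inverse (width m l) * L2_surface (Gamma_bd m) v v
     + g_form p \<gamma> m l v v)"

text \<open>The constants are common to all configurations of the family \<open>\<M>\<close> and all their levels.\<close>

definition cutfem_stability :: "nat \<Rightarrow> real \<Rightarrow> real \<Rightarrow> ('n::finite) config set \<Rightarrow> bool" where
  "cutfem_stability p \<gamma> \<gamma>\<^sub>D \<M> \<longleftrightarrow> (\<exists>c\<^sub>A>0. \<exists>C\<^sub>A>0. \<exists>C>0. \<forall>m\<in>\<M>. \<forall>l\<le>finest m.
     \<forall>u\<in>V_space p m l. \<forall>v\<in>V_space p m l.
       c\<^sub>A * (N_norm p \<gamma> m l v)\<^sup>2 \<le> A_form p \<gamma> \<gamma>\<^sub>D m l v v \<and>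
       A_form p \<gamma> \<gamma>\<^sub>D m l u v \<le> C\<^sub>A * N_norm p \<gamma> m l u * N_norm p \<gamma> m l v \<and>
       grad_inner (Omega_h m l - Omega m) v v
         \<le> C * (grad_inner (Omega m) v v + g_form p \<gamma> m l v v))"

section \<open>Patches and local spaces\<close>

definition vertex_cells :: "int ^ 'n::finite \<Rightarrow> (int ^ 'n) set" where
  "vertex_cells j = {z. \<forall>i. z $ i = j $ i \<or> z $ i = j $ i - 1}"

definition admissible :: "('n::finite) config \<Rightarrow> nat \<Rightarrow> (int ^ 'n) set" where
  "admissible m l = {j. vertex m l j \<in> Omega m \<or>
     (vertex m l j \<notin> closure (Omega m) \<and> vertex_cells j \<inter> cut_cells m l \<noteq> {})}"

definition full_patch :: "('n::finite) config \<Rightarrow> nat \<Rightarrow> int ^ 'n \<Rightarrow> (real ^ 'n) set" where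
  "full_patch m l j = (\<Union>z\<in>vertex_cells j. cell m l z)"

definition patch :: "('n::finite) config \<Rightarrow> nat \<Rightarrow> int ^ 'n \<Rightarrow> (real ^ 'n) set" where
  "patch m l j = (\<Union>z\<in>vertex_cells j \<inter> active_cells m l. cell m l z)"

definition node_patch :: "('n::finite) config \<Rightarrow> nat \<Rightarrow> real ^ 'n \<Rightarrow> (real ^ 'n) set" where
  "node_patch m l x = (\<Union>z\<in>{z \<in> active_cells m l. x \<in> cell m l z}. cell m l z)"

datatype local_kind = Dirichlet | Full_Residual

fun V_local :: "local_kind \<Rightarrow> nat \<Rightarrow> ('n::finite) config \<Rightarrow> nat \<Rightarrow> int ^ 'n \<Rightarrow> (real ^ 'n \<Rightarrow> real) set" where
  "V_local Dirichlet p m l j =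
     nodal_span p m l {x \<in> nodes p m l. x \<in> interior (full_patch m l j)}"
| "V_local Full_Residual p m l j =
     nodal_span p m l {x \<in> nodes p m l. node_patch m l x \<subseteq> patch m l j}"

definition covering_assumption :: "local_kind \<Rightarrow> nat \<Rightarrow> ('n::finite) config \<Rightarrow> nat \<Rightarrow> bool" where
  "covering_assumption \<kappa> p m l \<longleftrightarrow>
     (\<forall>x\<in>nodes p m l. \<exists>j\<in>admissible m l. nodal_basis p m l x \<in> V_local \<kappa> p m l j)"

definition A_proj :: "nat \<Rightarrow> real \<Rightarrow> real \<Rightarrow> ('n::finite) config \<Rightarrow> nat \<Rightarrow> (real ^ 'n \<Rightarrow> real) set \<Rightarrow>
    (real ^ 'n \<Rightarrow> real) \<Rightarrow> real ^ 'n \<Rightarrow> real" where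
  "A_proj p \<gamma> \<gamma>\<^sub>D m l W v =
     (THE w. w \<in> W \<and> (\<forall>z\<in>W. A_form p \<gamma> \<gamma>\<^sub>D m l (\<lambda>x. v x - w x) z = 0))"

definition stable_decomposition_constant ::
    "local_kind \<Rightarrow> nat \<Rightarrow> real \<Rightarrow> real \<Rightarrow> ('n::finite) config set \<Rightarrow> real \<Rightarrow> bool" where
  "stable_decomposition_constant \<kappa> p \<gamma> \<gamma>\<^sub>D \<M> C \<longleftrightarrow> 0 < C \<and>
     (\<forall>m\<in>\<M>. \<forall>l\<in>{1..finest m}. \<forall>v\<in>V_space p m l. \<exists>v\<^sub>0\<in>V_coarse p m l. \<exists>w.
        (\<forall>j\<in>admissible m l. w j \<in> V_local \<kappa> p m l j) \<and>
        v = (\<lambda>x. v\<^sub>0 x + (\<Sum>j\<in>admissible m l. w j x)) \<and>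
        (A_norm p \<gamma> \<gamma>\<^sub>D m l v\<^sub>0)\<^sup>2 + (\<Sum>j\<in>admissible m l. (A_norm p \<gamma> \<gamma>\<^sub>D m l (w j))\<^sup>2)
          \<le> C * (A_norm p \<gamma> \<gamma>\<^sub>D m l v)\<^sup>2)"

section \<open>Colored sweep\<close>

definition collar :: "('n::finite) config \<Rightarrow> nat \<Rightarrow> (int ^ 'n) set" where
  "collar m l = {j \<in> admissible m l. \<exists>K \<in> vertex_cells j \<inter> active_cells m l.
     \<exists>(i, z) \<in> ghost_faces m l. K = z \<or> K = z + axis i 1}"

definition collar_coloring :: "('n::finite) config \<Rightarrow> nat \<Rightarrow> (int ^ 'n \<Rightarrow> nat) \<Rightarrow> bool" where
  "collar_coloring m l \<chi>\<^sub>0 \<longleftrightarrow>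
     (\<forall>j\<in>collar m l. \<chi>\<^sub>0 j < 3 ^ CARD('n)) \<and>
     (\<forall>j\<in>collar m l. \<forall>k\<in>collar m l. j \<noteq> k \<and> \<chi>\<^sub>0 j = \<chi>\<^sub>0 k \<longrightarrow> (\<exists>i. \<bar>j $ i - k $ i\<bar> \<ge> 3))"

text \<open>The disjoint sum keeps the palettes of the collar and of the interior patches apart.\<close>

definition patch_color :: "('n::finite) config \<Rightarrow> nat \<Rightarrow> (int ^ 'n \<Rightarrow> nat) \<Rightarrow> int ^ 'n \<Rightarrow> nat + (int ^ 'n)" where
  "patch_color m l \<chi>\<^sub>0 j = (if j \<in> collar m l then Inl (\<chi>\<^sub>0 j) else Inr (\<chi> i. j $ i mod 2))"

definition color_class :: "('n::finite) config \<Rightarrow> nat \<Rightarrow> (int ^ 'n \<Rightarrow> nat) \<Rightarrow> nat + (int ^ 'n) \<Rightarrow> (int ^ 'n) set" where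
  "color_class m l \<chi>\<^sub>0 c = {j \<in> admissible m l. patch_color m l \<chi>\<^sub>0 j = c}"

definition color_order :: "('n::finite) config \<Rightarrow> nat \<Rightarrow> (int ^ 'n \<Rightarrow> nat) \<Rightarrow> (nat + (int ^ 'n)) list \<Rightarrow> bool" where
  "color_order m l \<chi>\<^sub>0 cs \<longleftrightarrow> distinct cs \<and> set cs = patch_color m l \<chi>\<^sub>0 ` admissible m l"

text \<open>The head of \<open>cs\<close> is the color processed first, i.e. the rightmost color factor.\<close>

definition E_col :: "local_kind \<Rightarrow> nat \<Rightarrow> real \<Rightarrow> real \<Rightarrow> ('n::finite) config \<Rightarrow> nat \<Rightarrow> (int ^ 'n \<Rightarrow> nat) \<Rightarrow>
    (nat + (int ^ 'n)) list \<Rightarrow> (real ^ 'n \<Rightarrow> real) \<Rightarrow> real ^ 'n \<Rightarrow> real" where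
  "E_col \<kappa> p \<gamma> \<gamma>\<^sub>D m l \<chi>\<^sub>0 cs v =
     fold (\<lambda>c u x. u x - (\<Sum>j\<in>color_class m l \<chi>\<^sub>0 c. A_proj p \<gamma> \<gamma>\<^sub>D m l (V_local \<kappa> p m l j) u x)) cs
       (\<lambda>x. v x - A_proj p \<gamma> \<gamma>\<^sub>D m l (V_coarse p m l) v x)"

end

theory Submission
  imports Defs
begin

text \<open>
  The sweep consists of one exact coarse correction and one correction per color. Two patches of the
  same color are orthogonal for the energy form \<open>A\<close> (\<open>same_color_orthogonal\<close>): they share no active
  cell, which decouples the volume and the boundary terms, and on a ghost face at most one of the
  two functions has a jump, because collar patches of one color are too far apart to touch a common
  face and interior patches do not touch ghost faces at all. Hence the simultaneous solves of one
  color are the exact projection onto the sum of their local spaces, and a stable decomposition into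
  patch contributions keeps its energy when it is grouped by color.

  What remains is a fact about exact successive corrections (\<open>successive_corrections_bound\<close>). Let
  \<open>e\<^sub>0 = v\<close> and \<open>e\<^sub>k\<^sub>+\<^sub>1 = e\<^sub>k - t\<^sub>k\<close>, where \<open>t\<^sub>k\<close> is the projection of \<open>e\<^sub>k\<close> to the \<open>k\<close>-th space. By
  Pythagoras the energy lost in \<open>n\<close> steps is \<open>A v v - A e\<^sub>n e\<^sub>n = \<Sum> A t\<^sub>k t\<^sub>k\<close>. On the other hand, if \<open>v\<close> is
  the sum of \<open>y\<^sub>k\<close> from the \<open>k\<close>-th space, then \<open>A v y\<^sub>k\<close> is the sum of the \<open>A t\<^sub>i y\<^sub>k\<close> with \<open>i \<le> k\<close>,
  because \<open>e\<^sub>k\<^sub>+\<^sub>1\<close> is orthogonal to \<open>y\<^sub>k\<close>. Two applications of the Cauchy--Schwarz inequality give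
  \<open>A v v \<le> n (n + 1) / 2 \<cdot> C \<cdot> (A v v - A e\<^sub>n e\<^sub>n)\<close> whenever \<open>\<Sum> A y\<^sub>k y\<^sub>k \<le> C \<cdot> A v v\<close>. With \<open>N\<close> colors
  there are \<open>n = N + 1\<close> spaces, and \<open>(N + 1) (N + 2) / 2 \<le> 2 N\<^sup>2 + 1\<close>.

  All of this presupposes that \<open>A\<close> is an inner product on the finite element space. Bilinearity rests
  on integrability: the boundary is locally the graph of a Lipschitz function and so has finite
  surface measure (\<open>hausdorff_frontier_finite\<close>), the outward normal is continuous on it, and the normal
  derivative of a piecewise polynomial is bounded and measurable
  (\<open>surface_admissible_normal_deriv\<close>). For definiteness (\<open>A_form_definite\<close>), stability turns
  \<open>A v v = 0\<close> into a vanishing gradient in the domain and a vanishing boundary norm. The domain being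
  connected, \<open>v\<close> is constant, and the constant is \<open>0\<close> because the boundary has positive surface measure
  (\<open>hausdorff_outer_frontier_pos\<close>). The latter is meaningful since the Hausdorff outer measure is
  additive on separated sets, hence a measure on the Borel sets (\<open>emeasure_hausdorff_measure\<close>).

  Finally, the local spaces are spans of nodal basis functions. These exist because there are exactly
  \<open>p + 1\<close> Gauss--Lobatto nodes (\<open>gauss_lobatto_nodes\<close>); each is a tensor product of one-dimensional
  piecewise Lagrange polynomials and vanishes on the cells that do not contain its node, which makes
  the functions of a local space vanish outside its patch (\<open>V_local_zero\<close>).
\<close>

section \<open>Successive subspace corrections\<close>

text \<open>
  An inner product \<open>A\<close> on a space \<open>V\<close> of real functions under pointwise operations. Vectors are functions
  rather than elements of a type of class \<open>real_vector\<close>, since the finite element spaces are sets of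
  functions that depend on the level and on the configuration.
\<close>

locale energy_form =
  fixes V :: "('a \<Rightarrow> real) set" and A :: "('a \<Rightarrow> real) \<Rightarrow> ('a \<Rightarrow> real) \<Rightarrow> real"
  assumes zero_mem: "(\<lambda>_. 0) \<in> V"
    and add_mem: "u \<in> V \<Longrightarrow> v \<in> V \<Longrightarrow> (\<lambda>x. u x + v x) \<in> V"
    and scale_mem: "u \<in> V \<Longrightarrow> (\<lambda>x. c * u x) \<in> V"
    and form_sym: "A u v = A v u"
    and form_lin: "u \<in> V \<Longrightarrow> v \<in> V \<Longrightarrow> w \<in> V \<Longrightarrow> A (\<lambda>x. c * u x + v x) w = c * A u w + A v w"
    and form_nonneg: "u \<in> V \<Longrightarrow> A u u \<ge> 0"
    and form_definite: "u \<in> V \<Longrightarrow> A u u = 0 \<Longrightarrow> u = (\<lambda>_. 0)"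
begin

lemma diff_mem: "u \<in> V \<Longrightarrow> v \<in> V \<Longrightarrow> (\<lambda>x. u x - v x) \<in> V"
  using add_mem[of u "\<lambda>x. (-1) * v x"] scale_mem[of v "-1"] by simp

lemma sum_mem: "(\<And>i. i \<in> I \<Longrightarrow> f i \<in> V) \<Longrightarrow> (\<lambda>x. \<Sum>i\<in>I. f i x) \<in> V"
  by (induction I rule: infinite_finite_induct) (simp_all add: zero_mem add_mem)

lemma form_zero: "w \<in> V \<Longrightarrow> A (\<lambda>_. 0) w = 0"
  using form_lin[of w w w "-1"] by simp

lemma form_add: "u \<in> V \<Longrightarrow> v \<in> V \<Longrightarrow> w \<in> V \<Longrightarrow> A (\<lambda>x. u x + v x) w = A u w + A v w"
  using form_lin[of u v w 1] by simp

lemma form_scale: "u \<in> V \<Longrightarrow> w \<in> V \<Longrightarrow> A (\<lambda>x. c * u x) w = c * A u w"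
  using form_lin[of u "\<lambda>_. 0" w c] zero_mem form_zero by simp

lemma form_diff: "u \<in> V \<Longrightarrow> v \<in> V \<Longrightarrow> w \<in> V \<Longrightarrow> A (\<lambda>x. u x - v x) w = A u w - A v w"
  using form_add[of u "\<lambda>x. (-1) * v x" w] scale_mem[of v "-1"] form_scale[of v w "-1"] by simp

lemma form_sum:
  "(\<And>i. i \<in> I \<Longrightarrow> f i \<in> V) \<Longrightarrow> w \<in> V \<Longrightarrow> A (\<lambda>x. \<Sum>i\<in>I. f i x) w = (\<Sum>i\<in>I. A (f i) w)"
  by (induction I rule: infinite_finite_induct) (simp_all add: form_zero form_add sum_mem)

lemma form_sum_right:
  "(\<And>i. i \<in> I \<Longrightarrow> f i \<in> V) \<Longrightarrow> w \<in> V \<Longrightarrow> A w (\<lambda>x. \<Sum>i\<in>I. f i x) = (\<Sum>i\<in>I. A w (f i))"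
  using form_sum[of I f w] unfolding form_sym[of w "f i" for i] form_sym[of w "\<lambda>x. \<Sum>i\<in>I. f i x"] .

lemma Cauchy_Schwarz:
  assumes "u \<in> V" "v \<in> V"
  shows "A u v \<le> sqrt (A u u) * sqrt (A v v)"
proof (cases "A v v = 0")
  case True
  then have "v = (\<lambda>_. 0)" using form_definite assms by blast
  then have "A u v = 0" using form_zero[OF assms(1)] form_sym[of u v] by simp
  then show ?thesis by (simp add: True)
next
  case False
  define c where "c = A u v / A v v"
  have cv: "(\<lambda>x. c * v x) \<in> V" and uv: "(\<lambda>x. u x - c * v x) \<in> V"
    using scale_mem diff_mem[of u "\<lambda>x. c * v x"] assms by auto
  have "0 \<le> A (\<lambda>x. u x - c * v x) (\<lambda>x. u x - c * v x)" using form_nonneg uv .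
  also have "\<dots> = A u (\<lambda>x. u x - c * v x) - c * A v (\<lambda>x. u x - c * v x)"
    using form_diff[of u "\<lambda>x. c * v x"] form_scale assms cv uv by simp
  also have "A u (\<lambda>x. u x - c * v x) = A u u - c * A u v"
    using form_diff[of u "\<lambda>x. c * v x" u] form_scale assms cv form_sym[of u "\<lambda>x. u x - c * v x"] form_sym[of u v] by simp
  also have "A v (\<lambda>x. u x - c * v x) = A u v - c * A v v"
    using form_diff[of u "\<lambda>x. c * v x" v] form_scale assms cv form_sym[of v "\<lambda>x. u x - c * v x"] by simp
  also have "A u u - c * A u v - c * (A u v - c * A v v) = A u u - A u v * A u v / A v v"
    using False by (simp add: c_def field_simps)
  finally have "(A u v)\<^sup>2 \<le> A u u * A v v"
    using False form_nonneg[OF assms(2)] by (simp add: field_simps power2_eq_square)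
  then have "\<bar>A u v\<bar> \<le> sqrt (A u u * A v v)" by (simp add: real_le_rsqrt)
  then show ?thesis by (simp add: real_sqrt_mult)
qed

text \<open>
  Gram--Schmidt: the projection onto the span enlarged by one vector \<open>a\<close> is corrected in the direction
  of \<open>r\<close>, the part of \<open>a\<close> that is orthogonal to the previous span.
\<close>

lemma projection_exists:
  assumes "finite Y" and "\<And>y. y \<in> Y \<Longrightarrow> b y \<in> V" and "v \<in> V"
  shows "\<exists>w. (\<exists>c. w = (\<lambda>x. \<Sum>y\<in>Y. c y * b y x)) \<and>
           (\<forall>y\<in>Y. A (\<lambda>x. v x - w x) (b y) = 0)"
  using assms
proof (induction Y arbitrary: v rule: finite_induct)
  case empty
  then show ?case by simp
next
  case (insert a Y)
  have span_mem: "(\<lambda>x. \<Sum>y\<in>Y. c y * b y x) \<in> V" for c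
    using insert.prems by (intro sum_mem scale_mem) auto
  obtain cv where v: "\<forall>y\<in>Y. A (\<lambda>x. v x - (\<Sum>y\<in>Y. cv y * b y x)) (b y) = 0"
    using insert.IH[of v] insert.prems by auto
  obtain ca where a: "\<forall>y\<in>Y. A (\<lambda>x. b a x - (\<Sum>y\<in>Y. ca y * b y x)) (b y) = 0"
    using insert.IH[of "b a"] insert.prems by auto
  define r where "r = (\<lambda>x. b a x - (\<Sum>y\<in>Y. ca y * b y x))"
  define e where "e = (\<lambda>x. v x - (\<Sum>y\<in>Y. cv y * b y x))"
  have rV: "r \<in> V" and eV: "e \<in> V"
    unfolding r_def e_def using span_mem diff_mem insert.prems by auto
  \<comment> \<open>If r = 0, then a adds nothing to the span, and the value 0 of the quotient is the right one.\<close>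
  define \<beta> where "\<beta> = A e r / A r r"
  have zV: "(\<lambda>x. e x - \<beta> * r x) \<in> V" using diff_mem[OF eV scale_mem[OF rV]] .
  have orth: "A (\<lambda>x. e x - \<beta> * r x) (b y) = 0" if "y \<in> Y" for y
    using that v a insert.prems
      form_diff[OF eV scale_mem[OF rV], of "b y"] form_scale[OF rV, of "b y"]
    unfolding e_def[symmetric] r_def[symmetric] by simp
  have "A (\<lambda>x. e x - \<beta> * r x) (\<lambda>x. \<Sum>y\<in>Y. ca y * b y x) = (\<Sum>y\<in>Y. ca y * A (\<lambda>x. e x - \<beta> * r x) (b y))"
  proof (subst form_sum_right)
    show "(\<Sum>y\<in>Y. A (\<lambda>x. e x - \<beta> * r x) (\<lambda>x. ca y * b y x)) = (\<Sum>y\<in>Y. ca y * A (\<lambda>x. e x - \<beta> * r x) (b y))"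
      unfolding form_sym[of "\<lambda>x. e x - \<beta> * r x"] using insert.prems zV by (intro sum.cong form_scale) auto
  qed (use insert.prems zV scale_mem in auto)
  also have "\<dots> = 0" using orth by simp
  finally have orth1: "A (\<lambda>x. e x - \<beta> * r x) (\<lambda>x. \<Sum>y\<in>Y. ca y * b y x) = 0" .
  have "A (\<lambda>x. e x - \<beta> * r x) r = A e r - \<beta> * A r r"
    using form_diff[OF eV scale_mem[OF rV] rV] form_scale[OF rV rV] by simp
  also have "\<dots> = 0"
  proof (cases "A r r = 0")
    case True
    then have "r = (\<lambda>_. 0)" using form_definite rV by blast
    then show ?thesis using form_zero[OF eV] form_sym[of e r] True by simp
  qed (simp add: \<beta>_def)
  finally have "A (\<lambda>x. e x - \<beta> * r x) (\<lambda>x. r x + (\<Sum>y\<in>Y. ca y * b y x)) = 0"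
    using orth1 form_add[OF rV span_mem zV, of ca] unfolding form_sym[of "\<lambda>x. e x - \<beta> * r x"] by simp
  then have orth2: "A (\<lambda>x. e x - \<beta> * r x) (b a) = 0" by (simp add: r_def)
  define c where "c = (\<lambda>y. if y = a then \<beta> else cv y - \<beta> * ca y)"
  have "(\<Sum>y\<in>insert a Y. c y * b y x) = (\<Sum>y\<in>Y. cv y * b y x) + \<beta> * r x" for x
  proof -
    have "(\<Sum>y\<in>Y. c y * b y x) = (\<Sum>y\<in>Y. cv y * b y x - \<beta> * (ca y * b y x))"
      using insert.hyps by (intro sum.cong) (auto simp: c_def algebra_simps)
    then show ?thesis using insert.hyps
      by (simp add: c_def r_def sum_subtractf algebra_simps sum_distrib_left)
  qed
  then have "(\<lambda>x. v x - (\<Sum>y\<in>insert a Y. c y * b y x)) = (\<lambda>x. e x - \<beta> * r x)"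
    by (auto simp: e_def)
  then show ?case using orth orth2
    by (intro exI[of _ "\<lambda>x. \<Sum>y\<in>insert a Y. c y * b y x"]) auto
qed

text \<open>
  The same projection in the form of a definite description. The difference of two candidates lies in
  \<open>W\<close> and is orthogonal to \<open>W\<close>.
\<close>

lemma projection_unique_exists:
  assumes "finite Y" and b: "\<And>y. y \<in> Y \<Longrightarrow> b y \<in> V" and "v \<in> V"
    and W: "W = {w. \<exists>c. w = (\<lambda>x. \<Sum>y\<in>Y. c y * b y x)}"
  shows "\<exists>!w. w \<in> W \<and> (\<forall>z\<in>W. A (\<lambda>x. v x - w x) z = 0)"
proof -
  have span_mem: "(\<lambda>x. \<Sum>y\<in>Y. c y * b y x) \<in> V" for c
    using b by (intro sum_mem scale_mem) auto
  have WV: "w \<in> V" if "w \<in> W" for w using that span_mem unfolding W by auto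
  have "\<exists>w. (\<exists>c. w = (\<lambda>x. \<Sum>y\<in>Y. c y * b y x)) \<and> (\<forall>y\<in>Y. A (\<lambda>x. v x - w x) (b y) = 0)"
    by (rule projection_exists) (fact assms(1) b assms(3))+
  then obtain w where w0: "\<exists>c. w = (\<lambda>x. \<Sum>y\<in>Y. c y * b y x)" and o0: "\<forall>y\<in>Y. A (\<lambda>x. v x - w x) (b y) = 0"
    by (elim exE conjE) (rule that, rule exI, assumption+)
  have w: "w \<in> W" using w0 unfolding W by simp
  have o: "\<And>y. y \<in> Y \<Longrightarrow> A (\<lambda>x. v x - w x) (b y) = 0" using o0 by (rule bspec)
  have vw: "(\<lambda>x. v x - w x) \<in> V" using diff_mem[OF assms(3) WV[OF w]] .
  have orth: "A (\<lambda>x. v x - w x) z = 0" if z: "z \<in> W" for z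
  proof -
    obtain c where c: "z = (\<lambda>x. \<Sum>y\<in>Y. c y * b y x)" using z unfolding W by auto
    have "A z (\<lambda>x. v x - w x) = (\<Sum>y\<in>Y. A (\<lambda>x. c y * b y x) (\<lambda>x. v x - w x))"
      unfolding c by (rule form_sum) (use vw b scale_mem in auto)
    also have "\<dots> = (\<Sum>y\<in>Y. c y * A (b y) (\<lambda>x. v x - w x))"
      by (intro sum.cong refl form_scale b vw)
    also have "\<dots> = 0"
    proof (rule sum.neutral, rule ballI)
      fix y assume "y \<in> Y"
      then show "c y * A (b y) (\<lambda>x. v x - w x) = 0"
        using o[of y] form_sym[of "b y" "\<lambda>x. v x - w x"] by simp
    qed
    finally show ?thesis using form_sym[of z] by simp
  qed
  show ?thesis
  proof (rule ex1I[of _ w])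
    fix w' assume w': "w' \<in> W \<and> (\<forall>z\<in>W. A (\<lambda>x. v x - w' x) z = 0)"
    obtain c c' where c: "w = (\<lambda>x. \<Sum>y\<in>Y. c y * b y x)" "w' = (\<lambda>x. \<Sum>y\<in>Y. c' y * b y x)"
      using w w' unfolding W by auto
    have "(\<lambda>x. w' x - w x) = (\<lambda>x. \<Sum>y\<in>Y. (c' y - c y) * b y x)"
      by (simp add: c sum_subtractf left_diff_distrib)
    then have d: "(\<lambda>x. w' x - w x) \<in> W"
      unfolding W by (intro CollectI exI)
    have vw': "(\<lambda>x. v x - w' x) \<in> V" using diff_mem[OF assms(3) WV] w' by blast
    have "A (\<lambda>x. (v x - w x) - (v x - w' x)) (\<lambda>x. w' x - w x) = 0"
      using form_diff[OF vw vw' WV[OF d]] orth[OF d] w' d by simp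
    then have "(\<lambda>x. w' x - w x) = (\<lambda>_. 0)" using form_definite[OF WV[OF d]] by simp
    then show "w' = w" by (auto simp: fun_eq_iff)
  qed (intro conjI ballI w orth)
qed

text \<open>
  The relations \<open>ot\<close> and \<open>ow\<close> express that the corrections are exact: after step \<open>c\<close> the error is
  orthogonal to the correction just made, which yields the energy loss, and to the component of \<open>v\<close> in
  the same space, which bounds \<open>A v (w c)\<close> by the corrections made so far.
\<close>

lemma successive_corrections_bound:
  assumes vV: "v \<in> V" and C: "C \<ge> 0"
    and e0: "e 0 = v"
    and tV: "\<And>c. c < n \<Longrightarrow> t c \<in> V" and wV: "\<And>c. c < n \<Longrightarrow> w c \<in> V"
    and step: "\<And>c. c < n \<Longrightarrow> e (Suc c) = (\<lambda>x. e c x - t c x)"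
    and ot: "\<And>c. c < n \<Longrightarrow> A (e (Suc c)) (t c) = 0"
    and ow: "\<And>c. c < n \<Longrightarrow> A (e (Suc c)) (w c) = 0"
    and v: "v = (\<lambda>x. \<Sum>c<n. w c x)"
    and stable: "(\<Sum>c<n. A (w c) (w c)) \<le> C * A v v"
  shows "A v v \<le> real (n * (n + 1)) / 2 * C * (A v v - A (e n) (e n))"
proof -
  have eV: "c \<le> n \<Longrightarrow> e c \<in> V" for c
    by (induction c) (auto simp: e0 vV step intro!: diff_mem tV)
  have split: "e c = (\<lambda>x. e (Suc c) x + t c x)" if "c < n" for c using step[OF that] by auto
  have loss: "A (e c) (e c) = A (e (Suc c)) (e (Suc c)) + A (t c) (t c)" if c: "c < n" for c
  proof -
    have *: "e c \<in> V" "e (Suc c) \<in> V" "t c \<in> V" using c eV tV by auto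
    have e: "A (e c) z = A (e (Suc c)) z + A (t c) z" if "z \<in> V" for z
      using form_add[OF *(2,3) that] split[OF c] by simp
    show ?thesis using e[OF *(1)] e[OF *(2)] e[OF *(3)] ot[OF c]
        form_sym[of "t c" "e (Suc c)"] form_sym[of "e (Suc c)" "e c"] form_sym[of "t c" "e c"] by simp
  qed
  have total: "(\<Sum>c<k. A (t c) (t c)) = A v v - A (e k) (e k)" if "k \<le> n" for k
    using that by (induction k) (auto simp: e0 loss)
  have expand: "A v z = A (e k) z + (\<Sum>c<k. A (t c) z)" if "k \<le> n" "z \<in> V" for k z
    using that(1)
  proof (induction k)
    case (Suc k)
    then have "A (e k) z = A (e (Suc k)) z + A (t k) z"
      using form_add[OF eV tV that(2), of "Suc k" k] split[of k] by simp
    with Suc show ?case by simp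
  qed (simp add: e0)
  let ?T = "A v v - A (e n) (e n)"
  have T: "(\<Sum>c<n. A (t c) (t c)) = ?T" using total by simp
  have T0: "?T \<ge> 0" unfolding T[symmetric] using form_nonneg tV by (intro sum_nonneg) auto
  have bound: "A v (w c) \<le> sqrt (real (Suc c) * ?T) * sqrt (A (w c) (w c))" if c: "c < n" for c
  proof -
    have "A v (w c) = (\<Sum>k<Suc c. A (t k) (w c))"
      using expand[of "Suc c" "w c"] c wV ow by simp
    also have "\<dots> \<le> (\<Sum>k<Suc c. sqrt (A (t k) (t k)) * sqrt (A (w c) (w c)))"
      using c by (intro sum_mono Cauchy_Schwarz tV wV) auto
    also have "\<dots> = (\<Sum>k<Suc c. sqrt (A (t k) (t k))) * sqrt (A (w c) (w c))"
      by (simp only: sum_distrib_right)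
    also have "(\<Sum>k<Suc c. sqrt (A (t k) (t k))) \<le> sqrt (real (Suc c) * ?T)"
    proof (rule real_le_rsqrt)
      \<comment> \<open>The explicit factor 1 makes this an inner product of two sequences.\<close>
      have "(\<Sum>k<Suc c. 1 * sqrt (A (t k) (t k)))\<^sup>2 \<le> (\<Sum>k<Suc c. 1\<^sup>2) * (\<Sum>k<Suc c. (sqrt (A (t k) (t k)))\<^sup>2)"
        by (rule Cauchy_Schwarz_ineq_sum)
      also have "\<dots> = real (Suc c) * (\<Sum>k<Suc c. A (t k) (t k))"
        using c tV form_nonneg by (intro arg_cong2[where f="(*)"] sum.cong) auto
      also have "\<dots> \<le> real (Suc c) * ?T"
        unfolding T[symmetric] using c tV form_nonneg by (intro mult_left_mono sum_mono2) auto
      finally show "(\<Sum>k<Suc c. sqrt (A (t k) (t k)))\<^sup>2 \<le> real (Suc c) * ?T" by simp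
    qed
    finally show ?thesis using form_nonneg[OF wV[OF c]] by (simp add: mult_right_mono)
  qed
  have "A v v = (\<Sum>c<n. A v (w c))"
    using form_sum_right[of "{..<n}" w v] v wV vV by simp
  also have "\<dots> \<le> (\<Sum>c<n. sqrt (real (Suc c) * ?T) * sqrt (A (w c) (w c)))"
    by (intro sum_mono bound) auto
  finally have "A v v \<le> \<dots>" .
  then have "(A v v)\<^sup>2 \<le> (\<Sum>c<n. sqrt (real (Suc c) * ?T) * sqrt (A (w c) (w c)))\<^sup>2"
    using form_nonneg[OF vV] by (intro power_mono) auto
  also have "\<dots> \<le> (\<Sum>c<n. (sqrt (real (Suc c) * ?T))\<^sup>2) * (\<Sum>c<n. (sqrt (A (w c) (w c)))\<^sup>2)"
    by (rule Cauchy_Schwarz_ineq_sum)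
  also have "(\<Sum>c<n. (sqrt (real (Suc c) * ?T))\<^sup>2) = (\<Sum>c<n. real (Suc c)) * ?T"
    using T0 by (simp add: sum_distrib_right del: of_nat_Suc)
  also have "(\<Sum>c<n. real (Suc c)) = real (n * (n + 1)) / 2"
    by (induction n) (auto simp: field_simps)
  also have "(\<Sum>c<n. (sqrt (A (w c) (w c)))\<^sup>2) = (\<Sum>c<n. A (w c) (w c))"
    using wV form_nonneg by (intro sum.cong) auto
  also have "real (n * (n + 1)) / 2 * ?T * \<dots> \<le> real (n * (n + 1)) / 2 * ?T * (C * A v v)"
    using T0 stable by (intro mult_left_mono) auto
  finally have "A v v * A v v \<le> (real (n * (n + 1)) / 2 * C * ?T) * A v v"
    by (simp add: power2_eq_square algebra_simps)
  moreover have "0 \<le> real (n * (n + 1)) / 2 * C * ?T"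
    using C T0 by (intro mult_nonneg_nonneg) auto
  ultimately show ?thesis
    using form_nonneg[OF vV] by (cases "A v v = 0") (simp_all add: mult_le_cancel_right)
qed

end

section \<open>Hausdorff measure\<close>

abbreviation hausdorff_weight :: "nat \<Rightarrow> 'a::metric_space set \<Rightarrow> ennreal" where
  "hausdorff_weight s U \<equiv> ennreal (unit_ball_vol (real s) * (diameter U / 2) ^ s)"

abbreviation (input) delta_cover :: "real \<Rightarrow> 'a::metric_space set \<Rightarrow> (nat \<Rightarrow> 'a set) \<Rightarrow> bool" where
  "delta_cover \<delta> A U \<equiv> A \<subseteq> (\<Union>i. U i) \<and> (\<forall>i. bounded (U i) \<and> diameter (U i) \<le> \<delta>)"

lemma hausdorff_pre_le:
  assumes "delta_cover \<delta> A U"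
  shows "hausdorff_pre s \<delta> A \<le> (\<Sum>i. hausdorff_weight s (U i))"
  unfolding hausdorff_pre_def by (rule INF_lower) (use assms in auto)

lemma hausdorff_pre_mono: "A \<subseteq> B \<Longrightarrow> hausdorff_pre s \<delta> A \<le> hausdorff_pre s \<delta> B"
  unfolding hausdorff_pre_def by (rule INF_superset_mono) auto

lemma hausdorff_pre_antimono: "\<delta> \<le> \<delta>' \<Longrightarrow> hausdorff_pre s \<delta>' A \<le> hausdorff_pre s \<delta> A"
  unfolding hausdorff_pre_def by (rule INF_superset_mono) (auto intro: order_trans)

lemma hausdorff_pre_le_outer: "\<delta> > 0 \<Longrightarrow> hausdorff_pre s \<delta> A \<le> hausdorff_outer s A"
  unfolding hausdorff_outer_def by (rule SUP_upper) auto

text \<open>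
  The dimension \<open>s\<close> has to be positive: for \<open>s = 0\<close> even the empty covering sets have weight \<open>1\<close>,
  because \<open>0 ^ 0 = 1\<close>.
\<close>

lemma hausdorff_pre_empty:
  assumes "s \<ge> 1" "\<delta> > 0"
  shows "hausdorff_pre s \<delta> {} = 0"
  using hausdorff_pre_le[of "{}" "\<lambda>_. {}" \<delta> s] assms by (simp add: power_0_left)

text \<open>
  Covers of the \<open>A i\<close> that are optimal up to \<open>e / 2 ^ (i + 1)\<close> are arranged into a single sequence.
\<close>

lemma hausdorff_pre_Union:
  fixes A :: "nat \<Rightarrow> 'a::metric_space set"
  shows "hausdorff_pre s \<delta> (\<Union>i. A i) \<le> (\<Sum>i. hausdorff_pre s \<delta> (A i))"
proof (rule ennreal_le_epsilon)
  fix e :: real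
  assume e: "0 < e" and fin: "(\<Sum>i. hausdorff_pre s \<delta> (A i)) < top"
  have *: "hausdorff_pre s \<delta> (A n) < hausdorff_pre s \<delta> (A n) + e * (1/2) ^ Suc n" for n
    using e fin by (auto simp: less_top dest!: ennreal_suminf_lessD)
  have "\<exists>U. delta_cover \<delta> (A n) U \<and> (\<Sum>i. hausdorff_weight s (U i)) \<le> hausdorff_pre s \<delta> (A n) + e * (1/2) ^ Suc n" for n
    using * [of n] unfolding hausdorff_pre_def[of s \<delta> "A n"] INF_less_iff by (auto intro: less_imp_le)
  then obtain B where B: "\<And>n. delta_cover \<delta> (A n) (B n)"
      and le: "\<And>n. (\<Sum>i. hausdorff_weight s (B n i)) \<le> hausdorff_pre s \<delta> (A n) + e * (1/2) ^ Suc n"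
    by metis
  define C where "C = case_prod B \<circ> prod_decode"
  have "(\<Union>i. A i) \<subseteq> (\<Union>i. C i)"
  proof
    fix x assume "x \<in> (\<Union>i. A i)"
    then obtain n i where "x \<in> B n i" using B by blast
    then have "x \<in> C (prod_encode (n, i))" by (simp add: C_def)
    then show "x \<in> (\<Union>i. C i)" by blast
  qed
  moreover have "bounded (C i) \<and> diameter (C i) \<le> \<delta>" for i
    using B by (auto simp: C_def split: prod.split)
  ultimately have "hausdorff_pre s \<delta> (\<Union>i. A i) \<le> (\<Sum>i. hausdorff_weight s (C i))"
    by (intro hausdorff_pre_le) auto
  also have "\<dots> = (\<Sum>n. \<Sum>i. hausdorff_weight s (B n i))"
    using suminf_ennreal_2dimen[of "\<lambda>n. \<Sum>i. hausdorff_weight s (B n i)" "\<lambda>(n, i). hausdorff_weight s (B n i)"]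
    by (simp add: C_def comp_def split_def)
  also have "\<dots> \<le> (\<Sum>n. hausdorff_pre s \<delta> (A n) + e * (1/2) ^ Suc n)"
    by (intro suminf_le le summableI)
  also have "\<dots> = (\<Sum>n. hausdorff_pre s \<delta> (A n)) + (\<Sum>n. ennreal e * ennreal ((1/2) ^ Suc n))"
    using e by (subst suminf_add[symmetric])
       (auto simp del: ennreal_suminf_cmult simp add: ennreal_mult[symmetric])
  also have "\<dots> = (\<Sum>n. hausdorff_pre s \<delta> (A n)) + e"
    unfolding ennreal_suminf_cmult
    by (subst suminf_ennreal_eq[OF zero_le_power power_half_series]) auto
  finally show "hausdorff_pre s \<delta> (\<Union>i. A i) \<le> (\<Sum>i. hausdorff_pre s \<delta> (A i)) + e" .
qed

lemma outer_measure_space_hausdorff: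
  assumes "s \<ge> 1"
  shows "outer_measure_space UNIV (hausdorff_outer s :: 'a::metric_space set \<Rightarrow> ennreal)"
  unfolding outer_measure_space_def
proof (intro conjI)
  show "positive UNIV (hausdorff_outer s :: 'a set \<Rightarrow> ennreal)"
    using assms by (auto simp: positive_def hausdorff_outer_def hausdorff_pre_empty)
  show "increasing UNIV (hausdorff_outer s :: 'a set \<Rightarrow> ennreal)"
    by (auto simp: increasing_def hausdorff_outer_def intro!: SUP_mono hausdorff_pre_mono)
  show "countably_subadditive UNIV (hausdorff_outer s :: 'a set \<Rightarrow> ennreal)"
  proof (clarsimp simp: countably_subadditive_def)
    fix A :: "nat \<Rightarrow> 'a set"
    show "hausdorff_outer s (\<Union>i. A i) \<le> (\<Sum>i. hausdorff_outer s (A i))"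
      unfolding hausdorff_outer_def[of s "\<Union>i. A i"]
    proof (rule SUP_least)
      fix \<delta> :: real assume "\<delta> \<in> {0<..}"
      then show "hausdorff_pre s \<delta> (\<Union>i. A i) \<le> (\<Sum>i. hausdorff_outer s (A i))"
        by (intro order_trans[OF hausdorff_pre_Union] suminf_le summableI hausdorff_pre_le_outer) auto
    qed
  qed
qed

text \<open>
  A set of diameter at most \<open>\<delta>\<close> cannot meet both \<open>A\<close> and \<open>B\<close>, so a cover of the union splits into a cover
  of \<open>A\<close> and a cover of \<open>B\<close>.
\<close>

lemma hausdorff_pre_separated:
  assumes s: "s \<ge> 1" and sep: "\<And>x y. x \<in> A \<Longrightarrow> y \<in> B \<Longrightarrow> dist x y > \<delta>" and "\<delta> > 0"
  shows "hausdorff_pre s \<delta> A + hausdorff_pre s \<delta> B \<le> hausdorff_pre s \<delta> (A \<union> B)"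
  unfolding hausdorff_pre_def[of s \<delta> "A \<union> B"]
proof (rule INF_greatest)
  fix U :: "nat \<Rightarrow> 'a set"
  assume "U \<in> {U. delta_cover \<delta> (A \<union> B) U}"
  then have U: "A \<union> B \<subseteq> (\<Union>i. U i)" "\<And>i. bounded (U i)" "\<And>i. diameter (U i) \<le> \<delta>" by auto
  define P where "P = (\<lambda>S i. if U i \<inter> S = {} then {} else U i)"
  have cov: "delta_cover \<delta> S (P S)" if "S \<subseteq> A \<union> B" for S
    using U that \<open>\<delta> > 0\<close> by (auto simp: P_def) blast
  have "hausdorff_pre s \<delta> A + hausdorff_pre s \<delta> B
      \<le> (\<Sum>i. hausdorff_weight s (P A i)) + (\<Sum>i. hausdorff_weight s (P B i))"
    by (intro add_mono hausdorff_pre_le cov) auto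
  also have "\<dots> = (\<Sum>i. hausdorff_weight s (P A i) + hausdorff_weight s (P B i))"
    by (intro suminf_add summableI)
  also have "\<dots> \<le> (\<Sum>i. hausdorff_weight s (U i))"
  proof (intro suminf_le summableI)
    fix i
    have "\<not> (U i \<inter> A \<noteq> {} \<and> U i \<inter> B \<noteq> {})"
    proof
      assume "U i \<inter> A \<noteq> {} \<and> U i \<inter> B \<noteq> {}"
      then obtain x y where "x \<in> U i" "x \<in> A" "y \<in> U i" "y \<in> B" by auto
      then have "dist x y \<le> \<delta>" "\<delta> < dist x y"
        using diameter_bounded_bound[OF U(2)] U(3)[of i] sep by (auto intro: order_trans)
      then show False by simp
    qed
    then show "hausdorff_weight s (P A i) + hausdorff_weight s (P B i) \<le> hausdorff_weight s (U i)"
      using s by (auto simp: P_def power_0_left)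
  qed
  finally show "hausdorff_pre s \<delta> A + hausdorff_pre s \<delta> B \<le> (\<Sum>i. hausdorff_weight s (U i))" .
qed

lemma hausdorff_outer_separated:
  assumes s: "s \<ge> 1" and sep: "\<And>x y. x \<in> A \<Longrightarrow> y \<in> B \<Longrightarrow> dist x y \<ge> \<epsilon>" and "\<epsilon> > 0"
  shows "hausdorff_outer s A + hausdorff_outer s B \<le> hausdorff_outer s (A \<union> B)"
proof -
  have le: "hausdorff_pre s \<delta> A + hausdorff_pre s \<delta>' B \<le> hausdorff_outer s (A \<union> B)"
    if "\<delta> > 0" "\<delta>' > 0" for \<delta> \<delta>'
  proof -
    define \<eta> where "\<eta> = min (min \<delta> \<delta>') (\<epsilon> / 2)"
    have \<eta>: "\<eta> > 0" "\<eta> \<le> \<delta>" "\<eta> \<le> \<delta>'" "\<eta> < \<epsilon>" using that \<open>\<epsilon> > 0\<close> by (auto simp: \<eta>_def)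
    have "hausdorff_pre s \<delta> A + hausdorff_pre s \<delta>' B \<le> hausdorff_pre s \<eta> A + hausdorff_pre s \<eta> B"
      using \<eta> by (intro add_mono hausdorff_pre_antimono) auto
    also have "\<dots> \<le> hausdorff_pre s \<eta> (A \<union> B)"
      using \<eta> sep by (intro hausdorff_pre_separated s) (auto intro: less_le_trans)
    also have "\<dots> \<le> hausdorff_outer s (A \<union> B)" using \<eta> by (intro hausdorff_pre_le_outer)
    finally show ?thesis .
  qed
  have "hausdorff_outer s A + hausdorff_pre s \<delta>' B \<le> hausdorff_outer s (A \<union> B)" if "\<delta>' > 0" for \<delta>'
    unfolding hausdorff_outer_def[of s A]
    by (subst ennreal_SUP_add_left[symmetric]) (use le that in \<open>auto intro!: SUP_least exI[of _ 1]\<close>)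
  then have "(SUP \<delta>'\<in>{0<..}. hausdorff_outer s A + hausdorff_pre s \<delta>' B) \<le> hausdorff_outer s (A \<union> B)"
    by (intro SUP_least) auto
  moreover have "(SUP \<delta>'\<in>{0<..}. hausdorff_outer s A + hausdorff_pre s \<delta>' B) = hausdorff_outer s A + hausdorff_outer s B"
    unfolding hausdorff_outer_def[of s B] by (rule ennreal_SUP_add_right[symmetric]) auto
  ultimately show ?thesis by simp
qed

text \<open>
  Subtraction in \<open>ennreal\<close> is truncated, so the tails are computed with real numbers.
\<close>

lemma suminf_tail_tendsto_zero:
  fixes g :: "nat \<Rightarrow> ennreal"
  assumes "(\<Sum>k. g k) < top"
  shows "(\<lambda>m. \<Sum>k. g (k + m)) \<longlonglongrightarrow> 0"
proof -
  define r where "r = (\<lambda>k. enn2real (g k))"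
  have fin: "g k < top" for k using ennreal_suminf_lessD[OF assms] .
  have g: "g k = ennreal (r k)" for k using fin[of k] by (simp add: r_def)
  have r0: "r k \<ge> 0" for k by (simp add: r_def)
  have sm: "summable r"
    using assms r0 unfolding g by (intro summable_suminf_not_top) auto
  have "(\<lambda>m. \<Sum>k. r (k + m)) = (\<lambda>m. suminf r - sum r {..<m})"
    using suminf_split_initial_segment[OF sm] by (auto simp: fun_eq_iff algebra_simps)
  moreover have "(\<lambda>m. suminf r - sum r {..<m}) \<longlonglongrightarrow> suminf r - suminf r"
    by (intro tendsto_diff tendsto_const summable_LIMSEQ sm)
  ultimately have "(\<lambda>m. \<Sum>k. r (k + m)) \<longlonglongrightarrow> 0" by simp
  then have "(\<lambda>m. ennreal (\<Sum>k. r (k + m))) \<longlonglongrightarrow> ennreal 0" by (rule tendsto_ennrealI)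
  moreover have "(\<Sum>k. g (k + m)) = ennreal (\<Sum>k. r (k + m))" for m
    unfolding g using r0 sm by (intro suminf_ennreal2) (auto simp: summable_iff_shift)
  ultimately show ?thesis by simp
qed

text \<open>
  Caratheodory's criterion for metric outer measures. The part of \<open>X\<close> outside \<open>C\<close> is cut into the shells
  \<open>R k\<close> of points at distance between \<open>1 / (k + 2)\<close> and \<open>1 / (k + 1)\<close> from \<open>C\<close>. Shells whose indices
  differ by at least two are separated from each other, so the measures of the even shells, and of the odd
  ones, add up to at most \<open>f X\<close>. Hence the shells close to \<open>C\<close> contribute arbitrarily little, and the
  rest is separated from \<open>C\<close>.
\<close>

lemma closed_in_lambda_system:
  fixes f :: "'a::metric_space set \<Rightarrow> ennreal" and C :: "'a set"
  assumes f: "outer_measure_space UNIV f"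
    and separated: "\<And>A B \<epsilon>. \<epsilon> > 0 \<Longrightarrow> (\<And>x y. x \<in> A \<Longrightarrow> y \<in> B \<Longrightarrow> dist x y \<ge> \<epsilon>) \<Longrightarrow> f A + f B \<le> f (A \<union> B)"
    and C: "closed C"
  shows "C \<in> lambda_system UNIV UNIV f"
proof (cases "C = {}")
  case True
  have "positive UNIV f" using f by (simp add: outer_measure_space_def)
  then show ?thesis using True by (simp add: lambda_system_def positive_def)
next
  case False
  have emp: "f {} = 0" and mono: "\<And>A B. A \<subseteq> B \<Longrightarrow> f A \<le> f B"
    and csub: "countably_subadditive UNIV f"
    using f by (auto simp: outer_measure_space_def positive_def increasing_def)
  have csub': "f (\<Union>i. A i) \<le> (\<Sum>i. f (A i))" for A :: "nat \<Rightarrow> 'a set"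
  proof -
    have "f (\<Union>i. disjointed A i) \<le> (\<Sum>i. f (disjointed A i))"
      using csub disjoint_family_disjointed[of A] by (auto simp: countably_subadditive_def)
    also have "\<dots> \<le> (\<Sum>i. f (A i))"
      by (intro suminf_le mono disjointed_subset summableI)
    finally show ?thesis by (simp add: UN_disjointed_eq)
  qed
  have sub: "f (A \<union> B) \<le> f A + f B" for A B
  proof -
    define S where "S = (\<lambda>i::nat. if i = 0 then A else if i = 1 then B else {})"
    have "(\<Sum>i. f (S i)) = (\<Sum>i\<in>{0, 1}. f (S i))"
      by (rule suminf_finite) (auto simp: S_def emp)
    moreover have "(\<Union>i. S i) = A \<union> B" by (auto simp: S_def split: if_splits)
    ultimately show ?thesis using csub'[of S] by (simp add: S_def)
  qed
  have "f (X \<inter> C) + f (X - C) \<le> f X" for X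
  proof (cases "f X < top")
    case fin: True
    define D where "D = (\<lambda>y. infdist y C)"
    have D_pos: "D y > 0" if "y \<notin> C" for y
      using that C False in_closed_iff_infdist_zero[OF C False, of y] infdist_nonneg[of y C]
      by (auto simp: D_def less_le)
    have D_lip: "D x \<le> D y + dist x y" for x y unfolding D_def by (rule infdist_triangle)
    define R where "R = (\<lambda>k::nat. {y \<in> X. 1 / (real k + 2) \<le> D y \<and> D y < 1 / (real k + 1)})"
    have sumR: "(\<Sum>k<n. f (R (2 * k + b))) \<le> f (\<Union>k<n. R (2 * k + b))" for n b
    proof (induction n)
      case 0 then show ?case by (simp add: emp)
    next
      case (Suc n)
      have "(\<Sum>k<Suc n. f (R (2 * k + b))) \<le> f (\<Union>k<n. R (2 * k + b)) + f (R (2 * n + b))"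
        using Suc by (simp add: add_mono)
      also have "\<dots> \<le> f ((\<Union>k<n. R (2 * k + b)) \<union> R (2 * n + b))"
      proof (cases "n = 0")
        case True then show ?thesis by (simp add: emp)
      next
        case n: False
        define a where "a = real (2 * n + b)"
        have a: "a \<ge> 2" using n by (simp add: a_def)
        show ?thesis
        proof (rule separated)
          show "1 / a - 1 / (a + 1) > 0" using a by (simp add: frac_less2)
          fix x y assume x: "x \<in> (\<Union>k<n. R (2 * k + b))" and y: "y \<in> R (2 * n + b)"
          then obtain k where k: "k < n" "1 / (real (2 * k + b) + 2) \<le> D x" by (auto simp: R_def)
          have "real (2 * k + b) + 2 \<le> a" using k by (simp add: a_def)
          then have "1 / a \<le> 1 / (real (2 * k + b) + 2)" by (intro divide_left_mono) (auto simp: a_def n intro!: mult_pos_pos)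
          with k have "1 / a \<le> D x" by simp
          moreover have "D y < 1 / (a + 1)" using y by (simp add: R_def a_def)
          ultimately show "1 / a - 1 / (a + 1) \<le> dist x y" using D_lip[of x y] by simp
        qed
      qed
      also have "(\<Union>k<n. R (2 * k + b)) \<union> R (2 * n + b) = (\<Union>k<Suc n. R (2 * k + b))"
        by (auto simp: lessThan_Suc)
      finally show ?case .
    qed
    have "(\<Sum>k. f (R (2 * k + b))) \<le> f X" for b
    proof (rule suminf_le_const[OF summableI])
      fix n
      show "(\<Sum>k<n. f (R (2 * k + b))) \<le> f X"
        using sumR[of b n] by (rule order_trans) (auto intro!: mono simp: R_def)
    qed
    then have finR: "(\<Sum>k. f (R (2 * k + b))) < top" for b using fin le_less_trans by blast
    \<comment> \<open>t b m: total measure of the shells of parity b from the index 2 m on.\<close>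
    define t where "t = (\<lambda>b m. \<Sum>k. f (R (2 * (k + m) + b)))"
    have t: "(\<lambda>m. t b m) \<longlonglongrightarrow> 0" for b
      unfolding t_def using suminf_tail_tendsto_zero[OF finR[of b]] by simp
    have bound: "f (X \<inter> C) + f (X - C) \<le> f X + (t 0 m + t 1 m)" for m
    proof -
      define B where "B = {y \<in> X. 1 / (real (2 * m) + 1) \<le> D y}"
      have "X - C \<subseteq> B \<union> ((\<Union>k. R (2 * (k + m) + 0)) \<union> (\<Union>k. R (2 * (k + m) + 1)))"
      proof
        fix y assume y: "y \<in> X - C"
        show "y \<in> B \<union> ((\<Union>k. R (2 * (k + m) + 0)) \<union> (\<Union>k. R (2 * (k + m) + 1)))"
        proof (cases "y \<in> B")
          case notB: False
          have "D y > 0" using D_pos y by auto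
          then obtain n where "inverse (real (Suc n)) < D y" using reals_Archimedean by blast
          then have ex: "1 / (real n + 1) \<le> D y" by (simp add: field_simps)
          define k where "k = (LEAST k. 1 / (real k + 1) \<le> D y)"
          have k: "1 / (real k + 1) \<le> D y" unfolding k_def using ex by (rule LeastI)
          have min: "\<not> 1 / (real j + 1) \<le> D y" if "j < k" for j using that unfolding k_def by (rule not_less_Least)
          have km: "k > 2 * m"
          proof (rule ccontr)
            assume "\<not> k > 2 * m"
            then have "1 / (real (2 * m) + 1) \<le> 1 / (real k + 1)" by (intro divide_left_mono) auto
            then show False using k notB y by (auto simp: B_def)
          qed
          then obtain j where j: "k = Suc j" by (cases k) auto
          have "y \<in> R j" using k min[of j] y by (auto simp: R_def j add.commute)
          moreover have "j \<ge> 2 * m" using km j by simp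
          then have "\<exists>i. j = 2 * (i + m) + 0 \<or> j = 2 * (i + m) + 1"
            by presburger
          ultimately show ?thesis by blast
        qed auto
      qed
      then have "f (X - C) \<le> f (B \<union> ((\<Union>k. R (2 * (k + m) + 0)) \<union> (\<Union>k. R (2 * (k + m) + 1))))" by (rule mono)
      also have "\<dots> \<le> f B + (f (\<Union>k. R (2 * (k + m) + 0)) + f (\<Union>k. R (2 * (k + m) + 1)))"
        by (intro order_trans[OF sub] add_mono order_refl sub)
      also have "\<dots> \<le> f B + (t 0 m + t 1 m)"
        unfolding t_def by (intro add_mono order_refl csub')
      finally have "f (X \<inter> C) + f (X - C) \<le> f (X \<inter> C) + (f B + (t 0 m + t 1 m))"
        by (intro add_mono) auto
      also have "\<dots> = (f (X \<inter> C) + f B) + (t 0 m + t 1 m)" by (simp add: add.assoc)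
      also have "f (X \<inter> C) + f B \<le> f (X \<inter> C \<union> B)"
      proof (rule separated)
        show "1 / (real (2 * m) + 1) > 0" by simp
        fix x y assume "x \<in> X \<inter> C" "y \<in> B"
        then have "D x = 0" "1 / (real (2 * m) + 1) \<le> D y" by (auto simp: D_def B_def)
        then show "1 / (real (2 * m) + 1) \<le> dist x y" using D_lip[of y x] by (simp add: dist_commute)
      qed
      also have "f (X \<inter> C \<union> B) \<le> f X" by (rule mono) (auto simp: B_def)
      finally show ?thesis by (auto intro: add_right_mono)
    qed
    have "(\<lambda>m. f X + (t 0 m + t 1 m)) \<longlonglongrightarrow> f X + (0 + 0)"
      by (intro tendsto_add tendsto_const t)
    then show ?thesis using bound by (intro LIMSEQ_le_const[where X = "\<lambda>m. f X + (t 0 m + t 1 m)"]) auto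
  next
    case False
    then have "f X = top" by (simp add: not_less top_unique)
    then show ?thesis by simp
  qed
  moreover have "f X \<le> f (X \<inter> C) + f (X - C)" for X
    using sub[of "X \<inter> C" "X - C"] by (simp add: Int_Diff_Un)
  ultimately have "f (X \<inter> C) + f (X - C) = f X" for X by (intro antisym)
  then show ?thesis by (auto simp: lambda_system_def Int_commute Diff_eq)
qed


lemma sets_hausdorff_measure [simp, measurable_cong]: "sets (hausdorff_measure s) = sets borel"
  using sets.sigma_sets_eq[of borel] by (simp add: hausdorff_measure_def sets_measure_of_conv)

lemma space_hausdorff_measure [simp]: "space (hausdorff_measure s) = UNIV"
  by (simp add: hausdorff_measure_def space_measure_of_conv)

text \<open>
  Without this, \<open>hausdorff_measure\<close> might be the null measure, which is what \<open>measure_of\<close> yields for a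
  function that is not countably additive.
\<close>

lemma emeasure_hausdorff_measure:
  fixes B :: "'a::metric_space set"
  assumes s: "s \<ge> 1" and B: "B \<in> sets borel"
  shows "emeasure (hausdorff_measure s) B = hausdorff_outer s B"
proof -
  let ?f = "hausdorff_outer s :: 'a set \<Rightarrow> ennreal"
  let ?L = "lambda_system UNIV UNIV ?f"
  have f: "outer_measure_space UNIV ?f" using outer_measure_space_hausdorff[OF s] .
  interpret sigma_algebra "UNIV :: 'a set" "UNIV :: 'a set set"
    using sigma_algebra_Pow[of "UNIV :: 'a set"] by simp
  have L: "measure_space UNIV ?L ?f" using caratheodory_lemma f by simp
  have "sigma_algebra UNIV ?L" using L by (simp add: measure_space_def)
  moreover have "Collect closed \<subseteq> ?L"
    using hausdorff_outer_separated[OF s] by (intro subsetI closed_in_lambda_system f) auto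
  ultimately have sub: "sets (borel :: 'a measure) \<subseteq> ?L"
    unfolding borel_eq_closed by (simp add: sigma_algebra.sigma_sets_subset)
  show ?thesis
    unfolding hausdorff_measure_def
  proof (rule emeasure_measure_of_sigma)
    show "sigma_algebra UNIV (sets (borel :: 'a measure))"
      using sets.sigma_algebra_axioms[of "borel :: 'a measure"] by simp
    show "positive (sets borel) ?f" using L by (simp add: measure_space_def positive_def)
    show "countably_additive (sets borel) ?f"
      using L sub by (auto simp: measure_space_def countably_additive_def)
  qed fact
qed

lemma hausdorff_outer_le_finite_cover:
  assumes s: "s \<ge> 1" and "c \<ge> 0"
    and cover: "\<And>\<delta>. \<delta> > 0 \<Longrightarrow> \<exists>F::'a::metric_space set set. finite F \<and> A \<subseteq> \<Union>F \<and>
      (\<forall>U\<in>F. bounded U \<and> diameter U \<le> \<delta>) \<and> (\<Sum>U\<in>F. unit_ball_vol (real s) * (diameter U / 2) ^ s) \<le> c"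
  shows "hausdorff_outer s A \<le> ennreal c"
  unfolding hausdorff_outer_def
proof (rule SUP_least)
  fix \<delta> :: real assume "\<delta> \<in> {0<..}"
  then obtain F :: "'a set set" where F: "finite F" "A \<subseteq> \<Union>F" "\<And>U. U \<in> F \<Longrightarrow> bounded U"
      "\<And>U. U \<in> F \<Longrightarrow> diameter U \<le> \<delta>" "(\<Sum>U\<in>F. unit_ball_vol (real s) * (diameter U / 2) ^ s) \<le> c"
    using cover[of \<delta>] by auto
  obtain e where e: "bij_betw e {..<card F} F" using F(1) bij_betw_from_nat_into_finite by blast
  define U where "U = (\<lambda>i. if i < card F then e i else {})"
  have eF: "e i \<in> F" if "i < card F" for i using e that by (auto simp: bij_betw_def)
  have "hausdorff_pre s \<delta> A \<le> (\<Sum>i. hausdorff_weight s (U i))"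
  proof (rule hausdorff_pre_le)
    have "\<Union>F \<subseteq> (\<Union>i. U i)"
    proof
      fix x assume "x \<in> \<Union>F"
      then obtain i where "i < card F" "x \<in> e i" using e by (auto simp: bij_betw_def)
      then show "x \<in> (\<Union>i. U i)" by (auto simp: U_def intro!: exI[of _ i])
    qed
    then show "delta_cover \<delta> A U"
      using F eF \<open>\<delta> \<in> {0<..}\<close> by (auto simp: U_def)
  qed
  also have "\<dots> = (\<Sum>i<card F. hausdorff_weight s (U i))"
    using s by (intro suminf_finite) (auto simp: U_def power_0_left)
  also have "\<dots> = (\<Sum>i<card F. hausdorff_weight s (e i))"
    by (intro sum.cong) (auto simp: U_def)
  also have "\<dots> = (\<Sum>U\<in>F. hausdorff_weight s U)" using sum.reindex_bij_betw[OF e] .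
  also have "\<dots> = ennreal (\<Sum>U\<in>F. unit_ball_vol (real s) * (diameter U / 2) ^ s)"
    using F by (intro sum_ennreal mult_nonneg_nonneg unit_ball_vol_nonneg zero_le_power) (auto simp: diameter_ge_0)
  also have "\<dots> \<le> ennreal c" using F by (intro ennreal_leI)
  finally show "hausdorff_pre s \<delta> A \<le> ennreal c" .
qed

text \<open>
  If a set is controlled by its coordinates other than \<open>k\<close>, as a Lipschitz graph over the hyperplane
  orthogonal to \<open>axis k 1\<close> is, then a grid of about \<open>N ^ (d - 1)\<close> cells in that hyperplane
  cuts it into pieces of diameter of order \<open>1 / N\<close>.
\<close>

lemma hausdorff_outer_graph_finite:
  fixes A :: "(real ^ 'n::finite) set" and k :: 'n
  assumes d: "CARD('n) \<ge> 2"
    and R: "R > 0" "\<And>x i. x \<in> A \<Longrightarrow> \<bar>x $ i\<bar> \<le> R"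
    and L: "L > 0" "\<And>x y. x \<in> A \<Longrightarrow> y \<in> A \<Longrightarrow> dist x y \<le> L * (\<Sum>i\<in>UNIV - {k}. \<bar>x $ i - y $ i\<bar>)"
  shows "hausdorff_outer (CARD('n) - 1) A < top"
proof -
  let ?s = "CARD('n) - 1"
  define M where "M = L * real ?s * (2 * R)"
  have M0: "M > 0" using d R L by (simp add: M_def)
  define c where "c = unit_ball_vol (real ?s) * M ^ ?s"
  have "hausdorff_outer ?s A \<le> ennreal c"
  proof (rule hausdorff_outer_le_finite_cover)
    show "1 \<le> ?s" using d by simp
    show "0 \<le> c" using M0 by (simp add: c_def)
    fix \<delta> :: real assume "\<delta> > 0"
    obtain N :: nat where N: "real N > M / \<delta>" using reals_Archimedean2 by blast
    have "M / \<delta> > 0" using M0 \<open>\<delta> > 0\<close> by simp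
    then have N0: "N > 0" using N by (cases N) auto
    have Nd: "M / real N \<le> \<delta>" using N N0 \<open>\<delta> > 0\<close> by (simp add: field_simps)
    define \<eta> where "\<eta> = 2 * R / real N"
    have \<eta>: "\<eta> > 0" using R N0 by (simp add: \<eta>_def)
    \<comment> \<open>The index N itself is needed for points on the upper faces of the box, so there are
      N + 1 slabs per direction; c pays for the extra one by not halving the diameter.\<close>
    define I where "I = PiE (UNIV - {k}) (\<lambda>_. {..N})"
    define U where "U = (\<lambda>\<alpha>. {x \<in> A. \<forall>i\<in>UNIV - {k}. real (\<alpha> i) * \<eta> \<le> x $ i + R \<and> x $ i + R \<le> (real (\<alpha> i) + 1) * \<eta>})"
    have finI: "finite I" unfolding I_def by (intro finite_PiE) auto
    have cardI: "card I = (N + 1) ^ ?s" unfolding I_def by (subst card_PiE) (auto simp: card_Diff_singleton)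
    have diam: "dist x y \<le> M / real N" if "x \<in> U \<alpha>" "y \<in> U \<alpha>" for x y \<alpha>
    proof -
      have "\<bar>x $ i - y $ i\<bar> \<le> \<eta>" if "i \<in> UNIV - {k}" for i
      proof -
        have "real (\<alpha> i) * \<eta> \<le> x $ i + R" "x $ i + R \<le> (real (\<alpha> i) + 1) * \<eta>"
             "real (\<alpha> i) * \<eta> \<le> y $ i + R" "y $ i + R \<le> (real (\<alpha> i) + 1) * \<eta>"
          using \<open>x \<in> U \<alpha>\<close> \<open>y \<in> U \<alpha>\<close> that by (auto simp: U_def)
        then show ?thesis by (simp add: algebra_simps abs_le_iff)
      qed
      then have "(\<Sum>i\<in>UNIV - {k}. \<bar>x $ i - y $ i\<bar>) \<le> (\<Sum>i\<in>UNIV - {k}. \<eta>)" by (intro sum_mono)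
      also have "\<dots> = real ?s * \<eta>" by (simp add: card_Diff_singleton)
      finally have *: "(\<Sum>i\<in>UNIV - {k}. \<bar>x $ i - y $ i\<bar>) \<le> real ?s * \<eta>" .
      have "dist x y \<le> L * (\<Sum>i\<in>UNIV - {k}. \<bar>x $ i - y $ i\<bar>)" using that L by (auto simp: U_def)
      also have "\<dots> \<le> L * (real ?s * \<eta>)" using * L by (intro mult_left_mono) auto
      also have "\<dots> = M / real N" by (simp add: M_def \<eta>_def)
      finally show ?thesis .
    qed
    have bdd: "bounded (U \<alpha>)" for \<alpha>
    proof (cases "U \<alpha> = {}")
      case False
      then obtain x where "x \<in> U \<alpha>" by auto
      then have "\<forall>y\<in>U \<alpha>. dist x y \<le> M / real N" using diam[of x \<alpha>] by blast
      then show ?thesis unfolding bounded_def by blast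
    qed simp
    have diamU: "diameter (U \<alpha>) \<le> M / real N" for \<alpha>
    proof (rule diameter_le)
      show "U \<alpha> \<noteq> {} \<or> 0 \<le> M / real N" using M0 by simp
    qed (use diam[of _ \<alpha>, unfolded dist_norm] in blast)
    have cover: "A \<subseteq> \<Union>(U ` I)"
    proof
      fix x assume x: "x \<in> A"
      define \<alpha> where "\<alpha> = restrict (\<lambda>i. nat \<lfloor>(x $ i + R) / \<eta>\<rfloor>) (UNIV - {k})"
      have nn: "0 \<le> (x $ i + R) / \<eta>" for i using R(2)[OF x, of i] \<eta> by (auto simp: abs_le_iff)
      have "(x $ i + R) / \<eta> \<le> real N" for i
      proof -
        have "x $ i + R \<le> 2 * R" using R(2)[OF x, of i] by auto
        also have "\<dots> = real N * \<eta>" using N0 by (simp add: \<eta>_def)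
        finally show ?thesis using \<eta> by (simp add: field_simps)
      qed
      then have "\<lfloor>(x $ i + R) / \<eta>\<rfloor> \<le> int N" for i by (simp add: floor_le_iff) (smt (verit))
      then have "\<alpha> \<in> I" by (auto simp: I_def \<alpha>_def nat_le_iff)
      moreover have "x \<in> U \<alpha>"
      proof -
        have *: "real (nat \<lfloor>(x $ i + R) / \<eta>\<rfloor>) * \<eta> \<le> x $ i + R \<and> x $ i + R \<le> (real (nat \<lfloor>(x $ i + R) / \<eta>\<rfloor>) + 1) * \<eta>" for i
        proof -
          have r: "real (nat \<lfloor>(x $ i + R) / \<eta>\<rfloor>) = of_int \<lfloor>(x $ i + R) / \<eta>\<rfloor>" using nn[of i] by simp
          show ?thesis
            unfolding r pos_le_divide_eq[OF \<eta>, symmetric] pos_divide_le_eq[OF \<eta>, symmetric]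
            by (auto intro: less_imp_le)
        qed
        have "\<forall>i\<in>UNIV - {k}. real (\<alpha> i) * \<eta> \<le> x $ i + R \<and> x $ i + R \<le> (real (\<alpha> i) + 1) * \<eta>"
        proof
          fix i assume "i \<in> UNIV - {k}"
          then have "\<alpha> i = nat \<lfloor>(x $ i + R) / \<eta>\<rfloor>" by (simp add: \<alpha>_def)
          then show "real (\<alpha> i) * \<eta> \<le> x $ i + R \<and> x $ i + R \<le> (real (\<alpha> i) + 1) * \<eta>"
            using *[of i] by (simp only:)
        qed
        then show ?thesis using x by (simp only: U_def mem_Collect_eq simp_thms)
      qed
      ultimately show "x \<in> \<Union>(U ` I)" by blast
    qed
    have "(\<Sum>S\<in>U ` I. unit_ball_vol (real ?s) * (diameter S / 2) ^ ?s)
        \<le> (\<Sum>S\<in>U ` I. unit_ball_vol (real ?s) * (M / real N / 2) ^ ?s)"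
    proof (intro sum_mono mult_left_mono power_mono divide_right_mono)
      show "diameter S \<le> M / real N" "0 \<le> diameter S / 2" if "S \<in> U ` I" for S
        using that diamU bdd by (auto simp: diameter_ge_0)
    qed auto
    also have "\<dots> = real (card (U ` I)) * (unit_ball_vol (real ?s) * (M / real N / 2) ^ ?s)" by simp
    also have "\<dots> \<le> real (card I) * (unit_ball_vol (real ?s) * (M / real N / 2) ^ ?s)"
      using finI M0 by (intro mult_right_mono) (auto intro: card_image_le)
    also have "\<dots> = unit_ball_vol (real ?s) * ((real N + 1) * (M / real N / 2)) ^ ?s"
      by (simp only: cardI of_nat_power of_nat_add of_nat_1 power_mult_distrib mult_ac)
    also have "\<dots> \<le> c"
      unfolding c_def
    proof (intro mult_left_mono power_mono)
      have "(real N + 1) / (2 * real N) \<le> 1" using N0 by (simp add: field_simps)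
      then have "((real N + 1) / (2 * real N)) * M \<le> 1 * M" using M0 by (intro mult_right_mono) auto
      then show "(real N + 1) * (M / real N / 2) \<le> M" by simp
    qed (use M0 in auto)
    finally have sum: "(\<Sum>S\<in>U ` I. unit_ball_vol (real ?s) * (diameter S / 2) ^ ?s) \<le> c" .
    show "\<exists>F. finite F \<and> A \<subseteq> \<Union>F \<and> (\<forall>U\<in>F. bounded U \<and> diameter U \<le> \<delta>) \<and>
        (\<Sum>U\<in>F. unit_ball_vol (real ?s) * (diameter U / 2) ^ ?s) \<le> c"
    proof (intro exI conjI ballI)
      show "finite (U ` I)" using finI by (rule finite_imageI)
      show "bounded S" "diameter S \<le> \<delta>" if "S \<in> U ` I" for S
        using that bdd order_trans[OF diamU Nd] by auto
    qed (fact cover sum)+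
  qed
  then show ?thesis by (simp add: le_less_trans)
qed

text \<open>
  The cylinder over \<open>U\<close> in the direction of the axis \<open>k\<close> lies in a box whose extent in all other
  directions is twice the diameter of \<open>U\<close>.
\<close>

lemma emeasure_cylinder_cbox_le:
  fixes U :: "(real ^ 'n::finite) set" and k :: 'n
  assumes "bounded U" "R > 0"
  shows "\<exists>B. B \<in> sets borel \<and> {x. \<bar>x $ k\<bar> \<le> R \<and> (\<exists>y\<in>U. \<forall>i. i \<noteq> k \<longrightarrow> x $ i = y $ i)} \<subseteq> B \<and>
    emeasure lborel B \<le> ennreal (2 * R * (2 * diameter U) ^ (CARD('n) - 1))"
proof (cases "U = {}")
  case True then show ?thesis by (intro exI[of _ "{}"]) auto
next
  case False
  then obtain y where y: "y \<in> U" by auto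
  define a b :: "real ^ 'n" where "a = (\<chi> i. if i = k then -R else y $ i - diameter U)"
    and "b = (\<chi> i. if i = k then R else y $ i + diameter U)"
  have ab: "a $ i \<le> b $ i" for i using assms diameter_ge_0[of U] by (auto simp: a_def b_def)
  have "{x. \<bar>x $ k\<bar> \<le> R \<and> (\<exists>y\<in>U. \<forall>i. i \<noteq> k \<longrightarrow> x $ i = y $ i)} \<subseteq> cbox a b"
  proof clarsimp
    fix x z assume x: "\<bar>x $ k\<bar> \<le> R" "z \<in> U" "\<forall>i. i \<noteq> k \<longrightarrow> x $ i = z $ i"
    have "y $ i - diameter U \<le> z $ i \<and> z $ i \<le> y $ i + diameter U" for i
      using component_le_norm_cart[of "z - y" i] diameter_bounded_bound[OF assms(1) x(2) y]
      by (simp add: dist_norm abs_le_iff)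
    then show "x \<in> cbox a b" using x by (auto simp: mem_box_cart a_def b_def abs_le_iff)
  qed
  moreover have "emeasure lborel (cbox a b) = ennreal (\<Prod>i\<in>UNIV. b $ i - a $ i)"
  proof -
    have "cbox a b \<noteq> {}" using ab by (simp add: interval_ne_empty_cart)
    moreover have "emeasure lborel (cbox a b) \<noteq> top"
      using emeasure_lborel_cbox_finite[of a b] by simp
    ultimately show ?thesis by (simp add: emeasure_eq_ennreal_measure content_cbox_cart)
  qed
  moreover have "(\<Prod>i\<in>UNIV. b $ i - a $ i) = 2 * R * (2 * diameter U) ^ (CARD('n) - 1)"
    by (subst prod.remove[of UNIV k]) (auto simp: a_def b_def card_Diff_singleton)
  ultimately show ?thesis by (intro exI[of _ "cbox a b"]) simp
qed

text \<open>
  Every line parallel to the axis \<open>k\<close> through a point of \<open>D\<close> leaves \<open>D\<close> and so meets the frontier. The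
  cylinders over the sets of a cover of the frontier therefore cover \<open>D\<close>, and their volumes are
  proportional to the weights in the Hausdorff measure. If that measure were zero, the open set
  \<open>D\<close> would be a null set.
\<close>

lemma hausdorff_outer_frontier_pos:
  fixes D :: "(real ^ 'n::finite) set"
  assumes d: "CARD('n) \<ge> 2" and D: "open D" "bounded D" "D \<noteq> {}"
  shows "hausdorff_outer (CARD('n) - 1) (frontier D) > 0"
proof (rule ccontr)
  let ?s = "CARD('n) - 1"
  assume "\<not> hausdorff_outer ?s (frontier D) > 0"
  then have "hausdorff_outer ?s (frontier D) = 0" by simp
  then have pre0: "hausdorff_pre ?s 1 (frontier D) = 0" using hausdorff_pre_le_outer[of 1 ?s "frontier D"] by simp
  define w where "w = unit_ball_vol (real ?s)"
  have w: "w > 0" by (simp add: w_def)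
  obtain R where R: "R > 0" "\<And>x. x \<in> D \<Longrightarrow> norm x \<le> R"
    using D(2) by (auto simp: bounded_pos)
  obtain k :: 'n where True by simp
  have le: "\<bar>x $ k\<bar> \<le> R" if "x \<in> D" for x using R(2)[OF that] component_le_norm_cart[of x k] by simp
  define K where "K = 2 * R * 4 ^ ?s / w"
  have K: "K > 0" using R w by (simp add: K_def)
  have "emeasure lborel D \<le> 0"
  proof (rule ennreal_le_epsilon)
    fix e :: real assume e: "0 < e"
    have "hausdorff_pre ?s 1 (frontier D) < ennreal (e / K)" using pre0 e K by simp
    then obtain U where U: "delta_cover 1 (frontier D) U" and lt: "(\<Sum>i. hausdorff_weight ?s (U i)) < ennreal (e / K)"
      unfolding hausdorff_pre_def INF_less_iff by auto
    let ?Z = "\<lambda>i. {x. \<bar>x $ k\<bar> \<le> R \<and> (\<exists>y\<in>U i. \<forall>j. j \<noteq> k \<longrightarrow> x $ j = y $ j)}"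
    have "\<forall>i. \<exists>B. B \<in> sets borel \<and> ?Z i \<subseteq> B \<and>
        emeasure lborel B \<le> ennreal (2 * R * (2 * diameter (U i)) ^ ?s)"
      using U R by (intro allI emeasure_cylinder_cbox_le) auto
    from choice[OF this] obtain B where B0: "\<forall>i. B i \<in> sets borel \<and> ?Z i \<subseteq> B i \<and>
        emeasure lborel (B i) \<le> ennreal (2 * R * (2 * diameter (U i)) ^ ?s)"
      by (elim exE)
    have B: "B i \<in> sets borel" "?Z i \<subseteq> B i"
        "emeasure lborel (B i) \<le> ennreal (2 * R * (2 * diameter (U i)) ^ ?s)" for i
      using spec[OF B0, of i] by simp_all
    have "D \<subseteq> (\<Union>i. B i)"
    proof
      fix x assume x: "x \<in> D"
      define S where "S = range (\<lambda>t. x + t *\<^sub>R axis k (1::real))"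
      have "connected S" unfolding S_def
        by (intro connected_continuous_image continuous_intros connected_UNIV)
      moreover have "x \<in> S" unfolding S_def by (rule image_eqI[of _ _ 0]) auto
      moreover have "x + (2 * R + 1) *\<^sub>R axis k 1 \<notin> D"
      proof
        assume "x + (2 * R + 1) *\<^sub>R axis k 1 \<in> D"
        then have "\<bar>(x + (2 * R + 1) *\<^sub>R axis k 1) $ k\<bar> \<le> R" by (rule le)
        moreover have "\<bar>x $ k\<bar> \<le> R" using x by (rule le)
        ultimately show False using R by auto
      qed
      then have "S - D \<noteq> {}" by (auto simp: S_def)
      ultimately have "S \<inter> frontier D \<noteq> {}" using x by (intro connected_Int_frontier) auto
      then obtain t where "x + t *\<^sub>R axis k 1 \<in> frontier D" by (auto simp: S_def)
      then obtain i where "x + t *\<^sub>R axis k 1 \<in> U i" using U by blast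
      moreover have "\<bar>x $ k\<bar> \<le> R" using x by (rule le)
      ultimately have "x \<in> ?Z i" by (auto simp: axis_def intro!: bexI[of _ "x + t *\<^sub>R axis k 1"])
      then show "x \<in> (\<Union>i. B i)" using B(2)[of i] by blast
    qed
    then have "emeasure lborel D \<le> emeasure lborel (\<Union>i. B i)"
      using B(1) by (intro emeasure_mono) auto
    also have "\<dots> \<le> (\<Sum>i. emeasure lborel (B i))"
      using B(1) by (intro emeasure_subadditive_countably) auto
    also have "\<dots> \<le> (\<Sum>i. ennreal K * hausdorff_weight ?s (U i))"
    proof (intro suminf_le summableI)
      fix i
      have d0: "diameter (U i) \<ge> 0" using U by (auto simp: diameter_ge_0)
      have "2 * R * (2 * diameter (U i)) ^ ?s = K * (w * (diameter (U i) / 2) ^ ?s)"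
      proof -
        have "2 * diameter (U i) = 4 * (diameter (U i) / 2)" by simp
        then have "(2 * diameter (U i)) ^ ?s = 4 ^ ?s * (diameter (U i) / 2) ^ ?s"
          by (metis power_mult_distrib)
        then show ?thesis using w by (simp add: K_def)
      qed
      moreover have "ennreal K * hausdorff_weight ?s (U i) = ennreal (K * (w * (diameter (U i) / 2) ^ ?s))"
        unfolding w_def using K d0 by (intro ennreal_mult[symmetric]) auto
      ultimately show "emeasure lborel (B i) \<le> ennreal K * hausdorff_weight ?s (U i)"
        using B(3)[of i] by (simp only:)
    qed
    also have "\<dots> = ennreal K * (\<Sum>i. hausdorff_weight ?s (U i))" by (rule ennreal_suminf_cmult)
    also have "\<dots> \<le> ennreal K * ennreal (e / K)" using lt by (intro mult_left_mono) auto
    also have "\<dots> = ennreal e" using K e by (simp add: ennreal_mult[symmetric])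
    finally show "emeasure lborel D \<le> 0 + ennreal e" by simp
  qed
  then have "D \<in> null_sets lborel" using D by (intro null_setsI) auto
  then have "negligible D" by (simp add: negligible_iff_null_sets null_sets_completionI)
  then show False using open_not_negligible D by blast
qed

section \<open>Tensor-product polynomials\<close>

lemma finite_exponents [simp]: "finite {\<alpha> :: 'n::finite \<Rightarrow> nat. \<forall>i. \<alpha> i \<le> p}"
proof -
  have "{\<alpha> :: 'n \<Rightarrow> nat. \<forall>i. \<alpha> i \<le> p} = PiE UNIV (\<lambda>_. {..p})" by auto
  then show ?thesis by (simp add: finite_PiE)
qed

abbreviation exponents :: "nat \<Rightarrow> ('n::finite \<Rightarrow> nat) set" where
  "exponents p \<equiv> {\<alpha>. \<forall>i. \<alpha> i \<le> p}"

lemma Q_poly_zero: "(\<lambda>_. 0) \<in> Q_poly p"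
  unfolding Q_poly_def by (intro CollectI exI[of _ "\<lambda>_. 0"]) simp

lemma Q_poly_add:
  assumes "q \<in> Q_poly p" "r \<in> Q_poly p"
  shows "(\<lambda>x. q x + r x) \<in> Q_poly p"
proof -
  obtain c c' where "\<forall>x. q x = (\<Sum>\<alpha>\<in>exponents p. c \<alpha> * (\<Prod>i\<in>UNIV. (x $ i) ^ \<alpha> i))"
    "\<forall>x. r x = (\<Sum>\<alpha>\<in>exponents p. c' \<alpha> * (\<Prod>i\<in>UNIV. (x $ i) ^ \<alpha> i))"
    using assms unfolding Q_poly_def by blast
  then show ?thesis unfolding Q_poly_def
    by (intro CollectI exI[of _ "\<lambda>\<alpha>. c \<alpha> + c' \<alpha>"]) (simp add: sum.distrib distrib_right)
qed

lemma Q_poly_scale: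
  assumes "q \<in> Q_poly p"
  shows "(\<lambda>x. a * q x) \<in> Q_poly p"
proof -
  obtain c where "\<forall>x. q x = (\<Sum>\<alpha>\<in>exponents p. c \<alpha> * (\<Prod>i\<in>UNIV. (x $ i) ^ \<alpha> i))"
    using assms unfolding Q_poly_def by blast
  then show ?thesis unfolding Q_poly_def
    by (intro CollectI exI[of _ "\<lambda>\<alpha>. a * c \<alpha>"]) (simp add: sum_distrib_left mult.assoc)
qed

lemma Q_poly_diff: "q \<in> Q_poly p \<Longrightarrow> r \<in> Q_poly p \<Longrightarrow> (\<lambda>x. q x - r x) \<in> Q_poly p"
  using Q_poly_add[of q p "\<lambda>x. (-1) * r x"] Q_poly_scale[of r p "-1"] by simp

lemma Q_poly_monomial:
  fixes \<alpha> :: "'n::finite \<Rightarrow> nat"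
  assumes "\<forall>i. \<alpha> i \<le> p"
  shows "(\<lambda>x. \<Prod>i\<in>UNIV. (x $ i) ^ \<alpha> i) \<in> Q_poly p"
  unfolding Q_poly_def
proof (intro CollectI exI[of _ "\<lambda>\<beta>. if \<beta> = \<alpha> then 1 else 0"] allI)
  fix x :: "real ^ 'n"
  show "(\<Prod>i\<in>UNIV. (x $ i) ^ \<alpha> i) = (\<Sum>\<beta>\<in>exponents p. (if \<beta> = \<alpha> then 1 else 0) * (\<Prod>i\<in>UNIV. (x $ i) ^ \<beta> i))"
  proof -
    have "(\<Sum>\<beta>\<in>exponents p. (if \<beta> = \<alpha> then 1 else 0) * (\<Prod>i\<in>UNIV. (x $ i) ^ \<beta> i))
        = (\<Sum>\<beta>\<in>exponents p. if \<beta> = \<alpha> then \<Prod>i\<in>UNIV. (x $ i) ^ \<beta> i else 0)"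
      by (intro sum.cong) auto
    also have "\<dots> = (\<Prod>i\<in>UNIV. (x $ i) ^ \<alpha> i)"
      using assms by (subst sum.delta) auto
    finally show ?thesis by simp
  qed
qed

text \<open>
  This induction spares later proofs the sums over multi-indices.
\<close>

lemma Q_poly_induct [consumes 1, case_names monomial zero add scale]:
  assumes "q \<in> Q_poly p"
    and mono: "\<And>\<alpha>. \<forall>i. \<alpha> i \<le> p \<Longrightarrow> P (\<lambda>x. \<Prod>i\<in>UNIV. (x $ i) ^ \<alpha> i)"
    and zero: "P (\<lambda>_. 0)"
    and add: "\<And>q r. q \<in> Q_poly p \<Longrightarrow> r \<in> Q_poly p \<Longrightarrow> P q \<Longrightarrow> P r \<Longrightarrow> P (\<lambda>x. q x + r x)"
    and scale: "\<And>a q. q \<in> Q_poly p \<Longrightarrow> P q \<Longrightarrow> P (\<lambda>x. a * q x)"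
  shows "P q"
proof -
  obtain c where c: "q = (\<lambda>x. \<Sum>\<alpha>\<in>exponents p. c \<alpha> * (\<Prod>i\<in>UNIV. (x $ i) ^ \<alpha> i))"
    using assms(1) unfolding Q_poly_def by auto
  have "(\<lambda>x. \<Sum>\<alpha>\<in>S. c \<alpha> * (\<Prod>i\<in>UNIV. (x $ i) ^ \<alpha> i)) \<in> Q_poly p \<and>
      P (\<lambda>x. \<Sum>\<alpha>\<in>S. c \<alpha> * (\<Prod>i\<in>UNIV. (x $ i) ^ \<alpha> i))"
    if "finite S" "S \<subseteq> exponents p" for S
    using that
  proof (induction S rule: finite_induct)
    case (insert \<alpha> S)
    have m: "\<forall>i. \<alpha> i \<le> p" using insert.prems by simp
    have t: "(\<lambda>x. c \<alpha> * (\<Prod>i\<in>UNIV. (x $ i) ^ \<alpha> i)) \<in> Q_poly p" "P (\<lambda>x. c \<alpha> * (\<Prod>i\<in>UNIV. (x $ i) ^ \<alpha> i))"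
      by (rule Q_poly_scale[OF Q_poly_monomial[OF m]], rule scale[OF Q_poly_monomial[OF m] mono[OF m]])
    have IH: "(\<lambda>x. \<Sum>\<alpha>\<in>S. c \<alpha> * (\<Prod>i\<in>UNIV. (x $ i) ^ \<alpha> i)) \<in> Q_poly p"
      "P (\<lambda>x. \<Sum>\<alpha>\<in>S. c \<alpha> * (\<Prod>i\<in>UNIV. (x $ i) ^ \<alpha> i))"
      using insert.IH insert.prems by simp_all
    have "(\<lambda>x. \<Sum>\<beta>\<in>insert \<alpha> S. c \<beta> * (\<Prod>i\<in>UNIV. (x $ i) ^ \<beta> i))
        = (\<lambda>x. c \<alpha> * (\<Prod>i\<in>UNIV. (x $ i) ^ \<alpha> i) + (\<Sum>\<alpha>\<in>S. c \<alpha> * (\<Prod>i\<in>UNIV. (x $ i) ^ \<alpha> i)))"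
      using insert.hyps by simp
    then show ?case using add[OF t(1) IH(1) t(2) IH(2)] Q_poly_add[OF t(1) IH(1)] by (simp only: simp_thms)
  qed (simp_all add: zero Q_poly_zero)
  from this[OF finite_exponents order_refl] show ?thesis unfolding c by (rule conjunct2)
qed

lemma Q_poly_prod_poly:
  fixes P :: "'n::finite \<Rightarrow> real poly"
  assumes "\<And>i. degree (P i) \<le> p"
  shows "(\<lambda>x. \<Prod>i\<in>UNIV. poly (P i) (x $ i)) \<in> Q_poly p"
  unfolding Q_poly_def
proof (intro CollectI exI[of _ "\<lambda>\<alpha>. \<Prod>i\<in>UNIV. coeff (P i) (\<alpha> i)"] allI)
  fix x :: "real ^ 'n"
  have "(\<Prod>i\<in>UNIV. poly (P i) (x $ i)) = (\<Prod>i\<in>UNIV. \<Sum>k\<in>{..p}. coeff (P i) k * (x $ i) ^ k)"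
  proof (intro prod.cong refl)
    fix i
    have "(\<Sum>k\<le>degree (P i). coeff (P i) k * (x $ i) ^ k) = (\<Sum>k\<in>{..p}. coeff (P i) k * (x $ i) ^ k)"
      using assms[of i] by (intro sum.mono_neutral_left) (auto simp: coeff_eq_0)
    then show "poly (P i) (x $ i) = (\<Sum>k\<in>{..p}. coeff (P i) k * (x $ i) ^ k)" by (simp add: poly_altdef)
  qed
  also have "\<dots> = (\<Sum>\<alpha>\<in>PiE UNIV (\<lambda>_. {..p}). \<Prod>i\<in>UNIV. coeff (P i) (\<alpha> i) * (x $ i) ^ \<alpha> i)"
    by (rule prod_sum_PiE) auto
  also have "PiE UNIV (\<lambda>_::'n. {..p}) = exponents p" by auto
  finally show "(\<Prod>i\<in>UNIV. poly (P i) (x $ i))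
      = (\<Sum>\<alpha>\<in>exponents p. (\<Prod>i\<in>UNIV. coeff (P i) (\<alpha> i)) * (\<Prod>i\<in>UNIV. (x $ i) ^ \<alpha> i))"
    by (simp add: prod.distrib)
qed

lemma Q_poly_const: "(\<lambda>_. a) \<in> Q_poly p"
  using Q_poly_scale[OF Q_poly_monomial[of "\<lambda>_. 0" p], of a] by simp

lemma Q_poly_line:
  assumes "q \<in> Q_poly p"
  shows "\<exists>P. degree P \<le> p \<and> (\<forall>t. q (\<chi> j. if j = i then t else x $ j) = poly P t)"
  using assms
proof (induction rule: Q_poly_induct)
  case (monomial \<alpha>)
  have "(\<Prod>j\<in>UNIV. ((\<chi> j. if j = i then t else x $ j) $ j) ^ \<alpha> j)
      = poly (monom (\<Prod>j\<in>UNIV - {i}. (x $ j) ^ \<alpha> j) (\<alpha> i)) t" for t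
  proof -
    have "(\<Prod>j\<in>UNIV. ((\<chi> j. if j = i then t else x $ j) $ j) ^ \<alpha> j)
        = t ^ \<alpha> i * (\<Prod>j\<in>UNIV - {i}. (if j = i then t else x $ j) ^ \<alpha> j)"
      by (subst prod.remove[of UNIV i]) simp_all
    also have "(\<Prod>j\<in>UNIV - {i}. (if j = i then t else x $ j) ^ \<alpha> j) = (\<Prod>j\<in>UNIV - {i}. (x $ j) ^ \<alpha> j)"
      by (intro prod.cong refl) simp
    finally show ?thesis by (simp add: poly_monom mult.commute)
  qed
  moreover have "degree (monom (\<Prod>j\<in>UNIV - {i}. (x $ j) ^ \<alpha> j) (\<alpha> i)) \<le> p"
    using monomial by (meson degree_monom_le order_trans)
  ultimately show ?case by blast
next
  case zero show ?case by (intro exI[of _ 0]) simp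
next
  case (add q r)
  then obtain P P' where "degree P \<le> p" "\<forall>t. q (\<chi> j. if j = i then t else x $ j) = poly P t"
    "degree P' \<le> p" "\<forall>t. r (\<chi> j. if j = i then t else x $ j) = poly P' t" by blast
  then show ?case by (intro exI[of _ "P + P'"]) (auto intro: degree_add_le)
next
  case (scale a q)
  then obtain P where "degree P \<le> p" "\<forall>t. q (\<chi> j. if j = i then t else x $ j) = poly P t" by blast
  moreover have "degree (smult a P) \<le> p" using degree_smult_le[of a P] calculation(1) by simp
  ultimately show ?case by (intro exI[of _ "smult a P"]) simp
qed

text \<open>
  By induction on the set \<open>I\<close> of the coordinates that are already allowed to be arbitrary: along each
  further coordinate the function is a polynomial of degree at most \<open>p\<close> with more than \<open>p\<close> zeros.
\<close>

lemma Q_poly_unisolvent: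
  fixes S :: "'n::finite \<Rightarrow> real set"
  assumes q: "q \<in> Q_poly p" and S: "\<And>i. finite (S i)" "\<And>i. card (S i) > p"
    and zero: "\<And>x. (\<forall>i. x $ i \<in> S i) \<Longrightarrow> q x = 0"
  shows "q x = 0"
proof -
  have "\<forall>x. (\<forall>i\<in>- I. x $ i \<in> S i) \<longrightarrow> q x = 0" if "finite I" for I
    using that
  proof (induction I rule: finite_induct)
    case empty
    show ?case
    proof (intro allI impI)
      fix x :: "real ^ 'n" assume "\<forall>i\<in>- {}. x $ i \<in> S i"
      then have "\<forall>i. x $ i \<in> S i" by simp
      then show "q x = 0" by (rule zero)
    qed
  next
    case (insert k I)
    show ?case
    proof (intro allI impI)
      fix x :: "real ^ 'n" assume x: "\<forall>i\<in>- insert k I. x $ i \<in> S i"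
      obtain P where P: "degree P \<le> p" "\<And>t. q (\<chi> j. if j = k then t else x $ j) = poly P t"
        using Q_poly_line[OF q, of k x] by (elim exE conjE) (rule that, assumption, erule spec)
      have root: "poly P t = 0" if "t \<in> S k" for t
        unfolding P(2)[symmetric] using x that by (intro insert.IH[rule_format]) simp
      have "P = 0"
      proof (rule ccontr)
        assume "P \<noteq> 0"
        then have "card {t. poly P t = 0} \<le> p" using card_poly_roots_bound[of P] P by auto
        moreover have "card (S k) \<le> card {t. poly P t = 0}"
          using root \<open>P \<noteq> 0\<close> by (intro card_mono poly_roots_finite) auto
        ultimately show False using S(2)[of k] by simp
      qed
      moreover have "(\<chi> j. if j = k then x $ k else x $ j) = x" by (simp add: vec_eq_iff)
      ultimately show "q x = 0" using P(2)[of "x $ k"] by simp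
    qed
  qed
  from this[of UNIV] show ?thesis by simp
qed

text \<open>
  An open set contains a grid with \<open>p + 1\<close> points in each direction.
\<close>

lemma Q_poly_zero_on_open:
  fixes q :: "real ^ 'n::finite \<Rightarrow> real"
  assumes q: "q \<in> Q_poly p" and U: "open U" "U \<noteq> {}" and zero: "\<And>x. x \<in> U \<Longrightarrow> q x = 0"
  shows "q x = 0"
proof -
  obtain y e where y: "y \<in> U" "e > 0" "ball y e \<subseteq> U" using U by (metis ex_in_conv openE)
  define \<epsilon> where "\<epsilon> = e / (2 * real CARD('n))"
  have \<epsilon>: "\<epsilon> > 0" using y by (simp add: \<epsilon>_def)
  define S where "S = (\<lambda>i. (\<lambda>k. y $ i + \<epsilon> / (real k + 1)) ` {..p})"
  show ?thesis
  proof (rule Q_poly_unisolvent[OF q, of S])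
    fix i
    show "finite (S i)" by (simp add: S_def)
    have "inj_on (\<lambda>k. y $ i + \<epsilon> / (real k + 1)) {..p}"
      using \<epsilon> by (auto simp: inj_on_def frac_eq_eq)
    then show "card (S i) > p" by (simp add: S_def card_image)
  next
    fix x assume x: "\<forall>i. x $ i \<in> S i"
    have "\<bar>(x - y) $ i\<bar> \<le> \<epsilon>" for i
    proof -
      obtain k where "x $ i = y $ i + \<epsilon> / (real k + 1)" using x by (auto simp: S_def)
      moreover have "\<epsilon> / (real k + 1) \<le> \<epsilon>" "\<epsilon> / (real k + 1) \<ge> 0" using \<epsilon> by (auto simp: field_simps)
      ultimately show ?thesis by simp
    qed
    then have "(\<Sum>i\<in>UNIV. \<bar>(x - y) $ i\<bar>) \<le> real CARD('n) * \<epsilon>"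
      using sum_bounded_above[of UNIV "\<lambda>i. \<bar>(x - y) $ i\<bar>" \<epsilon>] by simp
    then have "norm (x - y) \<le> e / 2" using norm_le_l1_cart[of "x - y"] by (simp add: \<epsilon>_def)
    then show "q x = 0" using y by (intro zero) (auto simp: dist_norm norm_minus_commute subset_iff)
  qed
qed

lemma sum_mult_axis: "(\<Sum>j\<in>UNIV. f j * (axis i 1 :: real ^ 'n::finite) $ j) = f i"
proof -
  have "(\<Sum>j\<in>UNIV. f j * (axis i 1 :: real ^ 'n) $ j) = (\<Sum>j\<in>UNIV. if j = i then f j else 0)"
    by (intro sum.cong refl) (auto simp: axis_def)
  then show ?thesis by simp
qed

text \<open>
  This is \<open>axis_deriv 1 i\<close>; it is a constant of its own because \<open>axis_deriv\<close> is computed by iterating it.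
\<close>

definition partial :: "'n::finite \<Rightarrow> (real ^ 'n \<Rightarrow> real) \<Rightarrow> real ^ 'n \<Rightarrow> real" where
  "partial i q x = deriv (\<lambda>t. q (x + t *\<^sub>R axis i 1)) 0"

lemma has_derivative_axis_line:
  "((\<lambda>t. x + t *\<^sub>R v) has_derivative (\<lambda>t. t *\<^sub>R v)) (at (t::real))"
  using has_derivative_add[OF has_derivative_const has_derivative_scaleR_left[OF has_derivative_ident]]
  by simp

lemma partial_eqI:
  assumes "(q has_derivative D) (at x)"
  shows "partial i q x = D (axis i 1)"
proof -
  have D: "(q has_derivative D) (at (x + 0 *\<^sub>R axis i 1))" using assms by simp
  have "((\<lambda>t. q (x + t *\<^sub>R axis i 1)) has_derivative (\<lambda>t. D (t *\<^sub>R axis i 1))) (at 0)"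
    by (rule has_derivative_compose[OF has_derivative_axis_line D])
  moreover have "(\<lambda>t. D (t *\<^sub>R axis i 1)) = (*) (D (axis i 1))"
    using linear_scale[OF has_derivative_linear[OF assms]] by (simp add: fun_eq_iff mult.commute)
  ultimately show ?thesis unfolding partial_def
    by (intro DERIV_imp_deriv) (simp add: has_field_derivative_def)
qed

text \<open>
  Both claims come out of one induction, since on monomials the derivative is computed explicitly as a
  sum of monomials.
\<close>

lemma Q_poly_has_derivative_partial:
  fixes q :: "real ^ 'a::finite \<Rightarrow> real"
  assumes "q \<in> Q_poly p"
  shows "(\<forall>x. (q has_derivative (\<lambda>h. \<Sum>i\<in>UNIV. partial i q x * h $ i)) (at x)) \<and> (\<forall>i. partial i q \<in> Q_poly p)"
proof -
  have "\<exists>D. (\<forall>i. D i \<in> Q_poly p) \<and> (\<forall>x. (q has_derivative (\<lambda>h. \<Sum>i\<in>UNIV. D i x * h $ i)) (at x))"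
    using assms
  proof (induction rule: Q_poly_induct)
    case (monomial \<alpha>)
    define D where "D = (\<lambda>i (x::real^'a). real (\<alpha> i) * (\<Prod>j\<in>UNIV. (x $ j) ^ (\<alpha>(i := \<alpha> i - 1)) j))"
    have D: "D i \<in> Q_poly p" for i
    proof -
      have "\<forall>j. (\<alpha>(i := \<alpha> i - 1)) j \<le> p" using monomial by (auto intro: le_trans[OF diff_le_self])
      then show ?thesis unfolding D_def by (intro Q_poly_scale Q_poly_monomial)
    qed
    have prod: "D i x = real (\<alpha> i) * (x $ i) ^ (\<alpha> i - 1) * (\<Prod>j\<in>UNIV - {i}. (x $ j) ^ \<alpha> j)" for i x
    proof -
      have "(\<Prod>j\<in>UNIV. (x $ j) ^ (\<alpha>(i := \<alpha> i - 1)) j)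
          = (x $ i) ^ (\<alpha> i - 1) * (\<Prod>j\<in>UNIV - {i}. (x $ j) ^ (\<alpha>(i := \<alpha> i - 1)) j)"
        by (subst prod.remove[of UNIV i]) simp_all
      also have "(\<Prod>j\<in>UNIV - {i}. (x $ j) ^ (\<alpha>(i := \<alpha> i - 1)) j) = (\<Prod>j\<in>UNIV - {i}. (x $ j) ^ \<alpha> j)"
        by (intro prod.cong refl) simp
      finally show ?thesis by (simp add: D_def)
    qed
    have "((\<lambda>x::real^'a. \<Prod>i\<in>UNIV. (x $ i) ^ \<alpha> i) has_derivative (\<lambda>h. \<Sum>i\<in>UNIV. D i x * h $ i)) (at x)" for x
    proof -
      have "((\<lambda>x::real^'a. (x $ i) ^ \<alpha> i) has_derivative (\<lambda>h. real (\<alpha> i) * h $ i * (x $ i) ^ (\<alpha> i - 1))) (at x)" for i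
        by (rule has_derivative_eq_rhs, rule has_derivative_power[OF bounded_linear_imp_has_derivative[OF bounded_linear_vec_nth]])
           (simp add: fun_eq_iff mult_ac)
      then have "((\<lambda>x::real^'a. \<Prod>i\<in>UNIV. (x $ i) ^ \<alpha> i) has_derivative
        (\<lambda>h. \<Sum>i\<in>UNIV. (real (\<alpha> i) * h $ i * (x $ i) ^ (\<alpha> i - 1)) * (\<Prod>j\<in>UNIV - {i}. (x $ j) ^ \<alpha> j))) (at x)"
        by (rule has_derivative_prod)
      moreover have "(\<lambda>h::real^'a. \<Sum>i\<in>UNIV. (real (\<alpha> i) * h $ i * (x $ i) ^ (\<alpha> i - 1)) * (\<Prod>j\<in>UNIV - {i}. (x $ j) ^ \<alpha> j))
          = (\<lambda>h. \<Sum>i\<in>UNIV. D i x * h $ i)"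
        unfolding prod by (intro ext sum.cong refl) (simp add: mult_ac)
      ultimately show ?thesis by simp
    qed
    then show ?case by (intro exI[of _ D] conjI allI D)
  next
    case zero
    show ?case by (intro exI[of _ "\<lambda>_ _. 0"]) (simp add: Q_poly_zero)
  next
    case (add q r)
    then obtain D D' where D: "\<forall>i. D i \<in> Q_poly p" "\<forall>x. (q has_derivative (\<lambda>h. \<Sum>i\<in>UNIV. D i x * h $ i)) (at x)"
      and D': "\<forall>i. D' i \<in> Q_poly p" "\<forall>x. (r has_derivative (\<lambda>h. \<Sum>i\<in>UNIV. D' i x * h $ i)) (at x)"
      by (elim exE conjE) (rule that, assumption+)
    have "((\<lambda>x. q x + r x) has_derivative (\<lambda>h. \<Sum>i\<in>UNIV. (D i x + D' i x) * h $ i)) (at x)" for x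
      using has_derivative_add[OF D(2)[rule_format, of x] D'(2)[rule_format, of x]]
      by (simp add: distrib_right sum.distrib)
    then show ?case using D D'
      by (intro exI[of _ "\<lambda>i x. D i x + D' i x"] conjI allI Q_poly_add) auto
  next
    case (scale a q)
    then obtain D where D: "\<forall>i. D i \<in> Q_poly p" "\<forall>x. (q has_derivative (\<lambda>h. \<Sum>i\<in>UNIV. D i x * h $ i)) (at x)"
      by (elim exE conjE) (rule that, assumption+)
    have "((\<lambda>x. a * q x) has_derivative (\<lambda>h. \<Sum>i\<in>UNIV. (a * D i x) * h $ i)) (at x)" for x
      using has_derivative_mult_right[OF D(2)[rule_format, of x], of a]
      by (simp add: sum_distrib_left mult.assoc)
    then show ?case using D
      by (intro exI[of _ "\<lambda>i x. a * D i x"] conjI allI Q_poly_scale) auto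
  qed
  then obtain D where D0: "\<forall>i. D i \<in> Q_poly p" "\<forall>x. (q has_derivative (\<lambda>h. \<Sum>i\<in>UNIV. D i x * h $ i)) (at x)"
    by (elim exE conjE) (rule that, assumption+)
  note D = D0[rule_format]
  have "partial i q = D i" for i
  proof
    fix x
    show "partial i q x = D i x"
      using partial_eqI[OF D(2)[of x], of i] by (simp add: sum_mult_axis)
  qed
  then show ?thesis using D by (simp only: simp_thms)
qed

lemmas Q_poly_has_derivative = Q_poly_has_derivative_partial[THEN conjunct1, rule_format]
  and Q_poly_partial = Q_poly_has_derivative_partial[THEN conjunct2, rule_format]

lemma Q_poly_continuous: "q \<in> Q_poly p \<Longrightarrow> continuous_on S q"
  by (rule has_derivative_continuous_on) (rule has_derivative_at_withinI[OF Q_poly_has_derivative])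

lemma partial_lin:
  assumes "q \<in> Q_poly p" "r \<in> Q_poly p"
  shows "partial i (\<lambda>x. a * q x + r x) = (\<lambda>x. a * partial i q x + partial i r x)"
proof
  fix x
  have "((\<lambda>x. a * q x + r x) has_derivative
      (\<lambda>h. a * (\<Sum>i\<in>UNIV. partial i q x * h $ i) + (\<Sum>i\<in>UNIV. partial i r x * h $ i))) (at x)"
    by (intro has_derivative_add has_derivative_mult_right assms[THEN Q_poly_has_derivative])
  from partial_eqI[OF this, of i] show "partial i (\<lambda>x. a * q x + r x) x = a * partial i q x + partial i r x"
    by (simp add: sum_mult_axis)
qed

lemma Q_poly_line_derivative:
  fixes q :: "real ^ 'a::finite \<Rightarrow> real"
  assumes "q \<in> Q_poly p"
  shows "((\<lambda>t. q (x + t *\<^sub>R axis i 1)) has_field_derivative partial i q (x + t *\<^sub>R axis i 1)) (at t)"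
proof -
  let ?y = "x + t *\<^sub>R axis i 1"
  have "((\<lambda>t. q (x + t *\<^sub>R axis i 1)) has_derivative (\<lambda>s. \<Sum>j\<in>UNIV. partial j q ?y * (s *\<^sub>R axis i 1 :: real^'a) $ j)) (at t)"
    by (rule has_derivative_compose[OF has_derivative_axis_line Q_poly_has_derivative[OF assms]])
  moreover have "(\<lambda>s. \<Sum>j\<in>UNIV. partial j q ?y * (s *\<^sub>R axis i 1 :: real^'a) $ j) = (*) (partial i q ?y)"
  proof
    fix s
    have "(\<Sum>j\<in>UNIV. partial j q ?y * (s *\<^sub>R axis i 1 :: real^'a) $ j)
        = (\<Sum>j\<in>UNIV. (partial j q ?y * s) * (axis i 1 :: real^'a) $ j)"
      by (simp add: mult_ac)
    then show "(\<Sum>j\<in>UNIV. partial j q ?y * (s *\<^sub>R axis i 1 :: real^'a) $ j) = partial i q ?y * s"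
      by (simp only: sum_mult_axis)
  qed
  ultimately show ?thesis by (simp add: has_field_derivative_def)
qed

lemma axis_deriv_0: "axis_deriv 0 i q = q"
  by (simp add: axis_deriv_def fun_eq_iff)

lemma axis_deriv_Suc:
  assumes "q \<in> Q_poly p"
  shows "axis_deriv (Suc k) i q = axis_deriv k i (partial i q)"
proof
  fix x
  have "deriv (\<lambda>t. q (x + t *\<^sub>R axis i 1)) = (\<lambda>t. partial i q (x + t *\<^sub>R axis i 1))"
    using DERIV_imp_deriv[OF Q_poly_line_derivative[OF assms]] by blast
  then show "axis_deriv (Suc k) i q x = axis_deriv k i (partial i q) x"
    by (simp add: axis_deriv_def funpow_Suc_right del: funpow.simps)
qed

lemma Q_poly_axis_deriv: "q \<in> Q_poly p \<Longrightarrow> axis_deriv k i q \<in> Q_poly p"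
  by (induction k arbitrary: q) (simp_all add: axis_deriv_0 axis_deriv_Suc Q_poly_partial)

lemma axis_deriv_lin:
  "q \<in> Q_poly p \<Longrightarrow> r \<in> Q_poly p \<Longrightarrow>
    axis_deriv k i (\<lambda>x. a * q x + r x) = (\<lambda>x. a * axis_deriv k i q x + axis_deriv k i r x)"
proof (induction k arbitrary: q r)
  case (Suc k)
  then show ?case
    by (simp add: axis_deriv_Suc[OF Q_poly_add[OF Q_poly_scale]] axis_deriv_Suc Q_poly_partial partial_lin)
qed (simp add: axis_deriv_0)

section \<open>Gauss--Lobatto nodes\<close>

text \<open>
  Rolle's theorem between neighbouring zeros. Bounding the new zeros by the extreme old ones keeps them
  inside the interval when the statement is iterated.
\<close>

lemma pderiv_roots_between:
  fixes q :: "real poly"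
  assumes "finite T" "card T = Suc n" "\<And>t. t \<in> T \<Longrightarrow> poly q t = 0"
  shows "\<exists>S. finite S \<and> card S = n \<and> (\<forall>s\<in>S. poly (pderiv q) s = 0 \<and> Min T < s \<and> s < Max T)"
  using assms
proof (induction n arbitrary: T)
  case 0
  then show ?case by (intro exI[of _ "{}"]) simp
next
  case (Suc n)
  define m where "m = Max T"
  define T' where "T' = T - {m}"
  have Tne: "T \<noteq> {}" using Suc.prems by auto
  then have m: "m \<in> T" using Suc.prems by (simp add: m_def)
  have T': "finite T'" "card T' = Suc n" using Suc.prems m by (simp_all add: T'_def)
  have T'ne: "T' \<noteq> {}" using T' by auto
  obtain S where S: "finite S" "card S = n" "\<forall>s\<in>S. poly (pderiv q) s = 0 \<and> Min T' < s \<and> s < Max T'"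
    using Suc.IH[OF T'] Suc.prems(3) by (auto simp: T'_def)
  have max': "Max T' \<in> T'" using T' T'ne by simp
  have lt: "Max T' < m"
    using max' Max_ge[OF Suc.prems(1), of "Max T'"] by (auto simp: T'_def m_def)
  obtain s where s: "Max T' < s" "s < m" "poly q m - poly q (Max T') = (m - Max T') * poly (pderiv q) s"
    using poly_MVT[OF lt, of q] by blast
  have root: "poly (pderiv q) s = 0"
    using s lt Suc.prems(3)[OF m] Suc.prems(3)[of "Max T'"] max' by (auto simp: T'_def)
  have min: "Min T \<le> Min T'" using T' T'ne Suc.prems(1) by (intro Min_antimono) (auto simp: T'_def)
  have minmax: "Min T' \<le> Max T'" using T' T'ne by simp
  show ?case
  proof (intro exI[of _ "insert s S"] conjI ballI)
    show "finite (insert s S)" using S by simp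
    show "card (insert s S) = Suc n" using S s by (subst card_insert_disjoint) auto
    fix r assume "r \<in> insert s S"
    then consider "r = s" | "r \<in> S" by blast
    then show "poly (pderiv q) r = 0" "Min T < r" "r < Max T"
      by (cases; use root S s min minmax lt in \<open>force simp: m_def\<close>)+
  qed
qed

lemma power_dvd_pderiv:
  fixes u q :: "real poly"
  assumes "u ^ Suc m dvd q"
  shows "u ^ m dvd pderiv q"
proof -
  obtain r where r: "q = u ^ Suc m * r" using assms by (elim dvdE)
  have "pderiv q = u ^ m * (u * pderiv r + smult (of_nat (Suc m)) (r * pderiv u))"
    unfolding r pderiv_mult pderiv_power_Suc by (simp add: algebra_simps)
  then show ?thesis by simp
qed

text \<open>
  Rodrigues' formula: \<open>(x\<^sup>2 - 1) ^ p\<close> has zeros of order \<open>p\<close> at \<open>-1\<close> and \<open>1\<close>, so as long as \<open>k < p\<close> its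
  \<open>k\<close>-th derivative still vanishes at both ends, and by Rolle's theorem each derivative has one more
  zero in the open interval than the previous one. After \<open>p\<close> steps the ends are lost, and the
  derivative of the Legendre polynomial has the \<open>p - 1\<close> zeros that its degree permits.
\<close>

lemma gauss_lobatto_nodes:
  assumes "p \<ge> 1"
  shows "finite (gauss_lobatto p)" "card (gauss_lobatto p) = Suc p" "gauss_lobatto p \<subseteq> {-1..1}"
proof -
  define u :: "real poly" where "u = [:-1, 0, 1:]"
  define w where "w = (\<lambda>k. (pderiv ^^ k) (u ^ p))"
  have wSuc: "w (Suc k) = pderiv (w k)" for k by (simp add: w_def)
  have deg: "degree (w k) = 2 * p - k" for k
    by (induction k) (auto simp: w_def u_def degree_power_eq degree_pderiv)
  have dvd: "u ^ (p - k) dvd w k" if "k \<le> p" for k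
    using that
  proof (induction k)
    case (Suc k)
    then have "u ^ Suc (p - Suc k) dvd w k" by (simp add: Suc_diff_Suc)
    then show ?case unfolding wSuc by (rule power_dvd_pderiv)
  qed (simp add: w_def)
  have ends: "poly (w k) 1 = 0" "poly (w k) (-1) = 0" if "k < p" for k
  proof -
    have "u ^ 1 dvd w k" using dvd[of k] that le_imp_power_dvd[of 1 "p - k" u] dvd_trans by auto
    then obtain r where "w k = u * r" by (auto elim: dvdE)
    then show "poly (w k) 1 = 0" "poly (w k) (-1) = 0" by (simp_all add: u_def)
  qed
  have roots: "\<exists>S. finite S \<and> card S = k \<and> (\<forall>s\<in>S. poly (w k) s = 0 \<and> -1 < s \<and> s < 1)" if "k \<le> p" for k
    using that
  proof (induction k)
    case 0 then show ?case by (intro exI[of _ "{}"]) simp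
  next
    case (Suc k)
    then obtain S where S: "finite S" "card S = k" "\<forall>s\<in>S. poly (w k) s = 0 \<and> -1 < s \<and> s < 1" by auto
    define T where "T = insert (-1) (insert 1 S)"
    have "card T = Suc (Suc k)" unfolding T_def using S by (auto simp: card_insert_if)
    moreover have "finite T" using S by (simp add: T_def)
    moreover have "poly (w k) t = 0" if "t \<in> T" for t using that S ends[of k] Suc.prems by (auto simp: T_def)
    ultimately obtain R where R: "finite R" "card R = Suc k" "\<forall>s\<in>R. poly (pderiv (w k)) s = 0 \<and> Min T < s \<and> s < Max T"
      using pderiv_roots_between[of T "Suc k" "w k"] by auto
    have "Min T \<ge> -1" using S by (intro Min.boundedI) (auto simp: T_def intro: less_imp_le)
    moreover have "Max T \<le> 1" using S by (intro Max.boundedI) (auto simp: T_def intro: less_imp_le)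
    ultimately have "\<forall>s\<in>R. poly (pderiv (w k)) s = 0 \<and> -1 < s \<and> s < 1" using R by force
    then show ?case using R unfolding wSuc by auto
  qed
  obtain c where c: "c \<noteq> 0" and leg: "legendre p = smult c (w p)"
    by (rule that[of "1 / (2 ^ p * fact p)"]) (simp_all add: legendre_def w_def u_def)
  have dleg: "pderiv (legendre p) = smult c (w (Suc p))" by (simp add: leg wSuc pderiv_smult)
  have ne: "w (Suc p) \<noteq> 0"
  proof
    assume "w (Suc p) = 0"
    then have "degree (w p) = 0" unfolding wSuc by (simp add: pderiv_eq_0_iff)
    then show False using deg[of p] assms by simp
  qed
  obtain S where S: "finite S" "card S = p" "\<forall>s\<in>S. poly (w p) s = 0 \<and> -1 < s \<and> s < 1"
    using roots[of p] by auto
  then have "\<exists>R. finite R \<and> card R = p - 1 \<and> (\<forall>s\<in>R. poly (pderiv (w p)) s = 0 \<and> Min S < s \<and> s < Max S)"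
    using assms by (intro pderiv_roots_between) auto
  then obtain R where R: "finite R" "card R = p - 1" "\<forall>s\<in>R. poly (w (Suc p)) s = 0 \<and> Min S < s \<and> s < Max S"
    unfolding wSuc by auto
  have Sne: "S \<noteq> {}" using S assms by auto
  have MS: "-1 < Min S" "Max S < 1" using S Sne by auto
  define Z where "Z = {\<xi>. poly (w (Suc p)) \<xi> = 0}"
  have Z: "finite Z" "card Z \<le> p - 1"
    using poly_roots_finite[OF ne] card_poly_roots_bound[OF ne] deg[of "Suc p"] by (simp_all add: Z_def)
  have "R = Z" using R Z by (intro card_seteq) (auto simp: Z_def)
  then have Zin: "-1 < s \<and> s < 1" if "s \<in> Z" for s using R MS that by force
  have gl: "gauss_lobatto p = insert (-1) (insert 1 Z)"
    using c by (auto simp: gauss_lobatto_def dleg Z_def)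
  show "finite (gauss_lobatto p)" using Z by (simp add: gl)
  show "card (gauss_lobatto p) = Suc p"
    unfolding gl using Z(1) Zin R \<open>R = Z\<close> assms by (subst card_insert_disjoint; force)+
  show "gauss_lobatto p \<subseteq> {-1..1}" using Zin by (force simp: gl)
qed

section \<open>Grid cells\<close>

lemma vertex_nth: "vertex m l z $ i = anchor m $ i + width m l * real_of_int (z $ i)"
  by (simp add: vertex_def)

lemma mem_cell:
  "x \<in> cell m l z \<longleftrightarrow> (\<forall>i. anchor m $ i + width m l * real_of_int (z $ i) \<le> x $ i \<and>
     x $ i \<le> anchor m $ i + width m l * (real_of_int (z $ i) + 1))"
  by (simp add: cell_def mem_box_cart vertex_nth)

lemma compact_cell [simp]: "compact (cell m l z)" and closed_cell [simp]: "closed (cell m l z)"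
  and convex_cell [simp]: "convex (cell m l z)"
  by (auto simp: cell_def compact_imp_closed convex_box)

locale mesh =
  fixes m :: "('n::finite) config" and l p :: nat
  assumes domain: "bounded_domain (Omega m)" and width0_pos: "0 < width0 m" and p_pos: "1 \<le> p"
begin

abbreviation "h \<equiv> width m l"
abbreviation "K z \<equiv> cell m l z"
abbreviation "active \<equiv> active_cells m l"
abbreviation "\<Omega>h \<equiv> Omega_h m l"
abbreviation "V \<equiv> V_space p m l"
abbreviation "lo i k \<equiv> anchor m $ i + h * real_of_int k"
abbreviation "hi i k \<equiv> anchor m $ i + h * (real_of_int k + 1)"

lemma h_pos: "h > 0"
  using width0_pos by (simp add: width_def)

lemma open_Omega: "open (Omega m)" and connected_Omega: "connected (Omega m)"
  and Omega_ne: "Omega m \<noteq> {}" and bounded_Omega: "bounded (Omega m)"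
  using domain by (auto simp: bounded_domain_def)

lemma mem_interior_cell:
  "x \<in> interior (K z) \<longleftrightarrow> (\<forall>i. lo i (z $ i) < x $ i \<and>
     x $ i < hi i (z $ i))"
  by (simp add: cell_def interior_cbox mem_box_cart vertex_nth)

definition center :: "int ^ 'n \<Rightarrow> real ^ 'n" where
  "center z = (\<chi> i. anchor m $ i + h * (real_of_int (z $ i) + 1 / 2))"

lemma center_interior: "center z \<in> interior (K z)"
  using h_pos by (simp add: mem_interior_cell center_def)

lemma interior_cell_ne: "interior (K z) \<noteq> {}"
  using center_interior by blast

lemma interior_cell_unique:
  assumes "x \<in> interior (K z)" "x \<in> K z'"
  shows "z' = z"
proof -
  have "z' $ i = z $ i" for i
  proof -
    have "h * real_of_int (z $ i) < h * (real_of_int (z' $ i) + 1)"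
      "h * real_of_int (z' $ i) < h * (real_of_int (z $ i) + 1)"
      using assms unfolding mem_interior_cell mem_cell by (smt (verit))+
    then show ?thesis using h_pos by (simp add: mult_less_cancel_left_pos)
  qed
  then show ?thesis by (simp add: vec_eq_iff)
qed

lemma closure_interior_cell: "closure (interior (K z)) = K z"
  using interior_cell_ne by (simp add: convex_closure_interior)

definition cell_index :: "real ^ 'n \<Rightarrow> int ^ 'n" where
  "cell_index x = (\<chi> i. \<lfloor>(x $ i - anchor m $ i) / h\<rfloor>)"

lemma mem_cell_index: "x \<in> K (cell_index x)"
  unfolding mem_cell
proof
  fix i
  have "of_int \<lfloor>(x $ i - anchor m $ i) / h\<rfloor> \<le> (x $ i - anchor m $ i) / h"
    "(x $ i - anchor m $ i) / h \<le> of_int \<lfloor>(x $ i - anchor m $ i) / h\<rfloor> + 1"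
    by (auto intro: less_imp_le)
  then show "lo i (cell_index x $ i) \<le> x $ i \<and>
     x $ i \<le> hi i (cell_index x $ i)"
    unfolding pos_le_divide_eq[OF h_pos] pos_divide_le_eq[OF h_pos] by (simp add: cell_index_def mult.commute)
qed

lemma Omega_subset: "Omega m \<subseteq> \<Omega>h"
  using mem_cell_index by (auto simp: Omega_h_def active_cells_def)

lemma finite_cells_meeting_bounded:
  assumes "bounded B"
  shows "finite {z. K z \<inter> B \<noteq> {}}"
proof -
  obtain R where R: "\<And>x. x \<in> B \<Longrightarrow> norm x \<le> R" using assms by (auto simp: bounded_iff)
  define N where "N = (\<lambda>i. {\<lfloor>(- R - anchor m $ i) / h\<rfloor> - 1 .. \<lceil>(R - anchor m $ i) / h\<rceil>})"
  have "{z. K z \<inter> B \<noteq> {}} \<subseteq> vec_lambda ` PiE UNIV N"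
  proof
    fix z assume "z \<in> {z. K z \<inter> B \<noteq> {}}"
    then obtain x where x: "x \<in> K z" "x \<in> B" by auto
    have "z $ i \<in> N i" for i
    proof -
      have "\<bar>x $ i\<bar> \<le> R" using component_le_norm_cart[of x i] R[OF x(2)] by simp
      moreover have "lo i (z $ i) \<le> x $ i" "x $ i \<le> hi i (z $ i)"
        using x(1) by (auto simp: mem_cell)
      ultimately have "real_of_int (z $ i) \<le> (R - anchor m $ i) / h" "(- R - anchor m $ i) / h \<le> real_of_int (z $ i) + 1"
        unfolding pos_le_divide_eq[OF h_pos] pos_divide_le_eq[OF h_pos] by (simp_all add: mult.commute)
      then show ?thesis unfolding N_def by (simp add: le_ceiling_iff) linarith
    qed
    then show "z \<in> vec_lambda ` PiE UNIV N"
      by (intro image_eqI[of _ _ "\<lambda>i. z $ i"]) auto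
  qed
  moreover have "finite (PiE (UNIV :: 'n set) N)" by (intro finite_PiE) (auto simp: N_def)
  ultimately show ?thesis using finite_surj by blast
qed

lemma finite_active [simp]: "finite active"
  using finite_cells_meeting_bounded[OF bounded_Omega] by (simp add: active_cells_def)

lemma compact_Omega_h: "compact \<Omega>h"
  unfolding Omega_h_def by (intro compact_UN) auto

lemma closed_Omega_h: "closed \<Omega>h"
  using compact_Omega_h by (rule compact_imp_closed)

lemma closure_Omega_subset: "closure (Omega m) \<subseteq> \<Omega>h"
  using Omega_subset closed_Omega_h by (rule closure_minimal)

lemma frontier_subset: "frontier (Omega m) \<subseteq> \<Omega>h"
  using closure_Omega_subset by (auto simp: frontier_def)

lemma cell_subset_Omega_h: "z \<in> active \<Longrightarrow> K z \<subseteq> \<Omega>h"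
  by (auto simp: Omega_h_def)

text \<open>
  The domain is open, so it cannot meet a cell in boundary points only.
\<close>

lemma active_meets_interior:
  assumes "z \<in> active"
  shows "interior (K z) \<inter> Omega m \<noteq> {}"
proof -
  have "Omega m \<inter> closure (interior (K z)) \<noteq> {}"
    using assms by (auto simp: active_cells_def closure_interior_cell)
  then show ?thesis using open_Int_closure_eq_empty[OF open_Omega] by blast
qed

lemma finite_vertices_in_bounded: "bounded B \<Longrightarrow> finite {j. vertex m l j \<in> B}"
proof (rule finite_subset)
  show "{j. vertex m l j \<in> B} \<subseteq> {z. K z \<inter> B \<noteq> {}}"
  proof clarify
    fix j assume "vertex m l j \<in> B" "K j \<inter> B = {}"
    moreover have "vertex m l j \<in> K j" using h_pos by (simp add: mem_cell vertex_nth)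
    ultimately show False by blast
  qed
qed (rule finite_cells_meeting_bounded)

lemma finite_vertex_cells: "finite (vertex_cells (j :: int ^ 'n))"
proof -
  have "vertex_cells j \<subseteq> vec_lambda ` PiE UNIV (\<lambda>i. {j $ i, j $ i - 1})"
    by (auto simp: vertex_cells_def intro!: image_eqI[of z _ "\<lambda>i. z $ i" for z])
  moreover have "finite (PiE (UNIV :: 'n set) (\<lambda>i. {j $ i, j $ i - 1}))" by (intro finite_PiE) auto
  ultimately show ?thesis using finite_surj by blast
qed

lemma finite_admissible [simp]: "finite (admissible m l)"
proof -
  have "bounded (frontier (Omega m))" by (rule compact_imp_bounded[OF compact_frontier_bounded[OF bounded_Omega]])
  then have cut: "finite (cut_cells m l)"
    unfolding cut_cells_def by (rule finite_cells_meeting_bounded)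
  have sub: "admissible m l \<subseteq> {j. vertex m l j \<in> Omega m} \<union> (\<Union>z\<in>cut_cells m l. {j. z \<in> vertex_cells j})"
    by (auto simp: admissible_def)
  have fin: "finite {j. z \<in> vertex_cells j}" for z :: "int ^ 'n"
  proof -
    have "{j. z \<in> vertex_cells j} \<subseteq> (\<lambda>z'. z' + (\<chi> i. 1)) ` vertex_cells z"
    proof
      fix j assume "j \<in> {j. z \<in> vertex_cells j}"
      then have "j - (\<chi> i. 1) \<in> vertex_cells z" by (auto simp: vertex_cells_def) (metis add_diff_cancel)
      then show "j \<in> (\<lambda>z'. z' + (\<chi> i. 1)) ` vertex_cells z" by (intro image_eqI[of _ _ "j - (\<chi> i. 1)"]) auto
    qed
    then show ?thesis by (rule finite_subset) (simp add: finite_vertex_cells)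
  qed
  show ?thesis
    by (rule finite_subset[OF sub])
       (intro finite_UnI finite_UN_I cut fin finite_vertices_in_bounded bounded_Omega)
qed

section \<open>The finite element space and its nodal basis\<close>

lemma V_zero_outside: "v \<in> V \<Longrightarrow> x \<notin> \<Omega>h \<Longrightarrow> v x = 0"
  by (simp add: V_space_def)

lemma V_cell: "v \<in> V \<Longrightarrow> z \<in> active \<Longrightarrow> \<exists>q\<in>Q_poly p. \<forall>x\<in>K z. v x = q x"
  by (simp add: V_space_def)

text \<open>
  Continuity comes from gluing: the active cells are finitely many closed sets, and \<open>v\<close> is polynomial on each.
\<close>

lemma V_spaceI:
  assumes cell: "\<And>z. z \<in> active \<Longrightarrow> \<exists>q\<in>Q_poly p. \<forall>x\<in>K z. v x = q x"
    and out: "\<And>x. x \<notin> \<Omega>h \<Longrightarrow> v x = 0"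
  shows "v \<in> V"
proof -
  have "continuous_on (\<Union>z\<in>active. K z) v"
  proof (rule continuous_on_closed_Union)
    fix z assume "z \<in> active"
    then obtain q where q: "q \<in> Q_poly p" "\<forall>x\<in>K z. v x = q x" using cell by blast
    then show "continuous_on (K z) v"
      using continuous_on_cong[OF refl, of "K z" v q] Q_poly_continuous by metis
  qed auto
  then show ?thesis using assms by (simp add: V_space_def Omega_h_def)
qed

lemma V_zero: "(\<lambda>_. 0) \<in> V"
  by (rule V_spaceI) (auto intro!: bexI[of _ "\<lambda>_. 0"] Q_poly_zero)

lemma V_add:
  assumes "u \<in> V" "v \<in> V"
  shows "(\<lambda>x. u x + v x) \<in> V"
proof (rule V_spaceI)
  fix z assume z: "z \<in> active"
  obtain q where q: "q \<in> Q_poly p" "\<forall>x\<in>K z. u x = q x" using V_cell[OF assms(1) z] by blast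
  obtain r where r: "r \<in> Q_poly p" "\<forall>x\<in>K z. v x = r x" using V_cell[OF assms(2) z] by blast
  show "\<exists>q\<in>Q_poly p. \<forall>x\<in>K z. u x + v x = q x"
    using q r by (intro bexI[of _ "\<lambda>x. q x + r x"] Q_poly_add) auto
qed (simp add: V_zero_outside[OF assms(1)] V_zero_outside[OF assms(2)])

lemma V_scale:
  assumes "u \<in> V"
  shows "(\<lambda>x. c * u x) \<in> V"
proof (rule V_spaceI)
  fix z assume z: "z \<in> active"
  obtain q where q: "q \<in> Q_poly p" "\<forall>x\<in>K z. u x = q x" using V_cell[OF assms(1) z] by blast
  show "\<exists>q\<in>Q_poly p. \<forall>x\<in>K z. c * u x = q x"
    using q by (intro bexI[of _ "\<lambda>x. c * q x"] Q_poly_scale) auto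
qed (simp add: V_zero_outside[OF assms])

lemma V_sum: "(\<And>i. i \<in> I \<Longrightarrow> f i \<in> V) \<Longrightarrow> (\<lambda>x. \<Sum>i\<in>I. f i x) \<in> V"
  by (induction I rule: infinite_finite_induct) (simp_all add: V_zero V_add)

lemma V_diff: "u \<in> V \<Longrightarrow> v \<in> V \<Longrightarrow> (\<lambda>x. u x - v x) \<in> V"
  using V_add[of u "\<lambda>x. (-1) * v x"] V_scale[of v "-1"] by simp

lemma Q_poly_eq_on_cell:
  assumes "q \<in> Q_poly p" "r \<in> Q_poly p" "\<And>x. x \<in> K z \<Longrightarrow> q x = r x"
  shows "q = r"
proof
  fix x
  have "(\<lambda>x. q x - r x) x = 0"
  proof (rule Q_poly_zero_on_open[OF Q_poly_diff[OF assms(1,2)] open_interior interior_cell_ne])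
    fix y assume "y \<in> interior (K z)"
    then show "q y - r y = 0" using assms(3) interior_subset by fastforce
  qed
  then show "q x = r x" by simp
qed

lemma cell_poly_eqI:
  assumes "q \<in> Q_poly p" "\<And>x. x \<in> K z \<Longrightarrow> q x = v x"
  shows "cell_poly p m l v z = q"
  unfolding cell_poly_def
proof (rule the_equality)
  fix r assume "r \<in> Q_poly p \<and> (\<forall>x\<in>K z. r x = v x)"
  then show "r = q" using assms by (intro Q_poly_eq_on_cell[of _ _ z]) auto
qed (use assms in auto)

abbreviation "qp v z \<equiv> cell_poly p m l v z"

lemma cell_poly:
  assumes "v \<in> V" "z \<in> active"
  shows "qp v z \<in> Q_poly p" "\<And>x. x \<in> K z \<Longrightarrow> qp v z x = v x"
proof -
  obtain q where q: "q \<in> Q_poly p" "\<forall>x\<in>K z. v x = q x" using V_cell[OF assms] by blast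
  then have "qp v z = q" by (intro cell_poly_eqI) auto
  with q show "qp v z \<in> Q_poly p" "\<And>x. x \<in> K z \<Longrightarrow> qp v z x = v x" by auto
qed

lemma cell_poly_lin:
  assumes "u \<in> V" "v \<in> V" "z \<in> active"
  shows "qp (\<lambda>x. c * u x + v x) z = (\<lambda>x. c * qp u z x + qp v z x)"
  using assms by (intro cell_poly_eqI Q_poly_add Q_poly_scale) (auto simp: cell_poly)

lemma V_continuous: "v \<in> V \<Longrightarrow> continuous_on \<Omega>h v"
  by (simp add: V_space_def)

text \<open>
  The nodes of a cell \<open>z\<close> are the product of the sets \<open>line_nodes i (z $ i)\<close>, which reduces the construction of
  the nodal basis to one dimension.
\<close>

definition line_nodes :: "'n \<Rightarrow> int \<Rightarrow> real set" where
  "line_nodes i k = (\<lambda>s. lo i k + h / 2 * (1 + s)) ` gauss_lobatto p"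

lemma line_nodes:
  shows "finite (line_nodes i k)" "card (line_nodes i k) = Suc p"
    and "\<And>t. t \<in> line_nodes i k \<Longrightarrow> lo i k \<le> t \<and> t \<le> hi i k"
    and "lo i k \<in> line_nodes i k"
    and "hi i k \<in> line_nodes i k"
proof -
  show "finite (line_nodes i k)" using gauss_lobatto_nodes(1)[OF p_pos] by (simp add: line_nodes_def)
  have "inj_on (\<lambda>s. lo i k + h / 2 * (1 + s)) (gauss_lobatto p)"
    using h_pos by (auto simp: inj_on_def)
  then show "card (line_nodes i k) = Suc p"
    using gauss_lobatto_nodes(2)[OF p_pos] by (simp add: line_nodes_def card_image)
  show "lo i k \<le> t \<and> t \<le> hi i k" if mem: "t \<in> line_nodes i k" for t
  proof -
    obtain s where s: "s \<in> gauss_lobatto p" "t = lo i k + h / 2 * (1 + s)"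
      using mem unfolding line_nodes_def by blast
    have "0 \<le> 1 + s" "1 + s \<le> 2" using s(1) gauss_lobatto_nodes(3)[OF p_pos] by auto
    then have "0 \<le> h / 2 * (1 + s)" "h / 2 * (1 + s) \<le> h / 2 * 2"
      using h_pos by (auto intro: mult_left_mono simp del: times_divide_eq_left)
    then show ?thesis unfolding s(2) by (simp add: distrib_left)
  qed
  show "lo i k \<in> line_nodes i k"
    unfolding line_nodes_def by (rule image_eqI[of _ _ "-1"]) (auto simp: gauss_lobatto_def)
  show "hi i k \<in> line_nodes i k"
    unfolding line_nodes_def by (rule image_eqI[of _ _ 1]) (auto simp: gauss_lobatto_def algebra_simps)
qed

lemma mem_nodes: "y \<in> nodes p m l \<longleftrightarrow> (\<exists>z\<in>active. \<forall>i. y $ i \<in> line_nodes i (z $ i))"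
proof
  assume "y \<in> nodes p m l"
  then obtain z \<xi> where "z \<in> active" "\<forall>i. \<xi> $ i \<in> gauss_lobatto p"
    "y = vertex m l z + (h / 2) *\<^sub>R (\<chi> i. 1 + \<xi> $ i)" by (auto simp: nodes_def)
  then show "\<exists>z\<in>active. \<forall>i. y $ i \<in> line_nodes i (z $ i)"
    by (intro bexI[of _ z]) (auto simp: line_nodes_def vertex_nth)
next
  assume "\<exists>z\<in>active. \<forall>i. y $ i \<in> line_nodes i (z $ i)"
  then obtain z where z: "z \<in> active" "\<forall>i. \<exists>s\<in>gauss_lobatto p. y $ i = lo i (z $ i) + h / 2 * (1 + s)"
    by (auto simp: line_nodes_def image_iff)
  then obtain s where s: "\<And>i. s i \<in> gauss_lobatto p" "\<And>i. y $ i = lo i (z $ i) + h / 2 * (1 + s i)"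
    by metis
  have "y = vertex m l z + (h / 2) *\<^sub>R (\<chi> i. 1 + (\<chi> i. s i) $ i)"
    using s by (simp add: vec_eq_iff vertex_nth)
  then show "y \<in> nodes p m l" using z(1) s(1) unfolding nodes_def by (intro CollectI exI[of _ z] exI[of _ "\<chi> i. s i"]) simp
qed

lemma line_nodes_in_cell: "\<forall>i. y $ i \<in> line_nodes i (z $ i) \<Longrightarrow> y \<in> K z"
  using line_nodes(3) by (simp add: mem_cell)

lemma finite_nodes [simp]: "finite (nodes p m l)"
proof -
  have "nodes p m l \<subseteq> (\<Union>z\<in>active. vec_lambda ` PiE UNIV (\<lambda>i. line_nodes i (z $ i)))"
  proof
    fix y assume "y \<in> nodes p m l"
    then obtain z where z: "z \<in> active" "\<forall>i. y $ i \<in> line_nodes i (z $ i)" by (auto simp: mem_nodes)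
    then have "y \<in> vec_lambda ` PiE UNIV (\<lambda>i. line_nodes i (z $ i))"
      by (intro image_eqI[of _ _ "\<lambda>i. y $ i"]) auto
    with z show "y \<in> (\<Union>z\<in>active. vec_lambda ` PiE UNIV (\<lambda>i. line_nodes i (z $ i)))" by blast
  qed
  then show ?thesis
    by (rule finite_subset) (intro finite_UN_I finite_active finite_imageI finite_PiE finite line_nodes(1))
qed

text \<open>
  The nodes of a cell form a tensor grid with \<open>p + 1\<close> points in each direction.
\<close>

lemma V_zero_on_cell:
  assumes v: "v \<in> V" and z: "z \<in> active" and zero: "\<And>y. y \<in> nodes p m l \<Longrightarrow> y \<in> K z \<Longrightarrow> v y = 0"
    and x: "x \<in> K z"
  shows "v x = 0"
proof -
  have "qp v z x = 0"
  proof (rule Q_poly_unisolvent[OF cell_poly(1)[OF v z], of "\<lambda>i. line_nodes i (z $ i)"])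
    fix y assume y: "\<forall>i. y $ i \<in> line_nodes i (z $ i)"
    then have "y \<in> nodes p m l" "y \<in> K z" using z mem_nodes line_nodes_in_cell by auto
    then show "qp v z y = 0" using zero cell_poly(2)[OF v z] by simp
  qed (simp_all add: line_nodes)
  then show ?thesis using cell_poly(2)[OF v z x] by simp
qed

lemma V_eqI:
  assumes "u \<in> V" "v \<in> V" "\<And>y. y \<in> nodes p m l \<Longrightarrow> u y = v y"
  shows "u = v"
proof
  fix x
  show "u x = v x"
  proof (cases "x \<in> \<Omega>h")
    case True
    then obtain z where z: "z \<in> active" "x \<in> K z" by (auto simp: Omega_h_def)
    have "u x - v x = 0"
      by (rule V_zero_on_cell[OF V_diff[OF assms(1,2)] z(1) _ z(2)]) (simp add: assms(3))
    then show ?thesis by simp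
  next
    case False
    then show ?thesis by (simp add: V_zero_outside[OF assms(1)] V_zero_outside[OF assms(2)])
  qed
qed

text \<open>
  For \<open>s\<close> outside \<open>S\<close> this is the zero polynomial, so that a node that does not belong to an interval induces the
  zero function on it.
\<close>

definition lagrange :: "real set \<Rightarrow> real \<Rightarrow> real poly" where
  "lagrange S s = (if s \<in> S then \<Prod>r\<in>S - {s}. smult (1 / (s - r)) [:- r, 1:] else 0)"

lemma lagrange:
  assumes "finite S" "card S = Suc p"
  shows "degree (lagrange S s) \<le> p" "\<And>t. t \<in> S \<Longrightarrow> poly (lagrange S s) t = (if t = s then 1 else 0)"
proof -
  show "degree (lagrange S s) \<le> p"
  proof (cases "s \<in> S")
    case True
    have "degree (\<Prod>r\<in>S - {s}. smult (1 / (s - r)) [:- r, 1:]) \<le> (\<Sum>r\<in>S - {s}. degree (smult (1 / (s - r)) [:- r, 1:]))"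
      by (rule degree_prod_sum_le[unfolded comp_def]) (use assms in simp)
    also have "\<dots> \<le> (\<Sum>r\<in>S - {s}. 1)" by (intro sum_mono) simp
    also have "\<dots> = p" using assms True by simp
    finally show ?thesis using True by (simp add: lagrange_def)
  qed (simp add: lagrange_def)
  show "poly (lagrange S s) t = (if t = s then 1 else 0)" if "t \<in> S" for t
  proof (cases "s \<in> S")
    case True
    then have e: "poly (lagrange S s) t = (\<Prod>r\<in>S - {s}. (t - r) / (s - r))"
      by (simp add: lagrange_def poly_prod diff_divide_distrib)
    show ?thesis
    proof (cases "t = s")
      case True then show ?thesis unfolding e by (auto intro!: prod.neutral)
    next
      case False
      then have "(\<Prod>r\<in>S - {s}. (t - r) / (s - r)) = 0" using that assms by (intro prod_zero) auto
      with False show ?thesis unfolding e by simp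
    qed
  qed (use that in \<open>auto simp: lagrange_def\<close>)
qed

text \<open>
  The one-dimensional nodal function of the node \<open>s\<close>, with the interval that contains \<open>t\<close> selected by rounding
  down.
\<close>

definition shape :: "'n \<Rightarrow> real \<Rightarrow> real \<Rightarrow> real" where
  "shape i s t = poly (lagrange (line_nodes i \<lfloor>(t - anchor m $ i) / h\<rfloor>) s) t"

text \<open>
  Both intervals that contain a grid point have it as a node, where their Lagrange polynomials take the same
  value. Hence rounding down may be replaced by any closed interval that contains \<open>t\<close>.
\<close>

lemma shape_eq:
  assumes k: "lo i k \<le> t" "t \<le> hi i k"
  shows "shape i s t = poly (lagrange (line_nodes i k) s) t"
proof (cases "t = hi i k")
  case True
  then have "\<lfloor>(t - anchor m $ i) / h\<rfloor> = k + 1" using h_pos by simp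
  moreover have "t \<in> line_nodes i k" using line_nodes(5) True by simp
  moreover have "t \<in> line_nodes i (k + 1)" using line_nodes(4)[of i "k + 1"] True by simp
  ultimately show ?thesis unfolding shape_def using lagrange(2) line_nodes(1,2) by simp
next
  case False
  then have "t < hi i k" using k by simp
  then have "(t - anchor m $ i) / h < real_of_int k + 1" "real_of_int k \<le> (t - anchor m $ i) / h"
    using k unfolding pos_le_divide_eq[OF h_pos] pos_divide_less_eq[OF h_pos] by (simp_all add: mult.commute)
  then have "\<lfloor>(t - anchor m $ i) / h\<rfloor> = k" by (simp add: floor_eq_iff)
  then show ?thesis by (simp add: shape_def)
qed

text \<open>
  A product of functions of one coordinate is compatible across all faces at once, without any matching
  of polynomials on neighbouring cells.
\<close>

definition tensor_shape :: "real ^ 'n \<Rightarrow> real ^ 'n \<Rightarrow> real" where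
  "tensor_shape y x = (if x \<in> \<Omega>h then \<Prod>i\<in>UNIV. shape i (y $ i) (x $ i) else 0)"

lemma tensor_shape_V: "tensor_shape y \<in> V"
proof (rule V_spaceI)
  fix z assume z: "z \<in> active"
  define q where "q = (\<lambda>x::real^'n. \<Prod>i\<in>UNIV. poly (lagrange (line_nodes i (z $ i)) (y $ i)) (x $ i))"
  have "q \<in> Q_poly p" unfolding q_def by (intro Q_poly_prod_poly lagrange(1) line_nodes)
  moreover have "tensor_shape y x = q x" if "x \<in> K z" for x
  proof -
    have "x \<in> \<Omega>h" using that z cell_subset_Omega_h by blast
    then show ?thesis using that unfolding tensor_shape_def q_def by (auto simp: mem_cell intro!: prod.cong shape_eq)
  qed
  ultimately show "\<exists>q\<in>Q_poly p. \<forall>x\<in>K z. tensor_shape y x = q x" by blast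
qed (simp add: tensor_shape_def)

lemma tensor_shape_node:
  assumes "x \<in> nodes p m l"
  shows "tensor_shape y x = (if x = y then 1 else 0)"
proof -
  obtain z where z: "z \<in> active" "\<forall>i. x $ i \<in> line_nodes i (z $ i)" using assms by (auto simp: mem_nodes)
  then have x: "x \<in> K z" using line_nodes_in_cell by blast
  have "shape i (y $ i) (x $ i) = (if x $ i = y $ i then 1 else 0)" for i
    using x z(2) lagrange(2)[OF line_nodes(1,2), of "x $ i" i "z $ i" "y $ i"]
    by (subst shape_eq[of i "z $ i"]) (auto simp: mem_cell)
  then have "tensor_shape y x = (\<Prod>i\<in>UNIV. if x $ i = y $ i then 1 else 0)"
    using x z(1) cell_subset_Omega_h by (auto simp: tensor_shape_def)
  also have "\<dots> = (if x = y then 1 else 0)"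
  proof (cases "x = y")
    case False
    then obtain i where "x $ i \<noteq> y $ i" by (auto simp: vec_eq_iff)
    then have "(\<Prod>i\<in>UNIV. if x $ i = y $ i then 1 else (0::real)) = 0" by (intro prod_zero) auto
    with False show ?thesis by simp
  qed simp
  finally show ?thesis .
qed

abbreviation "\<phi> y \<equiv> nodal_basis p m l y"

lemma nodal_basis_eq: "\<phi> y = tensor_shape y"
  unfolding nodal_basis_def
proof (rule the_equality)
  fix v assume v: "v \<in> V \<and> (\<forall>x\<in>nodes p m l. v x = (if x = y then 1 else 0))"
  show "v = tensor_shape y"
    by (rule V_eqI) (use v in \<open>simp_all add: tensor_shape_V tensor_shape_node\<close>)
qed (simp add: tensor_shape_V tensor_shape_node)

lemma nodal_basis_V: "\<phi> y \<in> V"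
  by (simp add: nodal_basis_eq tensor_shape_V)

lemma nodal_basis_node: "x \<in> nodes p m l \<Longrightarrow> \<phi> y x = (if x = y then 1 else 0)"
  by (simp add: nodal_basis_eq tensor_shape_node)

lemma nodal_basis_zero_on_cell:
  assumes "z \<in> active" "y \<notin> K z" "x \<in> K z"
  shows "\<phi> y x = 0"
  by (rule V_zero_on_cell[OF nodal_basis_V assms(1) _ assms(3)]) (use assms(2) in \<open>auto simp: nodal_basis_node\<close>)

lemma V_nodal_expansion:
  assumes "v \<in> V"
  shows "v = (\<lambda>x. \<Sum>y\<in>nodes p m l. v y * \<phi> y x)"
proof (rule V_eqI[OF assms])
  show "(\<lambda>x. \<Sum>y\<in>nodes p m l. v y * \<phi> y x) \<in> V" by (rule V_sum[OF V_scale[OF nodal_basis_V]])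
  fix x assume x: "x \<in> nodes p m l"
  then have "(\<Sum>y\<in>nodes p m l. v y * \<phi> y x) = (\<Sum>y\<in>nodes p m l. if y = x then v y else 0)"
    by (intro sum.cong refl) (auto simp: nodal_basis_node)
  then show "v x = (\<Sum>y\<in>nodes p m l. v y * \<phi> y x)" using x by simp
qed

section \<open>Local and coarse spaces\<close>

fun local_nodes :: "local_kind \<Rightarrow> int ^ 'n \<Rightarrow> (real ^ 'n) set" where
  "local_nodes Dirichlet j = {x \<in> nodes p m l. x \<in> interior (full_patch m l j)}"
| "local_nodes Full_Residual j = {x \<in> nodes p m l. node_patch m l x \<subseteq> patch m l j}"

lemma V_local_eq: "V_local \<kappa> p m l j = nodal_span p m l (local_nodes \<kappa> j)"
  by (cases \<kappa>) auto

lemma local_nodes_subset: "local_nodes \<kappa> j \<subseteq> nodes p m l"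
  by (cases \<kappa>) auto

text \<open>
  The two kinds of local spaces differ in the nodes that they use, but both admit only nodes all of whose
  active cells belong to the patch. For the full-residual kind the center of a cell identifies the
  cell within the patch; for the Dirichlet kind the node can be shifted by \<open>e / 2\<close> in both directions of every
  axis without leaving the patch.
\<close>

lemma local_node_cells:
  assumes y: "y \<in> local_nodes \<kappa> j" and z: "z \<in> active" "y \<in> K z"
  shows "z \<in> vertex_cells j"
proof (cases \<kappa>)
  case Full_Residual
  then have "node_patch m l y \<subseteq> patch m l j" using y by simp
  moreover have "center z \<in> node_patch m l y"
    using z center_interior[of z] interior_subset by (auto simp: node_patch_def)
  ultimately obtain z' where "z' \<in> vertex_cells j" "center z \<in> K z'" by (auto simp: patch_def)
  then show ?thesis using interior_cell_unique[OF center_interior] by blast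
next
  case Dirichlet
  then have "y \<in> interior (full_patch m l j)" using y by simp
  then obtain e where e: "e > 0" "ball y e \<subseteq> full_patch m l j" by (auto simp: mem_interior)
  have patch: "anchor m $ i + h * (real_of_int (j $ i) - 1) \<le> x $ i \<and> x $ i \<le> hi i (j $ i)"
    if x: "x \<in> full_patch m l j" for x i
  proof -
    obtain w where w: "w \<in> vertex_cells j" "x \<in> K w" using x by (auto simp: full_patch_def)
    then have "w $ i = j $ i \<or> w $ i = j $ i - 1" by (simp add: vertex_cells_def)
    then have "real_of_int (j $ i) - 1 \<le> real_of_int (w $ i)" "real_of_int (w $ i) + 1 \<le> real_of_int (j $ i) + 1"
      by auto
    then have "h * (real_of_int (j $ i) - 1) \<le> h * real_of_int (w $ i)"
      "h * (real_of_int (w $ i) + 1) \<le> h * (real_of_int (j $ i) + 1)"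
      using h_pos by (simp_all add: mult_left_mono)
    moreover have "lo i (w $ i) \<le> x $ i" "x $ i \<le> hi i (w $ i)"
      using w(2) by (auto simp: mem_cell)
    ultimately show ?thesis by linarith
  qed
  have "z $ i = j $ i \<or> z $ i = j $ i - 1" for i
  proof -
    have "y + (e / 2) *\<^sub>R axis i 1 \<in> ball y e" "y - (e / 2) *\<^sub>R axis i 1 \<in> ball y e"
      using e(1) by (auto simp: dist_norm)
    then have "y + (e / 2) *\<^sub>R axis i 1 \<in> full_patch m l j" "y - (e / 2) *\<^sub>R axis i 1 \<in> full_patch m l j"
      using e(2) by auto
    from patch[OF this(1), of i] patch[OF this(2), of i]
    have "y $ i + e / 2 \<le> hi i (j $ i)"
      "anchor m $ i + h * (real_of_int (j $ i) - 1) \<le> y $ i - e / 2" by simp_all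
    moreover have "lo i (z $ i) \<le> y $ i" "y $ i \<le> hi i (z $ i)"
      using z(2) by (auto simp: mem_cell)
    ultimately have "h * real_of_int (z $ i) < h * (real_of_int (j $ i) + 1)"
      "h * (real_of_int (j $ i) - 1) < h * (real_of_int (z $ i) + 1)" using e(1) by linarith+
    then show ?thesis using h_pos by (simp add: mult_less_cancel_left_pos) linarith
  qed
  then show ?thesis by (simp add: vertex_cells_def)
qed

lemma nodal_span_V: "v \<in> nodal_span p m l Y \<Longrightarrow> v \<in> V"
  unfolding nodal_span_def using V_sum[OF V_scale[OF nodal_basis_V]] by auto

lemma V_local_V: "v \<in> V_local \<kappa> p m l j \<Longrightarrow> v \<in> V"
  unfolding V_local_eq by (rule nodal_span_V)

lemma V_local_zero:
  assumes "v \<in> V_local \<kappa> p m l j" "z \<in> active" "z \<notin> vertex_cells j" "x \<in> K z"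
  shows "v x = 0"
proof -
  obtain c where c: "v = (\<lambda>x. \<Sum>y\<in>local_nodes \<kappa> j. c y * \<phi> y x)"
    using assms(1) unfolding V_local_eq nodal_span_def by auto
  have "\<phi> y x = 0" if "y \<in> local_nodes \<kappa> j" for y
    using that assms local_node_cells by (intro nodal_basis_zero_on_cell[of z]) auto
  then show ?thesis unfolding c by (intro sum.neutral) simp
qed

end

text \<open>
  The prolongation is linear, so the coarse space inherits from the nodal basis of the coarser level the finite
  spanning family that the projection onto it requires.
\<close>

lemma V_coarse_eq_span:
  assumes "mesh m p" "l \<ge> 1"
  shows "V_coarse p m l = {v. \<exists>c. v = (\<lambda>x. \<Sum>y\<in>nodes p m (l - 1). c y * prolongation m l (nodal_basis p m (l - 1) y) x)}"
proof -
  interpret C: mesh m "l - 1" p using assms by simp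
  have pro: "prolongation m l (\<lambda>x. \<Sum>y\<in>nodes p m (l - 1). c y * nodal_basis p m (l - 1) y x)
      = (\<lambda>x. \<Sum>y\<in>nodes p m (l - 1). c y * prolongation m l (nodal_basis p m (l - 1) y) x)" for c
    by (simp add: prolongation_def fun_eq_iff)
  show ?thesis
  proof (intro equalityI subsetI)
    fix u assume "u \<in> V_coarse p m l"
    then obtain v where v: "v \<in> V_space p m (l - 1)" "u = prolongation m l v" by (auto simp: V_coarse_def)
    have "u = (\<lambda>x. \<Sum>y\<in>nodes p m (l - 1). v y * prolongation m l (nodal_basis p m (l - 1) y) x)"
      unfolding v(2) pro[symmetric] using C.V_nodal_expansion[OF v(1)] by (rule arg_cong)
    then show "u \<in> {v. \<exists>c. v = (\<lambda>x. \<Sum>y\<in>nodes p m (l - 1). c y * prolongation m l (nodal_basis p m (l - 1) y) x)}"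
      by (intro CollectI exI)
  next
    fix u assume "u \<in> {v. \<exists>c. v = (\<lambda>x. \<Sum>y\<in>nodes p m (l - 1). c y * prolongation m l (nodal_basis p m (l - 1) y) x)}"
    then obtain c where "u = (\<lambda>x. \<Sum>y\<in>nodes p m (l - 1). c y * prolongation m l (nodal_basis p m (l - 1) y) x)" by auto
    then have "u = prolongation m l (\<lambda>x. \<Sum>y\<in>nodes p m (l - 1). c y * nodal_basis p m (l - 1) y x)" unfolding pro .
    moreover have "(\<lambda>x. \<Sum>y\<in>nodes p m (l - 1). c y * nodal_basis p m (l - 1) y x) \<in> V_space p m (l - 1)"
      by (rule C.V_sum[OF C.V_scale[OF C.nodal_basis_V]])
    ultimately show "u \<in> V_coarse p m l" unfolding V_coarse_def by (rule image_eqI)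
  qed
qed

text \<open>
  A fine cell lies in the coarse cell with the index halved and rounded down; if the fine cell is active, so is the coarse
  one, and the polynomial on the coarse cell can be used on the fine cell.
\<close>

lemma prolongation_V_space:
  assumes "mesh m p" "l \<ge> 1" and v: "v \<in> V_space p m (l - 1)"
  shows "prolongation m l v \<in> V_space p m l"
proof -
  interpret F: mesh m l p using assms by simp
  interpret C: mesh m "l - 1" p using assms by simp
  have width: "width m (l - 1) = 2 * width m l" using assms(2) by (cases l) (auto simp: width_def)
  show ?thesis
  proof (rule F.V_spaceI)
    fix z assume z: "z \<in> active_cells m l"
    define Z :: "int ^ 'a" where "Z = (\<chi> i. z $ i div 2)"
    have sub: "cell m l z \<subseteq> cell m (l - 1) Z"
    proof
      fix x assume x: "x \<in> cell m l z"
      show "x \<in> cell m (l - 1) Z"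
        unfolding mem_cell
      proof
        fix i
        have "2 * (Z $ i) \<le> z $ i" "z $ i + 1 \<le> 2 * (Z $ i + 1)" by (simp_all add: Z_def)
        then have "real_of_int (2 * (Z $ i)) \<le> real_of_int (z $ i)" "real_of_int (z $ i + 1) \<le> real_of_int (2 * (Z $ i + 1))"
          by (simp_all only: of_int_le_iff)
        then have "2 * real_of_int (Z $ i) \<le> real_of_int (z $ i)" "real_of_int (z $ i) + 1 \<le> 2 * (real_of_int (Z $ i) + 1)"
          by simp_all
        then have "width m l * (2 * real_of_int (Z $ i)) \<le> width m l * real_of_int (z $ i)"
          "width m l * (real_of_int (z $ i) + 1) \<le> width m l * (2 * (real_of_int (Z $ i) + 1))"
          using F.h_pos by (auto intro: mult_left_mono)
        moreover have "anchor m $ i + width m l * real_of_int (z $ i) \<le> x $ i"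
          "x $ i \<le> anchor m $ i + width m l * (real_of_int (z $ i) + 1)" using x by (auto simp: mem_cell)
        ultimately show "anchor m $ i + width m (l - 1) * real_of_int (Z $ i) \<le> x $ i \<and>
            x $ i \<le> anchor m $ i + width m (l - 1) * (real_of_int (Z $ i) + 1)"
          unfolding width by (simp add: algebra_simps)
      qed
    qed
    then have "Z \<in> active_cells m (l - 1)" using z by (auto simp: active_cells_def)
    from C.V_cell[OF v this] obtain q where q: "q \<in> Q_poly p" "\<forall>x\<in>cell m (l - 1) Z. v x = q x" by blast
    have "prolongation m l v x = q x" if "x \<in> cell m l z" for x
      using that sub q F.cell_subset_Omega_h[OF z] by (auto simp: prolongation_def)
    with q show "\<exists>q\<in>Q_poly p. \<forall>x\<in>cell m l z. prolongation m l v x = q x" by blast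
  qed (simp add: prolongation_def)
qed

section \<open>The boundary as a graph\<close>

text \<open>
  One chart of the boundary, with the continuous derivative \<open>f'\<close> of the graph function \<open>f\<close>. Below, \<open>G\<close> is the
  gradient of \<open>f\<close>, the boundary in the chart is the zero set of \<open>\<psi>\<close>, \<open>N\<close> is the gradient of \<open>\<psi>\<close>, and
  \<open>\<nu>\<close> is the outward unit normal.
\<close>

locale graph_chart =
  fixes D :: "(real ^ 'n::finite) set" and U and k :: 'n and \<sigma> :: real and f :: "real ^ 'n \<Rightarrow> real"
    and f' :: "(real ^ 'n) \<Rightarrow> ((real ^ 'n) \<Rightarrow>\<^sub>L real)"
  assumes open_D: "open D" and open_U: "open U" and sigma: "\<sigma> \<in> {-1, 1}"
    and deriv: "\<And>x. (f has_derivative blinfun_apply (f' x)) (at x)"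
    and cont_deriv: "continuous_on UNIV f'"
    and indep: "\<And>y t. f (y + t *\<^sub>R axis k 1) = f y"
    and below: "D \<inter> U = {y \<in> U. \<sigma> * (y $ k - f y) < 0}"
begin

definition G :: "real ^ 'n \<Rightarrow> real ^ 'n" where "G x = (\<chi> i. f' x (axis i 1))"
definition N :: "real ^ 'n \<Rightarrow> real ^ 'n" where "N x = axis k 1 - G x"
definition \<nu> :: "real ^ 'n \<Rightarrow> real ^ 'n" where "\<nu> x = (\<sigma> / norm (N x)) *\<^sub>R N x"

lemma sigma_sq: "\<sigma> * \<sigma> = 1" "\<bar>\<sigma>\<bar> = 1"
  using sigma by auto

lemma deriv_eq: "f' x v = G x \<bullet> v"
proof -
  have "f' x v = f' x (\<Sum>i\<in>UNIV. v $ i *\<^sub>R axis i 1)"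
    using basis_expansion[of v] by (simp add: scalar_mult_eq_scaleR)
  also have "\<dots> = (\<Sum>i\<in>UNIV. v $ i * f' x (axis i 1))"
    by (simp add: blinfun.sum_right blinfun.scaleR_right)
  finally show ?thesis by (simp add: G_def inner_vec_def mult.commute)
qed

lemma f_derivative: "(f has_derivative (\<lambda>v. G x \<bullet> v)) (at x)"
  using deriv[of x] by (simp add: deriv_eq[abs_def])

lemma f_line_derivative: "((\<lambda>t. f (x + t *\<^sub>R v)) has_field_derivative G (x + t *\<^sub>R v) \<bullet> v) (at t)"
proof -
  have "((\<lambda>t. f (x + t *\<^sub>R v)) has_derivative (\<lambda>s. G (x + t *\<^sub>R v) \<bullet> (s *\<^sub>R v))) (at t)"
    by (rule has_derivative_compose[OF has_derivative_axis_line f_derivative])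
  moreover have "(\<lambda>s. G (x + t *\<^sub>R v) \<bullet> (s *\<^sub>R v)) = (*) (G (x + t *\<^sub>R v) \<bullet> v)"
    by (simp add: fun_eq_iff mult.commute)
  ultimately show ?thesis by (simp add: has_field_derivative_def)
qed

lemma G_k: "G x $ k = 0"
proof -
  have "((\<lambda>t. f (x + t *\<^sub>R axis k 1)) has_field_derivative G (x + 0 *\<^sub>R axis k 1) \<bullet> axis k 1) (at 0)"
    by (rule f_line_derivative)
  then have "((\<lambda>t::real. f x) has_field_derivative G x \<bullet> axis k 1) (at 0)"
    by (simp only: indep) simp
  then have "G x \<bullet> axis k 1 = 0" using DERIV_unique DERIV_const by blast
  then show ?thesis by (simp add: inner_axis)
qed

lemma N_k: "N x $ k = 1"
  by (simp add: N_def G_k)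

lemma norm_N: "norm (N x) \<ge> 1"
  using component_le_norm_cart[of "N x" k] by (simp add: N_k)

lemma norm_nu: "norm (\<nu> x) = 1"
proof -
  have "N x \<noteq> 0" using norm_N[of x] by auto
  then show ?thesis using sigma_sq(2) by (simp add: \<nu>_def)
qed

lemma f_continuous: "continuous_on S f"
  by (rule has_derivative_continuous_on) (rule has_derivative_at_withinI[OF f_derivative])

lemma continuous_G: "continuous_on S G"
  unfolding G_def
  by (intro continuous_on_vec_lambda continuous_intros continuous_on_subset[OF cont_deriv]) auto

lemma continuous_nu: "continuous_on S \<nu>"
proof -
  have "N x \<noteq> 0" for x using norm_N[of x] by auto
  then show ?thesis unfolding \<nu>_def N_def
    by (intro continuous_intros continuous_G) (auto simp: N_def)
qed

definition \<psi> :: "real ^ 'n \<Rightarrow> real" where "\<psi> y = y $ k - f y"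

lemma psi_derivative: "(\<psi> has_derivative (\<lambda>v. N x \<bullet> v)) (at x)"
proof -
  have "((\<lambda>y. y $ k - f y) has_derivative (\<lambda>v. v $ k - G x \<bullet> v)) (at x)"
    by (intro has_derivative_diff f_derivative bounded_linear_imp_has_derivative bounded_linear_vec_nth)
  moreover have "(\<lambda>v. v $ k - G x \<bullet> v) = (\<lambda>v. N x \<bullet> v)"
    by (simp add: fun_eq_iff N_def inner_diff_left inner_axis')
  ultimately show ?thesis by (simp add: \<psi>_def[abs_def])
qed

lemma psi_line_derivative: "((\<lambda>t. \<psi> (x + t *\<^sub>R v)) has_field_derivative N x \<bullet> v) (at 0)"
proof -
  have "((\<lambda>t. \<psi> (x + t *\<^sub>R v)) has_derivative (\<lambda>s. N (x + 0 *\<^sub>R v) \<bullet> (s *\<^sub>R v))) (at 0)"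
    by (rule has_derivative_compose[OF has_derivative_axis_line psi_derivative])
  moreover have "(\<lambda>s. N (x + 0 *\<^sub>R v) \<bullet> (s *\<^sub>R v)) = (*) (N x \<bullet> v)"
    by (simp add: fun_eq_iff mult.commute)
  ultimately show ?thesis by (simp add: has_field_derivative_def)
qed

lemma psi_continuous: "continuous_on S \<psi>"
  unfolding \<psi>_def by (intro continuous_intros f_continuous)

lemma mem_D: "y \<in> U \<Longrightarrow> y \<in> D \<longleftrightarrow> \<sigma> * \<psi> y < 0"
  using below unfolding \<psi>_def by blast

lemma not_closure:
  assumes "y \<in> U" "\<sigma> * \<psi> y > 0"
  shows "y \<notin> closure D"
proof -
  have "open {y \<in> U. 0 < \<sigma> * \<psi> y}"
  proof -
    have "open (U \<inter> (\<lambda>y. \<sigma> * \<psi> y) -` {0<..})"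
      using open_U by (intro continuous_open_preimage continuous_intros psi_continuous) auto
    moreover have "{y \<in> U. 0 < \<sigma> * \<psi> y} = U \<inter> (\<lambda>y. \<sigma> * \<psi> y) -` {0<..}" by auto
    ultimately show ?thesis by simp
  qed
  moreover have "{y \<in> U. 0 < \<sigma> * \<psi> y} \<inter> D = {}" using mem_D by force
  ultimately have "{y \<in> U. 0 < \<sigma> * \<psi> y} \<inter> closure D = {}"
    using open_Int_closure_eq_empty by blast
  then show ?thesis using assms by blast
qed

lemma eventually_in_U: "x \<in> U \<Longrightarrow> \<forall>\<^sub>F t in at_right (0::real). x + t *\<^sub>R v \<in> U"
proof -
  assume "x \<in> U"
  have "((\<lambda>t. x + t *\<^sub>R v) \<longlongrightarrow> x + 0 *\<^sub>R v) (at_right 0)" by (intro tendsto_intros)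
  then show ?thesis using topological_tendstoD[OF _ open_U, of _ "x + 0 *\<^sub>R v"] \<open>x \<in> U\<close> by simp
qed

text \<open>
  Along the line in the direction of \<open>\<nu> x\<close> the function \<open>\<sigma> * \<psi>\<close> has the derivative \<open>norm (N x) > 0\<close> at \<open>x\<close>, so
  it changes its sign there.
\<close>

lemma nu_sides:
  assumes x: "x \<in> U" and zero: "\<psi> x = 0"
  shows "\<forall>\<^sub>F t in at_right 0. x - t *\<^sub>R \<nu> x \<in> D \<and> x + t *\<^sub>R \<nu> x \<notin> closure D"
proof -
  have N: "norm (N x) > 0" using norm_N[of x] by linarith
  have "N x \<bullet> \<nu> x = \<sigma> * norm (N x)"
    using N by (simp add: \<nu>_def power2_norm_eq_inner[symmetric] power2_eq_square)
  then have d: "((\<lambda>t. \<sigma> * \<psi> (x + t *\<^sub>R \<nu> x)) has_field_derivative norm (N x)) (at 0)"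
    using DERIV_cmult[OF psi_line_derivative[of x "\<nu> x"], of \<sigma>] sigma_sq(1)
    by (simp add: mult.assoc[symmetric])
  obtain d1 where d1: "d1 > 0" "\<And>h. h > 0 \<Longrightarrow> h < d1 \<Longrightarrow> 0 < \<sigma> * \<psi> (x + h *\<^sub>R \<nu> x)"
    using DERIV_pos_inc_right[OF d N] zero by auto
  obtain d2 where d2: "d2 > 0" "\<And>h. h > 0 \<Longrightarrow> h < d2 \<Longrightarrow> \<sigma> * \<psi> (x - h *\<^sub>R \<nu> x) < 0"
    using DERIV_pos_inc_left[OF d N] zero by auto
  have "\<forall>\<^sub>F t in at_right (0::real). 0 < t \<and> t < min d1 d2"
    using d1 d2 by (auto simp: eventually_at_right_field intro!: exI[of _ "min d1 d2"])
  moreover have "\<forall>\<^sub>F t in at_right 0. x + t *\<^sub>R (- \<nu> x) \<in> U" "\<forall>\<^sub>F t in at_right 0. x + t *\<^sub>R \<nu> x \<in> U"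
    by (rule eventually_in_U[OF x])+
  ultimately show ?thesis
  proof eventually_elim
    case (elim t)
    then have "\<sigma> * \<psi> (x - t *\<^sub>R \<nu> x) < 0" "x - t *\<^sub>R \<nu> x \<in> U" using d2(2)[of t] by auto
    then have "x - t *\<^sub>R \<nu> x \<in> D" using mem_D by blast
    moreover have "x + t *\<^sub>R \<nu> x \<notin> closure D" using elim d1(2)[of t] by (intro not_closure) auto
    ultimately show ?case ..
  qed
qed

lemma mem_frontier:
  assumes "y \<in> U"
  shows "y \<in> frontier D \<longleftrightarrow> \<psi> y = 0"
proof
  assume y: "y \<in> frontier D"
  then have "y \<notin> D" "y \<in> closure D" using open_D by (auto simp: frontier_def interior_open)
  then have "\<not> \<sigma> * \<psi> y < 0" "\<not> \<sigma> * \<psi> y > 0" using mem_D not_closure assms by blast+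
  then show "\<psi> y = 0" using sigma by auto
next
  assume z: "\<psi> y = 0"
  then have "y \<notin> D" using mem_D assms by simp
  moreover have "y \<in> closure D"
  proof -
    have "((\<lambda>t. y - t *\<^sub>R \<nu> y) \<longlongrightarrow> y - 0 *\<^sub>R \<nu> y) (at_right (0::real))" by (intro tendsto_intros)
    moreover have "\<forall>\<^sub>F t in at_right 0. y - t *\<^sub>R \<nu> y \<in> closure D"
      using nu_sides[OF assms z] closure_subset by (auto elim!: eventually_mono)
    ultimately show ?thesis by (intro Lim_in_closed_set[of "closure D" _ "at_right 0"]) auto
  qed
  ultimately show "y \<in> frontier D" using open_D by (simp add: frontier_def interior_open)
qed

lemma nu_tangent:
  assumes x: "x \<in> U" "\<psi> x = 0"
  shows "((\<lambda>y. (\<nu> x \<bullet> (y - x)) / norm (y - x)) \<longlongrightarrow> 0) (at x within frontier D)"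
proof -
  have "(\<psi> has_derivative (\<lambda>v. N x \<bullet> v)) (at x within frontier D)"
    by (rule has_derivative_at_withinI[OF psi_derivative])
  then have "((\<lambda>y. norm (\<psi> y - \<psi> x - N x \<bullet> (y - x)) / norm (y - x)) \<longlongrightarrow> 0) (at x within frontier D)"
    by (simp add: has_derivative_iff_norm)
  moreover have "\<forall>\<^sub>F y in at x within frontier D. norm (\<psi> y - \<psi> x - N x \<bullet> (y - x)) / norm (y - x) = \<bar>(N x \<bullet> (y - x)) / norm (y - x)\<bar>"
    unfolding eventually_at_topological
    using open_U x mem_frontier by (intro exI[of _ U]) simp
  ultimately have "((\<lambda>y. \<bar>(N x \<bullet> (y - x)) / norm (y - x)\<bar>) \<longlongrightarrow> 0) (at x within frontier D)"
    by (rule Lim_transform_eventually)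
  then have "((\<lambda>y. (N x \<bullet> (y - x)) / norm (y - x)) \<longlongrightarrow> 0) (at x within frontier D)"
    by (rule tendsto_rabs_zero_cancel)
  then have "((\<lambda>y. \<sigma> / norm (N x) * ((N x \<bullet> (y - x)) / norm (y - x))) \<longlongrightarrow> \<sigma> / norm (N x) * 0) (at x within frontier D)"
    by (rule tendsto_mult_left)
  then show ?thesis by (simp add: \<nu>_def)
qed

text \<open>
  The curves \<open>Y\<close> in the graph above the coordinate lines force a vector that is orthogonal to the boundary
  to be a multiple of \<open>N x\<close>; the sides then fix its sign.
\<close>

lemma nu_unique:
  assumes x: "x \<in> U" "\<psi> x = 0"
    and n: "norm n = 1" and tan: "((\<lambda>y. (n \<bullet> (y - x)) / norm (y - x)) \<longlongrightarrow> 0) (at x within frontier D)"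
    and side: "\<forall>\<^sub>F t in at_right 0. x - t *\<^sub>R n \<in> D \<and> x + t *\<^sub>R n \<notin> closure D"
  shows "n = \<nu> x"
proof -
  have comp: "n $ i = - n $ k * G x $ i" if i: "i \<noteq> k" for i
  proof -
    \<comment> \<open>Y t is the point of the graph above x + t e_i, and \<tau> is its velocity at t = 0.\<close>
    define q where "q = (\<lambda>t. f (x + t *\<^sub>R axis i 1) - f x)"
    define Y where "Y = (\<lambda>t. (x + t *\<^sub>R axis i 1) + q t *\<^sub>R axis k 1)"
    define \<tau> where "\<tau> = axis i 1 + G x $ i *\<^sub>R axis k (1::real)"
    have "((\<lambda>t. f (x + t *\<^sub>R axis i 1)) has_field_derivative G (x + 0 *\<^sub>R axis i 1) \<bullet> axis i 1) (at 0)"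
      by (rule f_line_derivative)
    then have "((\<lambda>t. q t / t) \<longlongrightarrow> G x $ i) (at 0)"
      by (simp add: has_field_derivative_iff q_def inner_axis)
    then have q: "((\<lambda>t. q t / t) \<longlongrightarrow> G x $ i) (at_right 0)" by (rule filterlim_mono) (auto simp: at_le)
    have q0: "(q \<longlongrightarrow> 0) (at_right 0)"
    proof -
      have "((\<lambda>t. q t / t * t) \<longlongrightarrow> G x $ i * 0) (at_right 0)" by (intro tendsto_mult q tendsto_ident_at)
      moreover have "\<forall>\<^sub>F t in at_right 0. q t / t * t = q t" by (auto simp: eventually_at_right_field intro!: exI[of _ 1])
      ultimately show ?thesis using Lim_transform_eventually by fastforce
    qed
    have Y0: "(Y \<longlongrightarrow> x) (at_right 0)"
    proof -
      have "(Y \<longlongrightarrow> (x + 0 *\<^sub>R axis i 1) + 0 *\<^sub>R axis k 1) (at_right 0)"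
        unfolding Y_def by (intro tendsto_intros q0)
      then show ?thesis by simp
    qed
    have psiY: "\<psi> (Y t) = 0" for t
    proof -
      have "f (Y t) = f (x + t *\<^sub>R axis i 1)" unfolding Y_def by (rule indep)
      moreover have "Y t $ k = x $ k + q t" using i by (simp add: Y_def axis_def)
      ultimately show ?thesis using x(2) by (simp add: \<psi>_def q_def)
    qed
    have Yne: "Y t \<noteq> x" if "t > 0" for t
    proof
      assume "Y t = x"
      then have "Y t $ i = x $ i" by simp
      then show False using i that by (simp add: Y_def axis_def)
    qed
    have YU: "\<forall>\<^sub>F t in at_right 0. Y t \<in> U" using topological_tendstoD[OF Y0 open_U x(1)] .
    have pos: "\<forall>\<^sub>F t in at_right (0::real). 0 < t" by (simp add: eventually_at_right_less)
    have "\<forall>\<^sub>F t in at_right 0. Y t \<in> frontier D \<and> Y t \<noteq> x"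
      using YU pos by eventually_elim (use mem_frontier psiY Yne in auto)
    then have "filterlim Y (at x within frontier D) (at_right 0)"
      using Y0 by (simp add: filterlim_at)
    from filterlim_compose[OF tan this]
    have lim0: "((\<lambda>t. (n \<bullet> (Y t - x)) / norm (Y t - x)) \<longlongrightarrow> 0) (at_right 0)" .
    have limtau: "((\<lambda>t. (1 / t) *\<^sub>R (Y t - x)) \<longlongrightarrow> \<tau>) (at_right 0)"
    proof -
      have "((\<lambda>t. axis i 1 + (q t / t) *\<^sub>R axis k 1) \<longlongrightarrow> \<tau>) (at_right 0)"
        unfolding \<tau>_def by (intro tendsto_intros q)
      moreover have "\<forall>\<^sub>F t in at_right 0. axis i 1 + (q t / t) *\<^sub>R axis k 1 = (1 / t) *\<^sub>R (Y t - x)"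
        using pos by eventually_elim (simp add: Y_def scaleR_add_right)
      ultimately show ?thesis by (rule Lim_transform_eventually)
    qed
    have "((\<lambda>t. (n \<bullet> (Y t - x)) / norm (Y t - x) * norm ((1 / t) *\<^sub>R (Y t - x))) \<longlongrightarrow> 0 * norm \<tau>) (at_right 0)"
      by (intro tendsto_mult lim0 tendsto_norm limtau)
    moreover have "\<forall>\<^sub>F t in at_right 0. (n \<bullet> (Y t - x)) / norm (Y t - x) * norm ((1 / t) *\<^sub>R (Y t - x)) = n \<bullet> ((1 / t) *\<^sub>R (Y t - x))"
      using pos by eventually_elim (use Yne in \<open>simp\<close>)
    ultimately have "((\<lambda>t. n \<bullet> ((1 / t) *\<^sub>R (Y t - x))) \<longlongrightarrow> 0) (at_right 0)"
      using Lim_transform_eventually by fastforce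
    moreover have "((\<lambda>t. n \<bullet> ((1 / t) *\<^sub>R (Y t - x))) \<longlongrightarrow> n \<bullet> \<tau>) (at_right 0)"
      by (intro tendsto_intros limtau)
    ultimately have "n \<bullet> \<tau> = 0" using tendsto_unique[of "at_right (0::real)"] by simp
    then show ?thesis by (simp add: \<tau>_def inner_add_right inner_axis eq_neg_iff_add_eq_0 mult.commute)
  qed
  have nN: "n = n $ k *\<^sub>R N x"
    unfolding vec_eq_iff
  proof
    fix i
    show "n $ i = (n $ k *\<^sub>R N x) $ i"
      using comp[of i] N_k[of x] by (cases "i = k") (auto simp: N_def axis_def)
  qed
  then have "1 = \<bar>n $ k\<bar> * norm (N x)" using n by (metis norm_scaleR)
  moreover have Npos: "norm (N x) > 0" using norm_N[of x] by linarith
  ultimately have nk: "\<bar>n $ k\<bar> = 1 / norm (N x)" by (simp add: field_simps)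
  have "n = \<nu> x \<or> n = - \<nu> x"
  proof -
    have "n $ k = \<sigma> / norm (N x) \<or> n $ k = - (\<sigma> / norm (N x))"
      using nk sigma by (auto simp: abs_if split: if_splits)
    then show ?thesis using nN by (auto simp: \<nu>_def)
  qed
  moreover have "n \<noteq> - \<nu> x"
  proof
    assume "n = - \<nu> x"
    then have "\<forall>\<^sub>F t in at_right 0. x + t *\<^sub>R \<nu> x \<in> D \<and> x - t *\<^sub>R \<nu> x \<notin> closure D" using side by simp
    then have "\<forall>\<^sub>F t in at_right (0::real). False"
      using nu_sides[OF x] by eventually_elim (use closure_subset in blast)
    then show False by simp
  qed
  ultimately show ?thesis by blast
qed

lemma outward_normal_eq:
  assumes "x \<in> U" "x \<in> frontier D"
  shows "outward_normal D x = \<nu> x"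
proof -
  have z: "\<psi> x = 0" using mem_frontier assms by blast
  show ?thesis unfolding outward_normal_def
    by (rule the_equality) (use assms(1) z norm_nu nu_tangent nu_sides nu_unique in auto)
qed

text \<open>
  Where the gradient of \<open>f\<close> is bounded by \<open>B\<close>, the mean value theorem bounds the difference of the \<open>k\<close>-th
  coordinates of two boundary points by the differences of the other ones, since \<open>f\<close> has no derivative in
  the direction \<open>k\<close>.
\<close>

lemma locally_finite:
  assumes d: "CARD('n) \<ge> 2" and x: "x \<in> U"
  shows "\<exists>W. open W \<and> x \<in> W \<and> hausdorff_outer (CARD('n) - 1) (frontier D \<inter> W) < top"
proof -
  have "\<exists>r>0. ball x r \<subseteq> U \<and> (\<forall>y\<in>ball x r. norm (f' y) \<le> norm (f' x) + 1)"
  proof -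
    have "open ((\<lambda>y. norm (f' y)) -` {..<norm (f' x) + 1})"
      using continuous_on_norm[OF cont_deriv] by (intro open_vimage) auto
    then have "open (U \<inter> (\<lambda>y. norm (f' y)) -` {..<norm (f' x) + 1})" using open_U by blast
    moreover have "x \<in> U \<inter> (\<lambda>y. norm (f' y)) -` {..<norm (f' x) + 1}" using x by simp
    ultimately obtain r where "r > 0" "ball x r \<subseteq> U \<inter> (\<lambda>y. norm (f' y)) -` {..<norm (f' x) + 1}"
      by (meson open_contains_ball)
    then show ?thesis by (intro exI[of _ r]) (auto intro: less_imp_le)
  qed
  then obtain r where r: "r > 0" "ball x r \<subseteq> U" "\<And>y. y \<in> ball x r \<Longrightarrow> norm (f' y) \<le> norm (f' x) + 1" by blast
  define B where "B = norm (f' x) + 1"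
  have B: "B > 0" using norm_ge_zero[of "f' x"] unfolding B_def by linarith
  have G: "\<bar>G y $ i\<bar> \<le> B" if "y \<in> ball x r" for y i
  proof -
    have "\<bar>G y $ i\<bar> \<le> norm (f' y) * norm (axis i (1::real) :: real^'n)"
      using norm_blinfun[of "f' y" "axis i 1"] by (simp add: G_def)
    then show ?thesis using r(3)[OF that] by (simp add: B_def)
  qed
  have lip: "dist y z \<le> (1 + B) * (\<Sum>i\<in>UNIV - {k}. \<bar>y $ i - z $ i\<bar>)"
    if y: "y \<in> frontier D \<inter> ball x r" and z: "z \<in> frontier D \<inter> ball x r" for y z
  proof -
    have yz: "y $ k = f y" "z $ k = f z"
      using mem_frontier y z r(2) by (auto simp: \<psi>_def)
    have "\<exists>s\<in>{0..1}. f (z + 1 *\<^sub>R (y - z)) - f (z + 0 *\<^sub>R (y - z)) = (G (z + s *\<^sub>R (y - z)) \<bullet> (y - z)) * (1 - 0)"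
      by (rule mvt_very_simple[where f = "\<lambda>t. f (z + t *\<^sub>R (y - z))" and f' = "\<lambda>s. (*) (G (z + s *\<^sub>R (y - z)) \<bullet> (y - z))"])
         (auto intro: has_derivative_at_withinI f_line_derivative[unfolded has_field_derivative_def])
    then obtain s where s: "s \<in> {0..1}" "f y - f z = G (z + s *\<^sub>R (y - z)) \<bullet> (y - z)" by auto
    have "z + s *\<^sub>R (y - z) = (1 - s) *\<^sub>R z + s *\<^sub>R y" by (simp add: algebra_simps)
    then have ball: "z + s *\<^sub>R (y - z) \<in> ball x r"
      using convexD[OF convex_ball[of x r], of z y "1 - s" s] y z s(1) by auto
    have "y $ k - z $ k = (\<Sum>i\<in>UNIV. G (z + s *\<^sub>R (y - z)) $ i * (y - z) $ i)"
      using yz s(2) by (simp add: inner_vec_def)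
    also have "\<dots> = (\<Sum>i\<in>UNIV - {k}. G (z + s *\<^sub>R (y - z)) $ i * (y - z) $ i)"
      by (subst sum.remove[of UNIV k]) (simp_all add: G_k)
    finally have "\<bar>y $ k - z $ k\<bar> \<le> (\<Sum>i\<in>UNIV - {k}. \<bar>G (z + s *\<^sub>R (y - z)) $ i * (y - z) $ i\<bar>)"
      by (simp only: sum_abs)
    also have "\<dots> \<le> (\<Sum>i\<in>UNIV - {k}. B * \<bar>y $ i - z $ i\<bar>)"
      using G[OF ball] by (intro sum_mono) (simp add: abs_mult mult_right_mono)
    finally have k: "\<bar>y $ k - z $ k\<bar> \<le> B * (\<Sum>i\<in>UNIV - {k}. \<bar>y $ i - z $ i\<bar>)" by (simp add: sum_distrib_left)
    have "dist y z \<le> (\<Sum>i\<in>UNIV. \<bar>(y - z) $ i\<bar>)" using norm_le_l1_cart[of "y - z"] by (simp add: dist_norm)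
    also have "\<dots> = \<bar>y $ k - z $ k\<bar> + (\<Sum>i\<in>UNIV - {k}. \<bar>y $ i - z $ i\<bar>)"
      by (subst sum.remove[of UNIV k]) simp_all
    also have "\<dots> \<le> (1 + B) * (\<Sum>i\<in>UNIV - {k}. \<bar>y $ i - z $ i\<bar>)" using k by (simp add: algebra_simps)
    finally show ?thesis .
  qed
  have "hausdorff_outer (CARD('n) - 1) (frontier D \<inter> ball x r) < top"
  proof (rule hausdorff_outer_graph_finite[OF d, where R = "norm x + r" and L = "1 + B" and k = k])
    fix y i assume "y \<in> frontier D \<inter> ball x r"
    then have "norm (x - y) < r" by (simp add: dist_norm)
    then have "norm y \<le> norm x + r" using norm_triangle_ineq2[of y x] by (simp add: norm_minus_commute)
    then show "\<bar>y $ i\<bar> \<le> norm x + r" using component_le_norm_cart[of y i] by simp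
  qed (use r B lip in \<open>auto simp: add_nonneg_pos\<close>)
  then show ?thesis using r(1) by (intro exI[of _ "ball x r"]) auto
qed

end

lemma C2_boundary_chart:
  assumes "open D" "C2_boundary D" "x \<in> frontier D"
  shows "\<exists>U k \<sigma> f f'. x \<in> U \<and> graph_chart D U k \<sigma> f f'"
proof -
  from assms(2)[unfolded C2_boundary_def, rule_format, OF assms(3)]
  obtain U k \<sigma> f where U: "open U" "x \<in> U" "\<sigma> \<in> {-1, 1::real}" and C2: "C2_on UNIV f"
    and indep: "\<forall>y t. f (y + t *\<^sub>R axis k 1) = f y" and below: "D \<inter> U = {y \<in> U. \<sigma> * (y $ k - f y) < 0}"
    by (elim exE conjE) (rule that)
  from C2 obtain f' where f': "\<forall>x. (f has_derivative blinfun_apply (f' x)) (at x)" "C1_on UNIV f'"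
    unfolding C2_on_def by auto
  have "continuous_on UNIV f'"
  proof -
    obtain f'' where "\<forall>x. (f' has_derivative blinfun_apply (f'' x)) (at x)" using f'(2) unfolding C1_on_def by auto
    then show ?thesis by (intro has_derivative_continuous_on[where f' = "\<lambda>x. blinfun_apply (f'' x)"]) auto
  qed
  then have "graph_chart D U k \<sigma> f f'"
    by (intro graph_chart.intro assms(1) U below f'(1)[rule_format] indep[rule_format])
  with U(2) show ?thesis by (intro exI conjI)
qed

lemma outward_normal:
  assumes "open D" "C2_boundary D" "x \<in> frontier D"
  shows "norm (outward_normal D x) = 1" "\<forall>\<^sub>F t in at_right 0. x - t *\<^sub>R outward_normal D x \<in> D"
proof -
  obtain U k \<sigma> f f' where x: "x \<in> U" and "graph_chart D U k \<sigma> f f'" using C2_boundary_chart[OF assms] by blast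
  then interpret graph_chart D U k \<sigma> f f' by simp
  show "norm (outward_normal D x) = 1" using outward_normal_eq[OF x assms(3)] norm_nu by simp
  show "\<forall>\<^sub>F t in at_right 0. x - t *\<^sub>R outward_normal D x \<in> D"
    unfolding outward_normal_eq[OF x assms(3)]
    using nu_sides[OF x] mem_frontier[OF x] assms(3) by (auto elim!: eventually_mono)
qed

lemma continuous_on_outward_normal:
  assumes "open D" "C2_boundary D"
  shows "continuous_on (frontier D) (outward_normal D)"
  unfolding continuous_on_eq_continuous_within
proof
  fix x assume x: "x \<in> frontier D"
  obtain U k \<sigma> f f' where xU: "x \<in> U" and "graph_chart D U k \<sigma> f f'" using C2_boundary_chart[OF assms x] by blast
  then interpret graph_chart D U k \<sigma> f f' by simp
  have c: "continuous (at x within frontier D) \<nu>"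
    using continuous_nu[of "frontier D"] x by (simp add: continuous_on_eq_continuous_within)
  obtain e where e: "e > 0" "ball x e \<subseteq> U" using open_U xU by (meson open_contains_ball)
  show "continuous (at x within frontier D) (outward_normal D)"
  proof (rule continuous_transform_within[OF c e(1) x])
    fix y assume "y \<in> frontier D" "dist y x < e"
    then show "\<nu> y = outward_normal D y" using e(2) outward_normal_eq[of y] by (simp add: subset_iff dist_commute)
  qed
qed

lemma hausdorff_frontier_finite:
  fixes D :: "(real ^ 'n::finite) set"
  assumes "open D" "bounded D" "C2_boundary D" and d: "CARD('n) \<ge> 2"
  shows "emeasure surface_measure (frontier D) < \<infinity>"
proof -
  let ?s = "CARD('n) - 1"
  have "\<exists>W. open W \<and> x \<in> W \<and> hausdorff_outer ?s (frontier D \<inter> W) < top" if hx: "x \<in> frontier D" for x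
  proof -
    obtain U k \<sigma> f f' where xU: "x \<in> U" and "graph_chart D U k \<sigma> f f'" using C2_boundary_chart[OF assms(1,3) hx] by blast
    then interpret graph_chart D U k \<sigma> f f' by simp
    show ?thesis by (rule locally_finite[OF d xU])
  qed
  then obtain W where W: "\<And>x. x \<in> frontier D \<Longrightarrow> open (W x) \<and> x \<in> W x \<and> hausdorff_outer ?s (frontier D \<inter> W x) < top"
    by metis
  obtain C where C: "C \<subseteq> frontier D" "finite C" "frontier D \<subseteq> (\<Union>x\<in>C. W x)"
    using compactE_image[OF compact_frontier_bounded[OF assms(2)], of "frontier D" W] W by blast
  have mb: "frontier D \<inter> W x \<in> sets borel" if "x \<in> C" for x
    using that C(1) W by (intro sets.Int borel_closed borel_open frontier_closed) auto
  have "emeasure surface_measure (frontier D) \<le> emeasure surface_measure (\<Union>x\<in>C. frontier D \<inter> W x)"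
    using C(3) by (intro emeasure_mono) (blast, unfold sets_hausdorff_measure, rule sets.finite_UN[OF C(2) mb])
  also have "\<dots> \<le> (\<Sum>x\<in>C. emeasure surface_measure (frontier D \<inter> W x))"
    using C(2) mb by (intro emeasure_subadditive_finite) auto
  also have "\<dots> = (\<Sum>x\<in>C. hausdorff_outer ?s (frontier D \<inter> W x))"
    using d mb by (intro sum.cong refl emeasure_hausdorff_measure) auto
  also have "\<dots> < \<infinity>" using C W by (auto simp: ennreal_sum_less_top subset_iff)
  finally show ?thesis .
qed

section \<open>Surface integrals of bounded measurable functions\<close>

text \<open>
  A sufficient condition for integrability over sets of finite surface measure that, unlike
  integrability itself, is closed under products.
\<close>

definition surface_admissible :: "(real ^ 'n::finite) set \<Rightarrow> (real ^ 'n \<Rightarrow> real) \<Rightarrow> bool" where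
  "surface_admissible S f \<longleftrightarrow>
     (\<lambda>x. indicator S x * f x) \<in> borel_measurable borel \<and> (\<exists>B. \<forall>x\<in>S. \<bar>f x\<bar> \<le> B)"

lemma surface_admissible_mult:
  assumes "surface_admissible S f" "surface_admissible S g"
  shows "surface_admissible S (\<lambda>x. f x * g x)"
proof -
  obtain B C where B: "\<forall>x\<in>S. \<bar>f x\<bar> \<le> B" and C: "\<forall>x\<in>S. \<bar>g x\<bar> \<le> C"
    using assms by (auto simp: surface_admissible_def)
  have "(\<lambda>x. (indicator S x * f x) * (indicator S x * g x)) \<in> borel_measurable borel"
    by (rule borel_measurable_times[OF assms[unfolded surface_admissible_def, THEN conjunct1]])
  moreover have "(\<lambda>x. (indicator S x * f x) * (indicator S x * g x)) = (\<lambda>x. indicator S x * (f x * g x))"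
    by (auto simp: fun_eq_iff indicator_def)
  moreover have "\<bar>f x * g x\<bar> \<le> \<bar>B\<bar> * \<bar>C\<bar>" if "x \<in> S" for x
    unfolding abs_mult using B C that by (intro mult_mono) (auto intro: order_trans[OF _ abs_ge_self])
  ultimately show ?thesis unfolding surface_admissible_def by auto
qed

lemma surface_admissible_continuous:
  assumes "compact S" "continuous_on S f"
  shows "surface_admissible S f"
proof -
  have "S \<in> sets borel" using assms(1) by (simp add: borel_compact)
  then have "(\<lambda>x. indicator S x *\<^sub>R f x) \<in> borel_measurable borel"
    using assms(2) by (rule borel_measurable_continuous_on_indicator)
  moreover have "bounded (f ` S)" using assms by (intro compact_imp_bounded compact_continuous_image)
  then obtain B where "\<forall>x\<in>S. \<bar>f x\<bar> \<le> B" by (auto simp: bounded_iff)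
  ultimately show ?thesis by (auto simp: surface_admissible_def)
qed

lemma surface_integrable:
  fixes S :: "(real ^ 'n::finite) set"
  assumes S: "S \<in> sets borel" "emeasure surface_measure S < \<infinity>" and f: "surface_admissible S f"
  shows "set_integrable surface_measure S f"
  unfolding set_integrable_def
proof -
  obtain B where B: "\<forall>x\<in>S. \<bar>f x\<bar> \<le> B" using f by (auto simp: surface_admissible_def)
  have m: "(\<lambda>x. indicator S x * f x) \<in> borel_measurable (surface_measure :: (real ^ 'n) measure)"
    using f by (simp add: surface_admissible_def measurable_def)
  have "integrable (surface_measure :: (real ^ 'n) measure) (\<lambda>x. indicator S x * f x)"
    by (rule integrableI_bounded_set[where A = S and B = B]) (use S m B in \<open>auto simp: indicator_def\<close>)
  then show "integrable surface_measure (\<lambda>x. indicator S x *\<^sub>R f x)" by simp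
qed

lemma L2_surface_sym: "L2_surface S u v = L2_surface S v u"
  by (simp add: L2_surface_def mult.commute)

lemma L2_surface_cong:
  fixes S :: "(real ^ 'n::finite) set"
  assumes "S \<in> sets borel" "\<And>x. x \<in> S \<Longrightarrow> u x * v x = u' x * v' x"
  shows "L2_surface S u v = L2_surface S u' v'"
  unfolding L2_surface_def by (rule set_lebesgue_integral_cong) (use assms in auto)

lemma L2_surface_lin:
  fixes S :: "(real ^ 'n::finite) set"
  assumes S: "S \<in> sets borel" "emeasure surface_measure S < \<infinity>"
    and "surface_admissible S u" "surface_admissible S v" "surface_admissible S w"
  shows "L2_surface S (\<lambda>x. c * u x + v x) w = c * L2_surface S u w + L2_surface S v w"
  unfolding L2_surface_def distrib_right mult.assoc set_integral_mult_right[symmetric]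
  using surface_integrable[OF S surface_admissible_mult] assms
  by (intro set_integral_add set_integrable_mult_right) auto

lemma L2_surface_nonneg: "L2_surface S u u \<ge> 0"
  unfolding L2_surface_def set_lebesgue_integral_def by (intro integral_nonneg_AE) auto

lemma L2_surface_zero:
  fixes S :: "(real ^ 'n::finite) set"
  assumes "S \<in> sets borel" "\<And>x. x \<in> S \<Longrightarrow> u x * v x = 0"
  shows "L2_surface S u v = 0"
proof -
  have "L2_surface S u v = L2_surface S (\<lambda>_. 0) (\<lambda>_. 0)" using assms by (intro L2_surface_cong) auto
  then show ?thesis by (simp add: L2_surface_def)
qed

section \<open>The normal derivative of a finite element function\<close>

locale cut_mesh = mesh m l p for m :: "('n::finite) config" and l p +
  assumes dim: "CARD('n) \<ge> 2" and C2: "C2_boundary (Omega m)"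
begin

abbreviation "\<Gamma> \<equiv> frontier (Omega m)"
abbreviation "n x \<equiv> outward_normal (Omega m) x"
abbreviation "dn \<equiv> normal_deriv (Omega m)"

lemma compact_Gamma: "compact \<Gamma>"
  using bounded_Omega by (rule compact_frontier_bounded)

lemma Gamma_borel: "\<Gamma> \<in> sets borel"
  using compact_Gamma by (rule borel_compact)

lemma Gamma_finite: "emeasure surface_measure \<Gamma> < \<infinity>"
  using hausdorff_frontier_finite[OF open_Omega bounded_Omega C2 dim] .

lemma Gamma_pos: "emeasure surface_measure \<Gamma> > 0"
proof -
  have "emeasure surface_measure \<Gamma> = hausdorff_outer (CARD('n) - 1) \<Gamma>"
    using dim by (intro emeasure_hausdorff_measure Gamma_borel) simp
  then show ?thesis using hausdorff_outer_frontier_pos[OF dim open_Omega bounded_Omega Omega_ne] by simp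
qed

text \<open>
  The segment that starts at \<open>x\<close> and goes into the domain along the normal begins in the cell \<open>z\<close>. On that cell the
  one-sided normal derivative is the derivative of a single polynomial, even if \<open>x\<close> lies on the mesh
  skeleton.
\<close>

definition enters :: "real ^ 'n \<Rightarrow> int ^ 'n \<Rightarrow> bool" where
  "enters x z \<longleftrightarrow> z \<in> active \<and> x \<in> K z \<and> (\<forall>\<^sub>F t in at_right 0. x - t *\<^sub>R n x \<in> K z)"

text \<open>
  The segment stays in the union of the finitely many active cells, so some cell contains points of it that
  are arbitrarily close to \<open>x\<close>; as cells are convex, that cell contains an initial piece of it.
\<close>

lemma exists_entered_cell:
  assumes x: "x \<in> \<Gamma>"
  obtains z where "enters x z"
proof -
  define T where "T = (\<lambda>z t. x - t *\<^sub>R n x \<in> K z)"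
  have inside: "\<forall>\<^sub>F t in at_right 0. x - t *\<^sub>R n x \<in> Omega m"
    by (rule outward_normal(2)[OF open_Omega C2 x])
  have "\<exists>z\<in>active. frequently (T z) (at_right 0)"
  proof (rule ccontr)
    assume "\<not> (\<exists>z\<in>active. frequently (T z) (at_right 0))"
    then have "\<forall>z\<in>active. \<forall>\<^sub>F t in at_right 0. \<not> T z t" by (auto simp: frequently_def)
    then have "\<forall>\<^sub>F t in at_right 0. \<forall>z\<in>active. \<not> T z t" using finite_active by (rule eventually_ball_finite[rotated])
    with inside have "\<forall>\<^sub>F t in at_right (0::real). False"
    proof eventually_elim
      case (elim t)
      then have "x - t *\<^sub>R n x \<in> \<Omega>h" using Omega_subset by blast
      then show False using elim(2) by (auto simp: Omega_h_def T_def)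
    qed
    then show False by simp
  qed
  then obtain z where z: "z \<in> active" "frequently (T z) (at_right 0)" by blast
  have small: "\<exists>t. 0 < t \<and> t < b \<and> T z t" if "b > 0" for b
  proof (rule ccontr)
    assume "\<not> (\<exists>t. 0 < t \<and> t < b \<and> T z t)"
    then have "\<forall>\<^sub>F t in at_right 0. \<not> T z t"
      unfolding eventually_at_right_field using that by (intro exI[of _ b]) auto
    then show False using z(2) by (simp add: frequently_def)
  qed
  obtain t0 where t0: "0 < t0" "T z t0" using small[of 1] by auto
  have "T z s" if s: "0 < s" "s < t0" for s
  proof -
    obtain t where t: "0 < t" "t < s" "T z t" using small[OF s(1)] by auto
    define a where "a = (s - t) / (t0 - t)"
    have a: "0 \<le> a" "a \<le> 1" using t s by (auto simp: a_def field_simps)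
    have "a * (t0 - t) = s - t" using t s by (simp add: a_def)
    then have s_eq: "s = (1 - a) * t + a * t0" by (simp add: algebra_simps)
    have "(1 - a) *\<^sub>R (x - t *\<^sub>R n x) + a *\<^sub>R (x - t0 *\<^sub>R n x) \<in> K z"
      using t(3) t0(2) a by (intro convexD[OF convex_cell]) (auto simp: T_def)
    moreover have "(1 - a) *\<^sub>R (x - t *\<^sub>R n x) + a *\<^sub>R (x - t0 *\<^sub>R n x) = x - s *\<^sub>R n x"
      unfolding s_eq by (simp add: algebra_simps)
    ultimately show ?thesis by (simp add: T_def)
  qed
  then have ev: "\<forall>\<^sub>F t in at_right 0. x - t *\<^sub>R n x \<in> K z"
    unfolding eventually_at_right_field T_def using t0(1) by (intro exI[of _ t0]) auto
  have "((\<lambda>t. x - t *\<^sub>R n x) \<longlongrightarrow> x - 0 *\<^sub>R n x) (at_right (0::real))" by (intro tendsto_intros)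
  then have "x - 0 *\<^sub>R n x \<in> K z" by (rule Lim_in_closed_set[OF closed_cell ev, rotated]) simp
  then show thesis using that[of z] z(1) ev by (simp add: enters_def)
qed

lemma normal_deriv_tendsto:
  assumes v: "v \<in> V" and "enters x z"
  shows "((\<lambda>t. (v x - v (x - t *\<^sub>R n x)) / t) \<longlongrightarrow> (\<Sum>i\<in>UNIV. partial i (qp v z) x * n x $ i)) (at_right 0)"
proof -
  have z: "z \<in> active" "x \<in> K z" and ev: "\<forall>\<^sub>F t in at_right 0. x - t *\<^sub>R n x \<in> K z"
    using assms(2) by (simp_all add: enters_def)
  let ?q = "qp v z"
  have q: "?q \<in> Q_poly p" using cell_poly(1)[OF v z(1)] .
  have "((\<lambda>t. ?q (x + t *\<^sub>R (- n x))) has_derivative (\<lambda>s. \<Sum>i\<in>UNIV. partial i ?q (x + 0 *\<^sub>R (- n x)) * (s *\<^sub>R (- n x)) $ i)) (at 0)"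
    by (rule has_derivative_compose[OF has_derivative_axis_line Q_poly_has_derivative[OF q]])
  moreover have "(\<lambda>s. \<Sum>i\<in>UNIV. partial i ?q (x + 0 *\<^sub>R (- n x)) * (s *\<^sub>R (- n x)) $ i)
      = (*) (- (\<Sum>i\<in>UNIV. partial i ?q x * n x $ i))"
    by (simp add: fun_eq_iff sum_negf sum_distrib_right sum_distrib_left mult_ac)
  ultimately have "((\<lambda>t. ?q (x - t *\<^sub>R n x)) has_field_derivative - (\<Sum>i\<in>UNIV. partial i ?q x * n x $ i)) (at 0)"
    by (simp add: has_field_derivative_def)
  then have "((\<lambda>t. (?q (x - t *\<^sub>R n x) - ?q x) / t) \<longlongrightarrow> - (\<Sum>i\<in>UNIV. partial i ?q x * n x $ i)) (at 0)"
    by (simp add: has_field_derivative_iff)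
  then have "((\<lambda>t. (?q (x - t *\<^sub>R n x) - ?q x) / t) \<longlongrightarrow> - (\<Sum>i\<in>UNIV. partial i ?q x * n x $ i)) (at_right 0)"
    by (rule filterlim_mono) (auto simp: at_le)
  from tendsto_minus[OF this]
  have "((\<lambda>t. - ((?q (x - t *\<^sub>R n x) - ?q x) / t)) \<longlongrightarrow> (\<Sum>i\<in>UNIV. partial i ?q x * n x $ i)) (at_right 0)" by simp
  moreover have "\<forall>\<^sub>F t in at_right 0. - ((?q (x - t *\<^sub>R n x) - ?q x) / t) = (v x - v (x - t *\<^sub>R n x)) / t"
    using ev
  proof eventually_elim
    case (elim t)
    then have "?q (x - t *\<^sub>R n x) = v (x - t *\<^sub>R n x)" "?q x = v x" using cell_poly(2)[OF v z(1)] z(2) by auto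
    then show ?case by (simp add: minus_divide_left)
  qed
  ultimately show ?thesis by (rule Lim_transform_eventually)
qed

lemma normal_deriv_eq:
  assumes "v \<in> V" "enters x z"
  shows "dn v x = (\<Sum>i\<in>UNIV. partial i (qp v z) x * n x $ i)"
  unfolding normal_deriv_def by (rule tendsto_Lim[OF _ normal_deriv_tendsto[OF assms]]) simp

lemma normal_deriv_lin:
  assumes "u \<in> V" "v \<in> V" "x \<in> \<Gamma>"
  shows "dn (\<lambda>x. c * u x + v x) x = c * dn u x + dn v x"
proof -
  obtain z where e: "enters x z" using exists_entered_cell[OF assms(3)] by blast
  then have z: "z \<in> active" by (simp add: enters_def)
  show ?thesis
    unfolding normal_deriv_eq[OF V_add[OF V_scale[OF assms(1)] assms(2)] e] normal_deriv_eq[OF assms(1) e]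
      normal_deriv_eq[OF assms(2) e] cell_poly_lin[OF assms(1,2) z]
    by (simp add: partial_lin[OF cell_poly(1)[OF assms(1) z] cell_poly(1)[OF assms(2) z]]
        distrib_right sum.distrib sum_distrib_left mult.assoc)
qed

lemma surface_admissible_trace: "v \<in> V \<Longrightarrow> surface_admissible \<Gamma> v"
  using compact_Gamma continuous_on_subset[OF V_continuous frontier_subset]
  by (intro surface_admissible_continuous)

lemma V_borel_measurable:
  assumes "v \<in> V"
  shows "v \<in> borel_measurable borel"
proof -
  have "(\<lambda>x. indicator \<Omega>h x *\<^sub>R v x) \<in> borel_measurable borel"
    using closed_Omega_h V_continuous[OF assms] by (intro borel_measurable_continuous_on_indicator) auto
  moreover have "(\<lambda>x. indicator \<Omega>h x *\<^sub>R v x) = v"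
    using V_zero_outside[OF assms] by (auto simp: fun_eq_iff indicator_def)
  ultimately show ?thesis by simp
qed

text \<open>
  The bound comes from the derivatives of the finitely many cell polynomials, measurability from writing the
  normal derivative as a limit of difference quotients.
\<close>

lemma surface_admissible_normal_deriv:
  assumes v: "v \<in> V"
  shows "surface_admissible \<Gamma> (dn v)"
  unfolding surface_admissible_def
proof
  have "\<exists>B. \<forall>x\<in>K z. \<forall>i. \<bar>partial i (qp v z) x\<bar> \<le> B" if z: "z \<in> active" for z
  proof -
    have "\<exists>B. \<forall>x\<in>K z. \<bar>partial i (qp v z) x\<bar> \<le> B" for i
    proof -
      have "continuous_on (K z) (partial i (qp v z))"
        by (rule Q_poly_continuous[OF Q_poly_partial[OF cell_poly(1)[OF v z]]])
      from surface_admissible_continuous[OF compact_cell this] show ?thesis by (auto simp: surface_admissible_def)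
    qed
    then obtain B where B: "\<And>i x. x \<in> K z \<Longrightarrow> \<bar>partial i (qp v z) x\<bar> \<le> B i" by metis
    have "\<bar>partial i (qp v z) x\<bar> \<le> (\<Sum>i\<in>UNIV. \<bar>B i\<bar>)" if "x \<in> K z" for x i
    proof -
      have "\<bar>partial i (qp v z) x\<bar> \<le> \<bar>B i\<bar>" using B[OF that, of i] by linarith
      also have "\<dots> \<le> (\<Sum>i\<in>UNIV. \<bar>B i\<bar>)" by (rule member_le_sum) auto
      finally show ?thesis .
    qed
    then show ?thesis by blast
  qed
  then obtain B where B: "\<And>z x i. z \<in> active \<Longrightarrow> x \<in> K z \<Longrightarrow> \<bar>partial i (qp v z) x\<bar> \<le> B z" by metis
  show "\<exists>C. \<forall>x\<in>\<Gamma>. \<bar>dn v x\<bar> \<le> C"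
  proof (intro exI[of _ "real CARD('n) * (\<Sum>z\<in>active. \<bar>B z\<bar>)"] ballI)
    fix x assume x: "x \<in> \<Gamma>"
    obtain z where e: "enters x z" using exists_entered_cell[OF x] by blast
    then have z: "z \<in> active" "x \<in> K z" by (simp_all add: enters_def)
    have "\<bar>partial i (qp v z) x * n x $ i\<bar> \<le> (\<Sum>z\<in>active. \<bar>B z\<bar>)" for i
    proof -
      have "\<bar>n x $ i\<bar> \<le> 1"
        using component_le_norm_cart[of "n x" i] outward_normal(1)[OF open_Omega C2 x] by simp
      then have "\<bar>partial i (qp v z) x\<bar> * \<bar>n x $ i\<bar> \<le> \<bar>partial i (qp v z) x\<bar> * 1" by (intro mult_left_mono) auto
      also have "\<dots> \<le> \<bar>B z\<bar>" using B[OF z(1,2), of i] by linarith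
      also have "\<dots> \<le> (\<Sum>z\<in>active. \<bar>B z\<bar>)" using z(1) by (intro member_le_sum) auto
      finally show ?thesis by (simp add: abs_mult)
    qed
    then have "(\<Sum>i\<in>UNIV. \<bar>partial i (qp v z) x * n x $ i\<bar>) \<le> real CARD('n) * (\<Sum>z\<in>active. \<bar>B z\<bar>)"
      by (rule sum_bounded_above[of UNIV, simplified])
    then show "\<bar>dn v x\<bar> \<le> real CARD('n) * (\<Sum>z\<in>active. \<bar>B z\<bar>)"
      unfolding normal_deriv_eq[OF v e] by (rule order_trans[OF sum_abs])
  qed
  \<comment> \<open>Cut off outside the boundary, where the outward normal is an unspecified value.\<close>
  define n' where "n' = (\<lambda>x. indicator \<Gamma> x *\<^sub>R n x)"
  have n'_meas [measurable]: "n' \<in> borel_measurable borel"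
    unfolding n'_def using Gamma_borel continuous_on_outward_normal[OF open_Omega C2]
    by (rule borel_measurable_continuous_on_indicator)
  define F where "F = (\<lambda>k x. indicator \<Gamma> x * ((v x - v (x - (1 / real (Suc k)) *\<^sub>R n' x)) / (1 / real (Suc k))))"
  have [measurable]: "v \<in> borel_measurable borel" "\<Gamma> \<in> sets borel" using V_borel_measurable[OF v] Gamma_borel by auto
  have meas: "F k \<in> borel_measurable borel" for k unfolding F_def by measurable
  have lim: "(\<lambda>k. F k x) \<longlonglongrightarrow> indicator \<Gamma> x * dn v x" for x
  proof (cases "x \<in> \<Gamma>")
    case True
    obtain z where e: "enters x z" using exists_entered_cell[OF True] by blast
    then have z: "z \<in> active" "x \<in> K z" by (simp_all add: enters_def)
    have "filterlim (\<lambda>k. 1 / real (Suc k)) (at_right 0) sequentially"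
      using LIMSEQ_inverse_real_of_nat by (auto simp: filterlim_at inverse_eq_divide)
    from filterlim_compose[OF normal_deriv_tendsto[OF v e] this]
    have "(\<lambda>k. (v x - v (x - (1 / real (Suc k)) *\<^sub>R n x)) / (1 / real (Suc k))) \<longlonglongrightarrow> dn v x"
      unfolding normal_deriv_eq[OF v e] .
    then show ?thesis using True by (simp add: F_def n'_def)
  qed (simp add: F_def)
  show "(\<lambda>x. indicator \<Gamma> x * dn v x) \<in> borel_measurable borel"
    by (rule borel_measurable_LIMSEQ_real[OF lim meas])
qed

section \<open>The ghost penalty\<close>

lemma face_properties:
  shows "compact (face m l F)" "emeasure surface_measure (face m l F) < \<infinity>"
proof -
  obtain i z where F: "F = (i, z)" by (cases F)
  let ?S = "face m l F"
  show comp: "compact ?S" unfolding F face_def by (simp add: compact_Int_closed)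
  have plane: "x $ i = hi i (z $ i)" if "x \<in> ?S" for x
  proof -
    have "x \<in> K z" "x \<in> K (z + axis i 1)" using that by (simp_all add: F face_def)
    then have "x $ i \<le> hi i (z $ i)"
      "lo i ((z + axis i 1) $ i) \<le> x $ i"
      unfolding mem_cell by blast+
    then show ?thesis by (simp add: axis_def)
  qed
  obtain R where R: "\<forall>x\<in>?S. norm x \<le> R" using comp compact_imp_bounded bounded_iff by blast
  have "hausdorff_outer (CARD('n) - 1) ?S < top"
  proof (rule hausdorff_outer_graph_finite[OF dim, where R = "\<bar>R\<bar> + 1" and L = 1 and k = i])
    fix x j assume "x \<in> ?S"
    then show "\<bar>x $ j\<bar> \<le> \<bar>R\<bar> + 1" using R component_le_norm_cart[of x j] by fastforce
  next
    fix x y assume xy: "x \<in> ?S" "y \<in> ?S"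
    have "dist x y \<le> (\<Sum>j\<in>UNIV. \<bar>(x - y) $ j\<bar>)" using norm_le_l1_cart[of "x - y"] by (simp add: dist_norm)
    also have "\<dots> = (\<Sum>j\<in>UNIV - {i}. \<bar>x $ j - y $ j\<bar>)"
      using plane[OF xy(1)] plane[OF xy(2)] by (subst sum.remove[of UNIV i]) simp_all
    finally show "dist x y \<le> 1 * (\<Sum>j\<in>UNIV - {i}. \<bar>x $ j - y $ j\<bar>)" by simp
  qed auto
  then show "emeasure surface_measure ?S < \<infinity>"
    using dim borel_compact[OF comp] by (subst emeasure_hausdorff_measure) auto
qed

lemma jump_lin:
  assumes "u \<in> V" "v \<in> V" "F \<in> ghost_faces m l"
  shows "jump p m l k F (\<lambda>x. c * u x + v x) x = c * jump p m l k F u x + jump p m l k F v x"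
proof -
  obtain i z where F: "F = (i, z)" by (cases F)
  have z: "z \<in> active" "z + axis i 1 \<in> active" using assms(3) by (auto simp: F ghost_faces_def)
  show ?thesis
    by (simp add: F jump_def cell_poly_lin[OF assms(1,2)] z right_diff_distrib
        axis_deriv_lin[OF cell_poly(1)[OF assms(1)] cell_poly(1)[OF assms(2)]])
qed

lemma surface_admissible_jump:
  assumes "u \<in> V" "F \<in> ghost_faces m l"
  shows "surface_admissible (face m l F) (jump p m l k F u)"
proof (rule surface_admissible_continuous[OF face_properties(1)])
  obtain i z where F: "F = (i, z)" by (cases F)
  have z: "z \<in> active" "z + axis i 1 \<in> active" using assms(2) by (auto simp: F ghost_faces_def)
  have "jump p m l k F u = (\<lambda>x. axis_deriv k i (qp u (z + axis i 1)) x - axis_deriv k i (qp u z) x)"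
    by (simp add: F jump_def fun_eq_iff)
  then show "continuous_on (face m l F) (jump p m l k F u)"
    using Q_poly_continuous[OF Q_poly_axis_deriv[OF cell_poly(1)[OF assms(1) z(1)]]]
      Q_poly_continuous[OF Q_poly_axis_deriv[OF cell_poly(1)[OF assms(1) z(2)]]]
    by (simp add: continuous_on_diff)
qed

lemma face_borel: "face m l F \<in> sets borel"
  using face_properties(1) by (rule borel_compact)

lemma g_form_sym: "g_form p \<gamma> m l u v = g_form p \<gamma> m l v u"
  by (simp add: g_form_def L2_surface_sym[of _ "jump p m l _ _ u"])

lemma g_form_lin:
  assumes "u \<in> V" "v \<in> V" "w \<in> V"
  shows "g_form p \<gamma> m l (\<lambda>x. c * u x + v x) w = c * g_form p \<gamma> m l u w + g_form p \<gamma> m l v w"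
proof -
  let ?J = "\<lambda>F k u. L2_surface (face m l F) (jump p m l k F u) (jump p m l k F w)"
  let ?a = "\<lambda>k. width m l ^ (2 * k - 1) / (fact k)\<^sup>2"
  have "?J F k (\<lambda>x. c * u x + v x) = c * ?J F k u + ?J F k v" if "F \<in> ghost_faces m l" for F k
  proof -
    have "jump p m l k F (\<lambda>x. c * u x + v x) = (\<lambda>x. c * jump p m l k F u x + jump p m l k F v x)"
      using jump_lin[OF assms(1,2) that] by blast
    then show ?thesis
      using L2_surface_lin[OF face_borel face_properties(2)] surface_admissible_jump[OF _ that] assms by simp
  qed
  then have "g_form p \<gamma> m l (\<lambda>x. c * u x + v x) w
      = \<gamma> * (\<Sum>F\<in>ghost_faces m l. \<Sum>k=1..p. c * (?a k * ?J F k u) + ?a k * ?J F k v)"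
    unfolding g_form_def by (intro arg_cong[where f = "(*) \<gamma>"] sum.cong refl) (simp add: distrib_left)
  then show ?thesis
    unfolding g_form_def sum.distrib sum_distrib_left[symmetric] by (simp add: distrib_left)
qed

lemma g_form_nonneg: "\<gamma> > 0 \<Longrightarrow> g_form p \<gamma> m l u u \<ge> 0"
  unfolding g_form_def using h_pos
  by (intro mult_nonneg_nonneg sum_nonneg divide_nonneg_nonneg L2_surface_nonneg) auto

section \<open>The energy form\<close>

definition cell_grad :: "(real ^ 'n \<Rightarrow> real) \<Rightarrow> (real ^ 'n \<Rightarrow> real) \<Rightarrow> int ^ 'n \<Rightarrow> real ^ 'n \<Rightarrow> real" where
  "cell_grad u v z x = (\<Sum>i\<in>UNIV. partial i (qp u z) x * partial i (qp v z) x)"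

text \<open>
  Agrees almost everywhere with the integrand of \<open>grad_inner\<close>, but is measurable and, on finite element functions,
  linear in each argument at every point; on the mesh skeleton \<open>grad\<close> need not be linear.
\<close>

definition grad_density :: "(real ^ 'n \<Rightarrow> real) \<Rightarrow> (real ^ 'n \<Rightarrow> real) \<Rightarrow> real ^ 'n \<Rightarrow> real" where
  "grad_density u v x = (\<Sum>z\<in>active. indicator (Omega m \<inter> interior (K z)) x * cell_grad u v z x)"

lemma grad_interior:
  assumes "v \<in> V" "z \<in> active" "x \<in> interior (K z)"
  shows "grad v x = (\<chi> i. partial i (qp v z) x)"
proof -
  have "(v has_derivative (\<lambda>h. \<Sum>i\<in>UNIV. partial i (qp v z) x * h $ i)) (at x)"
    by (rule has_derivative_transform_within_open[OF Q_poly_has_derivative[OF cell_poly(1)[OF assms(1,2)]] open_interior assms(3)])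
       (use cell_poly(2)[OF assms(1,2)] interior_subset in blast)
  then have "frechet_derivative v (at x) = (\<lambda>h. \<Sum>i\<in>UNIV. partial i (qp v z) x * h $ i)"
    by (rule frechet_derivative_at[symmetric])
  then show ?thesis by (simp add: grad_def sum_mult_axis)
qed

lemma integrable_grad_density:
  assumes "u \<in> V" "v \<in> V"
  shows "integrable lebesgue (grad_density u v)"
  unfolding grad_density_def[abs_def]
proof (intro Bochner_Integration.integrable_sum)
  fix z assume z: "z \<in> active"
  let ?f = "cell_grad u v z"
  have "continuous_on (K z) ?f"
    unfolding cell_grad_def by (intro continuous_intros Q_poly_continuous[OF Q_poly_partial[OF cell_poly(1)]] assms z)
  then have "set_integrable lborel (K z) ?f"
    unfolding set_integrable_def by (intro borel_integrable_compact compact_cell)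
  then have "set_integrable lborel (Omega m \<inter> interior (K z)) ?f"
    by (rule set_integrable_subset) (use open_Omega interior_subset in \<open>auto intro!: borel_open\<close>)
  then have i: "integrable lborel (\<lambda>x. indicator (Omega m \<inter> interior (K z)) x * ?f x)"
    by (simp add: set_integrable_def)
  then show "integrable lebesgue (\<lambda>x. indicator (Omega m \<inter> interior (K z)) x * ?f x)"
    using integrable_completion borel_measurable_integrable by blast
qed

lemma grad_inner_eq:
  assumes "u \<in> V" "v \<in> V"
  shows "grad_inner (Omega m) u v = integral\<^sup>L lebesgue (grad_density u v)"
proof -
  have "negligible (\<Union>z\<in>active. frontier (K z))"
    by (rule negligible_Union) (auto intro: negligible_convex_frontier)
  then have "AE x in lebesgue. x \<notin> (\<Union>z\<in>active. frontier (K z))"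
    by (intro AE_not_in) (simp add: negligible_iff_null_sets)
  moreover have "grad_density u v x = indicator (Omega m) x *\<^sub>R (grad u x \<bullet> grad v x)"
    if x: "x \<notin> (\<Union>z\<in>active. frontier (K z))" for x
  proof (cases "x \<in> Omega m")
    case True
    then obtain z where z: "z \<in> active" "x \<in> K z" using Omega_subset by (auto simp: Omega_h_def)
    then have int: "x \<in> interior (K z)" using x by (auto simp: frontier_def)
    have "grad_density u v x = (\<Sum>z'\<in>active. if z' = z then cell_grad u v z x else 0)"
      unfolding grad_density_def
    proof (intro sum.cong refl)
      fix z' assume "z' \<in> active"
      show "indicator (Omega m \<inter> interior (K z')) x * cell_grad u v z' x
        = (if z' = z then cell_grad u v z x else 0)"
      proof (cases "z' = z")
        case False
        then have "x \<notin> interior (K z')" using interior_cell_unique[of x z' z] z(2) by blast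
        then show ?thesis using False by simp
      qed (use True int in simp)
    qed
    also have "\<dots> = cell_grad u v z x" using z(1) by simp
    also have "\<dots> = grad u x \<bullet> grad v x"
      by (simp add: grad_interior[OF assms(1) z(1) int] grad_interior[OF assms(2) z(1) int] inner_vec_def cell_grad_def)
    finally show ?thesis using True by simp
  qed (simp add: grad_density_def)
  ultimately have ae: "AE x in lebesgue. grad_density u v x = indicator (Omega m) x *\<^sub>R (grad u x \<bullet> grad v x)"
    by (auto elim: eventually_mono)
  have meas: "grad_density u v \<in> borel_measurable lebesgue"
    using integrable_grad_density[OF assms] by (rule borel_measurable_integrable)
  show ?thesis
    unfolding grad_inner_def set_lebesgue_integral_def
    by (rule integral_cong_AE[symmetric]) (use meas borel_measurable_AE[OF meas ae] ae in auto)
qed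

lemma grad_inner_sym: "grad_inner S u v = grad_inner S v u"
  by (simp add: grad_inner_def inner_commute)

lemma grad_inner_lin:
  assumes "u \<in> V" "v \<in> V" "w \<in> V"
  shows "grad_inner (Omega m) (\<lambda>x. c * u x + v x) w = c * grad_inner (Omega m) u w + grad_inner (Omega m) v w"
proof -
  have cell: "cell_grad (\<lambda>x. c * u x + v x) w z x = c * cell_grad u w z x + cell_grad v w z x"
    if "z \<in> active" for z x
    using that by (simp add: cell_grad_def cell_poly_lin[OF assms(1,2)] distrib_right sum.distrib sum_distrib_left
        partial_lin[OF cell_poly(1)[OF assms(1)] cell_poly(1)[OF assms(2)]] mult.assoc)
  have "grad_density (\<lambda>x. c * u x + v x) w = (\<lambda>x. c * grad_density u w x + grad_density v w x)"
  proof
    fix x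
    let ?i = "\<lambda>z. indicator (Omega m \<inter> interior (K z)) x :: real"
    have "grad_density (\<lambda>x. c * u x + v x) w x
        = (\<Sum>z\<in>active. c * (?i z * cell_grad u w z x) + ?i z * cell_grad v w z x)"
      unfolding grad_density_def by (intro sum.cong refl) (simp add: cell distrib_left)
    then show "grad_density (\<lambda>x. c * u x + v x) w x = c * grad_density u w x + grad_density v w x"
      by (simp only: grad_density_def sum.distrib sum_distrib_left)
  qed
  then show ?thesis
    using integrable_grad_density assms by (simp add: grad_inner_eq V_add V_scale)
qed

lemma A_form_sym: "A_form p \<gamma> \<gamma>\<^sub>D m l u v = A_form p \<gamma> \<gamma>\<^sub>D m l v u"
  unfolding A_form_def a_form_def
  by (simp add: grad_inner_sym[of _ u v] g_form_sym[of _ u v] L2_surface_sym[of _ u]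
      L2_surface_sym[of _ "dn u"])

lemma A_form_lin:
  assumes "u \<in> V" "v \<in> V" "w \<in> V"
  shows "A_form p \<gamma> \<gamma>\<^sub>D m l (\<lambda>x. c * u x + v x) w
    = c * A_form p \<gamma> \<gamma>\<^sub>D m l u w + A_form p \<gamma> \<gamma>\<^sub>D m l v w"
proof -
  note lin = L2_surface_lin[OF Gamma_borel Gamma_finite]
  have nd: "surface_admissible \<Gamma> (dn f)" and tr: "surface_admissible \<Gamma> f" if "f \<in> {u, v, w}" for f
    using surface_admissible_normal_deriv surface_admissible_trace assms that by auto
  have "L2_surface \<Gamma> (dn (\<lambda>x. c * u x + v x)) w = L2_surface \<Gamma> (\<lambda>x. c * dn u x + dn v x) w"
    using normal_deriv_lin[OF assms(1,2)] by (intro L2_surface_cong Gamma_borel) simp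
  then show ?thesis
    unfolding A_form_def a_form_def
    by (simp add: grad_inner_lin[OF assms] g_form_lin[OF assms] lin nd tr) (simp add: algebra_simps)
qed

text \<open>
  The gradient of the polynomial of an active cell vanishes almost everywhere on an open set, namely where the
  domain meets the interior of the cell, and so it is identically zero. A function that is constant on
  each of finitely many cells and continuous on the connected domain has only one value.
\<close>

lemma constant_on_Omega_h:
  assumes v: "v \<in> V" and zero: "grad_inner (Omega m) v v = 0"
  shows "\<exists>c. \<forall>x\<in>\<Omega>h. v x = c"
proof -
  have cell_grad_nonneg: "cell_grad v v z x \<ge> 0" for z x
    unfolding cell_grad_def by (intro sum_nonneg) simp
  then have nonneg: "grad_density v v x \<ge> 0" for x
    unfolding grad_density_def by (intro sum_nonneg mult_nonneg_nonneg) auto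
  have "AE x in lebesgue. grad_density v v x = 0"
    using zero integrable_grad_density[OF v v] unfolding grad_inner_eq[OF v v]
    by (subst (asm) integral_nonneg_eq_0_iff_AE) (auto simp: nonneg)
  then obtain N where N: "N \<in> null_sets lebesgue" "{x. grad_density v v x \<noteq> 0} \<subseteq> N"
    unfolding eventually_ae_filter by auto
  have cell_const: "\<exists>c. \<forall>x\<in>K z. v x = c" if z: "z \<in> active" for z
  proof -
    let ?q = "qp v z"
    have q: "?q \<in> Q_poly p" using cell_poly(1)[OF v z] .
    define G0 where "G0 = Omega m \<inter> interior (K z)"
    have G0: "open G0" "G0 \<noteq> {}" using open_Omega active_meets_interior[OF z] by (auto simp: G0_def)
    have partial0: "partial i ?q x = 0" for i x
    proof (rule Q_poly_zero_on_open[OF Q_poly_partial[OF q] G0])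
      fix y assume y: "y \<in> G0"
      show "partial i ?q y = 0"
      proof (rule ccontr)
        assume ne: "partial i ?q y \<noteq> 0"
        define G1 where "G1 = G0 \<inter> {x. partial i ?q x \<noteq> 0}"
        have "open {x. partial i ?q x \<noteq> 0}"
          by (intro open_Collect_neq Q_poly_continuous[OF Q_poly_partial[OF q]] continuous_on_const)
        then have "open G1" "G1 \<noteq> {}" using G0 y ne by (auto simp: G1_def)
        moreover have "G1 \<subseteq> N"
        proof
          fix x assume x: "x \<in> G1"
          have "0 < (partial i ?q x)\<^sup>2" using x by (simp add: G1_def)
          also have "\<dots> \<le> (\<Sum>j\<in>UNIV. (partial j ?q x)\<^sup>2)" by (intro member_le_sum) auto
          also have "\<dots> = indicator (Omega m \<inter> interior (K z)) x * cell_grad v v z x"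
            using x by (simp add: G1_def G0_def cell_grad_def power2_eq_square)
          also have "\<dots> \<le> grad_density v v x"
            unfolding grad_density_def using z cell_grad_nonneg
            by (intro member_le_sum[where f = "\<lambda>z. indicator (Omega m \<inter> interior (K z)) x * cell_grad v v z x"])
               (auto intro!: mult_nonneg_nonneg)
          finally show "x \<in> N" using N(2) by auto
        qed
        then have "negligible G1" using N(1) negligible_subset by (auto simp: negligible_iff_null_sets[symmetric])
        ultimately show False using open_not_negligible by blast
      qed
    qed
    have "(?q has_derivative (\<lambda>h. 0)) (at x within UNIV)" for x
      using Q_poly_has_derivative[OF q, of x] by (simp add: partial0)
    then obtain c where "\<And>x. ?q x = c"
      using has_derivative_zero_constant[OF convex_UNIV, of ?q] by auto
    then show ?thesis using cell_poly(2)[OF v z] by metis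
  qed
  then obtain c where c: "\<And>z x. z \<in> active \<Longrightarrow> x \<in> K z \<Longrightarrow> v x = c z" by metis
  have "v ` Omega m \<subseteq> c ` active"
    using Omega_subset c by (fastforce simp: Omega_h_def)
  then have "finite (v ` Omega m)" using finite_active finite_subset by blast
  then have "v constant_on Omega m"
    using continuous_on_subset[OF V_continuous[OF v] Omega_subset] connected_Omega
    by (intro continuous_finite_range_constant)
  then obtain a where a: "\<And>x. x \<in> Omega m \<Longrightarrow> v x = a" by (auto simp: constant_on_def)
  have "v x = a" if x: "x \<in> \<Omega>h" for x
  proof -
    obtain z where z: "z \<in> active" "x \<in> K z" using x by (auto simp: Omega_h_def)
    then obtain y where "y \<in> K z" "y \<in> Omega m" by (auto simp: active_cells_def)
    then show ?thesis using a c z by metis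
  qed
  then show ?thesis by blast
qed

text \<open>
  The radicand of \<open>N_norm\<close> is a sum of nonnegative terms, each of which vanishes with \<open>A v v\<close>. The gradient term
  makes \<open>v\<close> constant, the boundary term makes the constant zero.
\<close>

lemma A_form_definite:
  assumes v: "v \<in> V" and \<gamma>: "\<gamma> > 0" and c: "c > 0"
    and stable: "c * (N_norm p \<gamma> m l v)\<^sup>2 \<le> A_form p \<gamma> \<gamma>\<^sub>D m l v v"
  shows "A_form p \<gamma> \<gamma>\<^sub>D m l v v \<ge> 0" "A_form p \<gamma> \<gamma>\<^sub>D m l v v = 0 \<Longrightarrow> v = (\<lambda>_. 0)"
proof -
  have "0 \<le> c * (N_norm p \<gamma> m l v)\<^sup>2" using c by simp
  then show "A_form p \<gamma> \<gamma>\<^sub>D m l v v \<ge> 0" using stable by linarith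
  assume "A_form p \<gamma> \<gamma>\<^sub>D m l v v = 0"
  then have "c * (N_norm p \<gamma> m l v)\<^sup>2 \<le> 0" using stable by simp
  then have "N_norm p \<gamma> m l v = 0" using c by (simp add: mult_le_0_iff)
  moreover have gi: "grad_inner (Omega m) v v \<ge> 0"
    unfolding grad_inner_def set_lebesgue_integral_def by (intro integral_nonneg_AE) auto
  ultimately have "grad_inner (Omega m) v v + h * L2_surface \<Gamma> (dn v) (dn v)
     + inverse h * L2_surface \<Gamma> v v + g_form p \<gamma> m l v v = 0"
    by (simp add: N_norm_def)
  moreover have "h * L2_surface \<Gamma> (dn v) (dn v) \<ge> 0" "inverse h * L2_surface \<Gamma> v v \<ge> 0"
    using h_pos by (simp_all add: L2_surface_nonneg)
  ultimately have g0: "grad_inner (Omega m) v v = 0" and "inverse h * L2_surface \<Gamma> v v = 0"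
    using gi g_form_nonneg[OF \<gamma>, of v] by linarith+
  then have s0: "L2_surface \<Gamma> v v = 0" using h_pos by simp
  obtain a where a: "\<And>x. x \<in> \<Omega>h \<Longrightarrow> v x = a" using constant_on_Omega_h[OF v g0] by blast
  have "L2_surface \<Gamma> v v = L2_surface \<Gamma> (\<lambda>_. a) (\<lambda>_. a)"
    using a frontier_subset by (intro L2_surface_cong Gamma_borel) auto
  also have "\<dots> = measure surface_measure \<Gamma> * (a * a)"
    using Gamma_borel Gamma_finite by (simp add: L2_surface_def set_lebesgue_integral_def)
  finally have "measure surface_measure \<Gamma> * (a * a) = 0" using s0 by simp
  moreover have "measure surface_measure \<Gamma> > 0"
    using Gamma_pos Gamma_finite by (simp add: measure_def enn2real_positive_iff)
  ultimately have "a = 0" by simp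
  then show "v = (\<lambda>_. 0)" using a V_zero_outside[OF v] by (metis (no_types))
qed

end

section \<open>Energy orthogonality within a color\<close>

lemma partial_zero: "partial i (\<lambda>_. 0) x = 0"
  by (simp add: partial_def)

lemma axis_deriv_zero: "axis_deriv k i (\<lambda>_. 0) x = 0"
  using axis_deriv_lin[OF Q_poly_zero[of 0] Q_poly_zero, of k i "-1"] by (simp add: fun_eq_iff)

context cut_mesh
begin

text \<open>
  Cells are closed, so such a function also vanishes where a cell of \<open>Z\<close> touches another active cell.
\<close>

definition supported_in :: "(real ^ 'n \<Rightarrow> real) \<Rightarrow> (int ^ 'n) set \<Rightarrow> bool" where
  "supported_in u Z \<longleftrightarrow> u \<in> V \<and> (\<forall>z\<in>active - Z. \<forall>x\<in>K z. u x = 0)"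

lemma supported_cell_poly:
  assumes "supported_in u Z" "z \<in> active" "z \<notin> Z"
  shows "qp u z = (\<lambda>_. 0)"
  using assms by (intro cell_poly_eqI Q_poly_zero) (auto simp: supported_in_def)

text \<open>
  On the boundary, disjointness of the cells suffices although closed cells overlap: the values and the
  one-sided derivatives of both functions at a point are read off the same entered cell, and one of
  the two functions vanishes on that cell.
\<close>

lemma a_form_disjoint:
  assumes u: "supported_in u Z" and v: "supported_in v Z'" and disj: "Z \<inter> Z' = {}"
  shows "a_form \<gamma>\<^sub>D m l u v = 0"
proof -
  have V: "u \<in> V" "v \<in> V" using u v by (simp_all add: supported_in_def)
  have cases: "z \<notin> Z \<or> z \<notin> Z'" for z using disj by auto
  have "grad_density u v x = 0" for x
    unfolding grad_density_def
  proof (rule sum.neutral, rule ballI)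
    fix z assume z: "z \<in> active"
    have "cell_grad u v z x = 0"
      using cases[of z] supported_cell_poly[OF u z] supported_cell_poly[OF v z]
      by (auto simp: cell_grad_def partial_zero)
    then show "indicator (Omega m \<inter> interior (K z)) x * cell_grad u v z x = 0" by simp
  qed
  then have "grad_density u v = (\<lambda>_. 0)" by blast
  then have grad: "grad_inner (Omega m) u v = 0" by (simp add: grad_inner_eq[OF V])
  have nd: "dn u x * v x = 0 \<and> u x * dn v x = 0 \<and> u x * v x = 0"
    if x: "x \<in> \<Gamma>" for x
  proof -
    obtain z where e: "enters x z" using exists_entered_cell[OF x] by blast
    then have z: "z \<in> active" "x \<in> K z" by (simp_all add: enters_def)
    have "dn u x = 0 \<and> u x = 0" if "z \<notin> Z"
      using supported_cell_poly[OF u z(1) that] normal_deriv_eq[OF V(1) e] u z that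
      by (auto simp: supported_in_def partial_zero)
    moreover have "dn v x = 0 \<and> v x = 0" if "z \<notin> Z'"
      using supported_cell_poly[OF v z(1) that] normal_deriv_eq[OF V(2) e] v z that
      by (auto simp: supported_in_def partial_zero)
    ultimately show ?thesis using cases[of z] by auto
  qed
  show ?thesis
    unfolding a_form_def grad
    using nd by (simp add: L2_surface_zero[OF Gamma_borel])
qed

lemma jump_supported:
  assumes u: "supported_in u Z" and F: "(i, z) \<in> ghost_faces m l" and "z \<notin> Z" "z + axis i 1 \<notin> Z"
  shows "jump p m l k (i, z) u x = 0"
proof -
  have "z \<in> active" "z + axis i 1 \<in> active" using F by (auto simp: ghost_faces_def)
  then show ?thesis using supported_cell_poly[OF u] assms(3,4) by (simp add: jump_def axis_deriv_zero)
qed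

lemma g_form_zero:
  assumes "\<And>F k x. F \<in> ghost_faces m l \<Longrightarrow> jump p m l k F u x * jump p m l k F v x = 0"
  shows "g_form p \<gamma> m l u v = 0"
  unfolding g_form_def
  using assms by (simp add: L2_surface_zero[OF face_borel])

lemma V_local_supported: "u \<in> V_local \<kappa> p m l j \<Longrightarrow> supported_in u (vertex_cells j)"
  using V_local_V V_local_zero by (auto simp: supported_in_def)

lemma vertex_cells_bounds: "z \<in> vertex_cells j \<Longrightarrow> j $ i - 1 \<le> z $ i \<and> z $ i \<le> j $ i"
  by (auto simp: vertex_cells_def dest!: spec[of _ i])

text \<open>
  Collar patches of one color differ by at least three cells in some direction, so there is a layer of cells
  between them and no face touches both. Interior patches of one color differ by an even number of cells, at
  least two, in some direction, so they may share a boundary, but they have no active cell at a ghost face.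
\<close>

lemma same_color_orthogonal:
  assumes col: "collar_coloring m l \<chi>\<^sub>0" and j: "j \<in> color_class m l \<chi>\<^sub>0 c" and k: "k \<in> color_class m l \<chi>\<^sub>0 c"
    and ne: "j \<noteq> k" and u: "u \<in> V_local \<kappa> p m l j" and v: "v \<in> V_local \<kappa> p m l k"
  shows "A_form p \<gamma> \<gamma>\<^sub>D m l u v = 0"
proof -
  note su = V_local_supported[OF u] and sv = V_local_supported[OF v]
  have adm: "j \<in> admissible m l" "k \<in> admissible m l" and c: "patch_color m l \<chi>\<^sub>0 j = patch_color m l \<chi>\<^sub>0 k"
    using j k by (auto simp: color_class_def)
  have "vertex_cells j \<inter> vertex_cells k = {} \<and>
    (\<forall>F\<in>ghost_faces m l. \<forall>n x. jump p m l n F u x * jump p m l n F v x = 0)"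
  proof (cases "j \<in> collar m l")
    case True
    then have kc: "k \<in> collar m l" and same: "\<chi>\<^sub>0 j = \<chi>\<^sub>0 k" using c by (auto simp: patch_color_def split: if_splits)
    then obtain i where i: "\<bar>j $ i - k $ i\<bar> \<ge> 3" using col True ne unfolding collar_coloring_def by blast
    \<comment> \<open>A patch is two cells wide, so an index distance of three leaves a distance of two for the cells.\<close>
    have far: "\<bar>z $ i - z' $ i\<bar> \<ge> 2" if "z \<in> vertex_cells j" "z' \<in> vertex_cells k" for z z'
      using vertex_cells_bounds[OF that(1), of i] vertex_cells_bounds[OF that(2), of i] i by linarith
    show ?thesis
    proof (intro conjI ballI allI)
      show "vertex_cells j \<inter> vertex_cells k = {}" using far by fastforce
      fix F n x assume F: "F \<in> ghost_faces m l"
      obtain i' z where Fz: "F = (i', z)" by (cases F)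
      have near: "\<bar>y $ i - y' $ i\<bar> \<le> 1" if "y \<in> {z, z + axis i' 1}" "y' \<in> {z, z + axis i' 1}" for y y'
        using that by (auto simp: axis_def)
      have "(z \<notin> vertex_cells j \<and> z + axis i' 1 \<notin> vertex_cells j) \<or> (z \<notin> vertex_cells k \<and> z + axis i' 1 \<notin> vertex_cells k)"
        using far near by (smt (verit) insertCI)
      then show "jump p m l n F u x * jump p m l n F v x = 0"
        using jump_supported[OF su] jump_supported[OF sv] F unfolding Fz by auto
    qed
  next
    case False
    then have kc: "k \<notin> collar m l" and par: "(\<chi> i. j $ i mod 2) = (\<chi> i. k $ i mod 2)"
      using c by (auto simp: patch_color_def split: if_splits)
    obtain i where i: "j $ i \<noteq> k $ i" using ne by (auto simp: vec_eq_iff)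
    have "j $ i mod 2 = k $ i mod 2" using par by (auto simp: vec_eq_iff)
    with i have gap: "\<bar>j $ i - k $ i\<bar> \<ge> 2" by presburger
    show ?thesis
    proof (intro conjI ballI allI)
      have False if "z \<in> vertex_cells j" "z \<in> vertex_cells k" for z
        using vertex_cells_bounds[OF that(1), of i] vertex_cells_bounds[OF that(2), of i] gap by linarith
      then show "vertex_cells j \<inter> vertex_cells k = {}" by blast
      fix F n x assume F: "F \<in> ghost_faces m l"
      obtain i' z where Fz: "F = (i', z)" by (cases F)
      have act: "z \<in> active" "z + axis i' 1 \<in> active" using F unfolding Fz by (auto simp: ghost_faces_def)
      have "z \<notin> vertex_cells j" "z + axis i' 1 \<notin> vertex_cells j"
        using False adm(1) F act unfolding collar_def Fz by blast+
      then show "jump p m l n F u x * jump p m l n F v x = 0"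
        using jump_supported[OF su] F unfolding Fz by simp
    qed
  qed
  then show ?thesis
    unfolding A_form_def using a_form_disjoint[OF su sv] g_form_zero by simp
qed

end

section \<open>Contraction of the colored sweep\<close>

lemma card_parity_vectors: "card {x :: int ^ 'n::finite. \<forall>i. x $ i \<in> {0, 1}} \<le> 2 ^ CARD('n)"
  and finite_parity_vectors: "finite {x :: int ^ 'n::finite. \<forall>i. x $ i \<in> {0, 1}}"
proof -
  have fin: "finite (PiE (UNIV :: 'n set) (\<lambda>_. {0, 1 :: int}))" by (intro finite_PiE) auto
  have sub: "{x :: int ^ 'n. \<forall>i. x $ i \<in> {0, 1}} \<subseteq> vec_lambda ` PiE UNIV (\<lambda>_. {0, 1})"
  proof
    fix x :: "int ^ 'n" assume "x \<in> {x. \<forall>i. x $ i \<in> {0, 1}}"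
    then show "x \<in> vec_lambda ` PiE UNIV (\<lambda>_. {0, 1})" by (intro image_eqI[of _ _ "\<lambda>i. x $ i"]) auto
  qed
  show "finite {x :: int ^ 'n. \<forall>i. x $ i \<in> {0, 1}}" using sub fin by (meson finite_imageI finite_subset)
  have "card {x :: int ^ 'n. \<forall>i. x $ i \<in> {0, 1}} \<le> card (vec_lambda ` PiE (UNIV :: 'n set) (\<lambda>_. {0, 1 :: int}))"
    using sub fin by (intro card_mono) auto
  also have "\<dots> \<le> card (PiE (UNIV :: 'n set) (\<lambda>_. {0, 1 :: int}))" using fin by (rule card_image_le)
  also have "\<dots> = 2 ^ CARD('n)" by (simp add: card_PiE numeral_2_eq_2)
  finally show "card {x :: int ^ 'n. \<forall>i. x $ i \<in> {0, 1}} \<le> 2 ^ CARD('n)" .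
qed

lemma number_of_colors:
  fixes m :: "('n::finite) config"
  assumes "collar_coloring m l \<chi>\<^sub>0" "color_order m l \<chi>\<^sub>0 cs"
  shows "length cs \<le> 2 ^ CARD('n) + 3 ^ CARD('n)"
proof -
  let ?I = "{..<(3::nat) ^ CARD('n)}" and ?P = "{x :: int ^ 'n. \<forall>i. x $ i \<in> {0, 1}}"
  have "set cs \<subseteq> Inl ` ?I \<union> Inr ` ?P"
  proof
    fix c assume "c \<in> set cs"
    then obtain j where j: "c = patch_color m l \<chi>\<^sub>0 j" using assms(2) by (auto simp: color_order_def)
    show "c \<in> Inl ` ?I \<union> Inr ` ?P"
    proof (cases "j \<in> collar m l")
      case True
      then show ?thesis using assms(1) by (auto simp: j patch_color_def collar_coloring_def)
    next
      case False
      have "(\<chi> i. j $ i mod 2) \<in> ?P" by auto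
      then show ?thesis using False by (auto simp: j patch_color_def)
    qed
  qed
  then have "card (set cs) \<le> card (Inl ` ?I \<union> Inr ` ?P)"
    by (rule card_mono[rotated]) (intro finite_UnI finite_imageI finite_lessThan finite_parity_vectors)
  also have "\<dots> \<le> card (Inl ` ?I :: (nat + int ^ 'n) set) + card (Inr ` ?P :: (nat + int ^ 'n) set)" by (rule card_Un_le)
  also have "\<dots> = 3 ^ CARD('n) + card ?P" by (simp add: card_image)
  also have "\<dots> \<le> 3 ^ CARD('n) + 2 ^ CARD('n)" using card_parity_vectors by simp
  finally have "card (set cs) \<le> 2 ^ CARD('n) + 3 ^ CARD('n)" by simp
  moreover have "card (set cs) = length cs" using assms(2) by (intro distinct_card) (simp add: color_order_def)
  ultimately show ?thesis by simp
qed

text \<open>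
  The left-hand side counts the pairs \<open>i \<le> k\<close> of the \<open>N + 1\<close> spaces, which come from \<open>N\<close> colors and the
  coarse space.
\<close>

lemma triangular_le: "real ((N + 1) * (N + 2)) / 2 \<le> 2 * (real N)\<^sup>2 + 1"
proof -
  have "real N \<le> (real N)\<^sup>2" by (cases N) (simp_all add: power2_eq_square)
  then show ?thesis by (simp add: power2_eq_square algebra_simps)
qed

text \<open>
  One configuration and level of the family. The lower stability bound is what makes \<open>A\<close> definite.
\<close>

locale stable_mesh = cut_mesh m l p for m :: "('n::finite) config" and l p +
  fixes \<gamma> \<gamma>\<^sub>D c\<^sub>A :: real
  assumes gamma_pos: "0 < \<gamma>" and c_pos: "0 < c\<^sub>A"
    and stable: "\<And>v. v \<in> V_space p m l \<Longrightarrow> c\<^sub>A * (N_norm p \<gamma> m l v)\<^sup>2 \<le> A_form p \<gamma> \<gamma>\<^sub>D m l v v"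
    and level: "1 \<le> l"
begin

abbreviation "A \<equiv> A_form p \<gamma> \<gamma>\<^sub>D m l"
abbreviation "proj \<equiv> A_proj p \<gamma> \<gamma>\<^sub>D m l"

sublocale energy_form "V_space p m l" "A_form p \<gamma> \<gamma>\<^sub>D m l"
proof
  show "A u v = A v u" for u v by (rule A_form_sym)
  show "A v v = 0 \<Longrightarrow> v = (\<lambda>_. 0)" "A v v \<ge> 0" if "v \<in> V" for v
    using A_form_definite[OF that gamma_pos c_pos stable[OF that]] by auto
qed (simp_all add: V_zero V_add V_scale A_form_lin)

lemma proj_span:
  assumes "finite Y" "\<And>y. y \<in> Y \<Longrightarrow> b y \<in> V" "W = {w. \<exists>c. w = (\<lambda>x. \<Sum>y\<in>Y. c y * b y x)}" "v \<in> V"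
  shows "proj W v \<in> W \<and> (\<forall>z\<in>W. A (\<lambda>x. v x - proj W v x) z = 0)"
proof -
  have "\<exists>!w. w \<in> W \<and> (\<forall>z\<in>W. A (\<lambda>x. v x - w x) z = 0)"
    by (rule projection_unique_exists) (fact assms(1) assms(2) assms(4) assms(3))+
  from theI'[OF this] show ?thesis unfolding A_proj_def .
qed

lemma proj_local:
  assumes "v \<in> V"
  shows "proj (V_local \<kappa> p m l j) v \<in> V_local \<kappa> p m l j"
    "z \<in> V_local \<kappa> p m l j \<Longrightarrow> A (\<lambda>x. v x - proj (V_local \<kappa> p m l j) v x) z = 0"
proof -
  have fin: "finite (local_nodes \<kappa> j)" using local_nodes_subset finite_nodes by (rule finite_subset)
  have "proj (V_local \<kappa> p m l j) v \<in> V_local \<kappa> p m l j \<and>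
    (\<forall>z\<in>V_local \<kappa> p m l j. A (\<lambda>x. v x - proj (V_local \<kappa> p m l j) v x) z = 0)"
    by (rule proj_span[OF fin, of "nodal_basis p m l"])
       (use assms nodal_basis_V in \<open>simp_all add: V_local_eq nodal_span_def\<close>)
  then show "proj (V_local \<kappa> p m l j) v \<in> V_local \<kappa> p m l j"
    "z \<in> V_local \<kappa> p m l j \<Longrightarrow> A (\<lambda>x. v x - proj (V_local \<kappa> p m l j) v x) z = 0" by auto
qed

lemma coarse_V: "v \<in> V_coarse p m l \<Longrightarrow> v \<in> V"
  using prolongation_V_space[OF _ level] mesh_axioms unfolding V_coarse_def mesh_def by auto

lemma proj_coarse:
  assumes "v \<in> V"
  shows "proj (V_coarse p m l) v \<in> V_coarse p m l"
    "z \<in> V_coarse p m l \<Longrightarrow> A (\<lambda>x. v x - proj (V_coarse p m l) v x) z = 0"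
proof -
  have mp: "mesh m p" using mesh_axioms by (simp add: mesh_def)
  interpret C: mesh m "l - 1" p using mp .
  have b: "prolongation m l (nodal_basis p m (l - 1) y) \<in> V" for y
    by (rule prolongation_V_space[OF mp level C.nodal_basis_V])
  have "proj (V_coarse p m l) v \<in> V_coarse p m l \<and>
    (\<forall>z\<in>V_coarse p m l. A (\<lambda>x. v x - proj (V_coarse p m l) v x) z = 0)"
    by (rule proj_span[OF C.finite_nodes, of "\<lambda>y. prolongation m l (nodal_basis p m (l - 1) y)"])
       (use assms b V_coarse_eq_span[OF mp level] in simp_all)
  then show "proj (V_coarse p m l) v \<in> V_coarse p m l"
    "z \<in> V_coarse p m l \<Longrightarrow> A (\<lambda>x. v x - proj (V_coarse p m l) v x) z = 0" by auto
qed

definition color_correction :: "local_kind \<Rightarrow> (int ^ 'n \<Rightarrow> nat) \<Rightarrow> nat + (int ^ 'n) \<Rightarrow> (real ^ 'n \<Rightarrow> real) \<Rightarrow> real ^ 'n \<Rightarrow> real" where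
  "color_correction \<kappa> \<chi>\<^sub>0 c u x = (\<Sum>j\<in>color_class m l \<chi>\<^sub>0 c. proj (V_local \<kappa> p m l j) u x)"

lemma color_correction_V: "u \<in> V \<Longrightarrow> color_correction \<kappa> \<chi>\<^sub>0 c u \<in> V"
  unfolding color_correction_def[abs_def] by (intro V_sum V_local_V[OF proj_local(1)])

lemma finite_color_class: "finite (color_class m l \<chi>\<^sub>0 c)"
  by (simp add: color_class_def)

text \<open>
  The other patches of the color do not see the correction of a given patch, so the simultaneous correction acts on
  each local space as its own projection does.
\<close>

lemma color_correction_orthogonal:
  assumes col: "collar_coloring m l \<chi>\<^sub>0" and u: "u \<in> V"
    and y: "\<And>j. j \<in> color_class m l \<chi>\<^sub>0 c \<Longrightarrow> y j \<in> V_local \<kappa> p m l j"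
  shows "A (\<lambda>x. u x - color_correction \<kappa> \<chi>\<^sub>0 c u x) (\<lambda>x. \<Sum>j\<in>color_class m l \<chi>\<^sub>0 c. y j x) = 0"
proof -
  let ?c = "color_class m l \<chi>\<^sub>0 c" and ?P = "\<lambda>j. proj (V_local \<kappa> p m l j) u"
  have yV: "y j \<in> V" if "j \<in> ?c" for j using y[OF that] by (rule V_local_V)
  have PV: "?P j \<in> V" for j using proj_local(1)[OF u] by (rule V_local_V)
  have rV: "(\<lambda>x. u x - color_correction \<kappa> \<chi>\<^sub>0 c u x) \<in> V"
    by (rule V_diff[OF u color_correction_V[OF u]])
  have "A (\<lambda>x. u x - color_correction \<kappa> \<chi>\<^sub>0 c u x) (y k) = 0" if k: "k \<in> ?c" for k
  proof -
    have "A (color_correction \<kappa> \<chi>\<^sub>0 c u) (y k) = (\<Sum>j\<in>?c. A (?P j) (y k))"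
      unfolding color_correction_def[abs_def] using PV yV[OF k] by (intro form_sum) auto
    also have "\<dots> = (\<Sum>j\<in>?c. if j = k then A (?P k) (y k) else 0)"
      using same_color_orthogonal[OF col _ k _ proj_local(1)[OF u] y[OF k]] by (intro sum.cong refl) auto
    also have "\<dots> = A (?P k) (y k)" using k finite_color_class by simp
    finally have "A (\<lambda>x. u x - color_correction \<kappa> \<chi>\<^sub>0 c u x) (y k) = A u (y k) - A (?P k) (y k)"
      using form_diff[OF u color_correction_V[OF u] yV[OF k]] by simp
    also have "\<dots> = A (\<lambda>x. u x - ?P k x) (y k)" using form_diff[OF u PV yV[OF k]] by simp
    also have "\<dots> = 0" using proj_local(2)[OF u y[OF k]] .
    finally show ?thesis .
  qed
  then show ?thesis using form_sum_right[of ?c y, OF yV rV] by simp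
qed

lemma color_sum_energy:
  assumes col: "collar_coloring m l \<chi>\<^sub>0" and y: "\<And>j. j \<in> color_class m l \<chi>\<^sub>0 c \<Longrightarrow> y j \<in> V_local \<kappa> p m l j"
  shows "A (\<lambda>x. \<Sum>j\<in>color_class m l \<chi>\<^sub>0 c. y j x) (\<lambda>x. \<Sum>j\<in>color_class m l \<chi>\<^sub>0 c. y j x)
    = (\<Sum>j\<in>color_class m l \<chi>\<^sub>0 c. A (y j) (y j))"
proof -
  let ?c = "color_class m l \<chi>\<^sub>0 c"
  have yV: "y j \<in> V" if "j \<in> ?c" for j using y[OF that] by (rule V_local_V)
  have sV: "(\<lambda>x. \<Sum>j\<in>?c. y j x) \<in> V" by (rule V_sum[OF yV])
  have "A (\<lambda>x. \<Sum>j\<in>?c. y j x) (\<lambda>x. \<Sum>j\<in>?c. y j x) = (\<Sum>k\<in>?c. A (\<lambda>x. \<Sum>j\<in>?c. y j x) (y k))"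
    by (rule form_sum_right[OF yV sV])
  also have "\<dots> = (\<Sum>k\<in>?c. A (y k) (y k))"
  proof (intro sum.cong refl)
    fix k assume k: "k \<in> ?c"
    have "A (\<lambda>x. \<Sum>j\<in>?c. y j x) (y k) = (\<Sum>j\<in>?c. A (y j) (y k))" by (rule form_sum[OF yV yV[OF k]])
    also have "\<dots> = (\<Sum>j\<in>?c. if j = k then A (y k) (y k) else 0)"
      using same_color_orthogonal[OF col _ k _ y y[OF k]] by (intro sum.cong refl) auto
    also have "\<dots> = A (y k) (y k)" using k finite_color_class by simp
    finally show "A (\<lambda>x. \<Sum>j\<in>?c. y j x) (y k) = A (y k) (y k)" .
  qed
  finally show ?thesis .
qed

lemma sum_over_color_classes:
  assumes "color_order m l \<chi>\<^sub>0 cs"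
  shows "(\<Sum>k<length cs. \<Sum>j\<in>color_class m l \<chi>\<^sub>0 (cs ! k). f j) = (\<Sum>j\<in>admissible m l. f j)"
proof -
  have cs: "distinct cs" "set cs = patch_color m l \<chi>\<^sub>0 ` admissible m l" using assms by (auto simp: color_order_def)
  have "(\<Sum>k<length cs. \<Sum>j\<in>color_class m l \<chi>\<^sub>0 (cs ! k). f j) = (\<Sum>c\<in>set cs. \<Sum>j\<in>color_class m l \<chi>\<^sub>0 c. f j)"
    by (rule sum.reindex_bij_betw[OF bij_betw_nth[OF cs(1) refl refl]])
  also have "\<dots> = (\<Sum>j\<in>admissible m l. f j)"
    unfolding color_class_def by (rule sum.group) (simp_all add: cs(2))
  finally show ?thesis .
qed

text \<open>
  The bound for successive corrections, applied to the coarse space as the space with the number \<open>0\<close> and to the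
  color \<open>cs ! k\<close> as the space with the number \<open>k + 1\<close>.
\<close>

lemma sweep_energy_bound:
  assumes col: "collar_coloring m l \<chi>\<^sub>0" "color_order m l \<chi>\<^sub>0 cs" and C: "0 < C" and v: "v \<in> V"
    and v0: "v0 \<in> V_coarse p m l" and w: "\<And>j. j \<in> admissible m l \<Longrightarrow> w j \<in> V_local \<kappa> p m l j"
    and v_eq: "v = (\<lambda>x. v0 x + (\<Sum>j\<in>admissible m l. w j x))"
    and energy: "A v0 v0 + (\<Sum>j\<in>admissible m l. A (w j) (w j)) \<le> C * A v v"
  shows "E_col \<kappa> p \<gamma> \<gamma>\<^sub>D m l \<chi>\<^sub>0 cs v \<in> V"
    and "A v v \<le> (2 * (2 ^ CARD('n) + 3 ^ CARD('n))\<^sup>2 + 1) * C *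
      (A v v - A (E_col \<kappa> p \<gamma> \<gamma>\<^sub>D m l \<chi>\<^sub>0 cs v) (E_col \<kappa> p \<gamma> \<gamma>\<^sub>D m l \<chi>\<^sub>0 cs v))"
proof -
  let ?N = "length cs" and ?P0 = "proj (V_coarse p m l)"
  define S where "S = (\<lambda>c u x. u x - color_correction \<kappa> \<chi>\<^sub>0 c u x)"
  define f where "f = (\<lambda>k. fold S (take k cs) (\<lambda>x. v x - ?P0 v x))"
  define e where "e = (\<lambda>k. case k of 0 \<Rightarrow> v | Suc k \<Rightarrow> f k)"
  define t where "t = (\<lambda>k. case k of 0 \<Rightarrow> ?P0 v | Suc k \<Rightarrow> color_correction \<kappa> \<chi>\<^sub>0 (cs ! k) (f k))"
  define y where "y = (\<lambda>k. case k of 0 \<Rightarrow> v0 | Suc k \<Rightarrow> (\<lambda>x. \<Sum>j\<in>color_class m l \<chi>\<^sub>0 (cs ! k). w j x))"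
  have E: "E_col \<kappa> p \<gamma> \<gamma>\<^sub>D m l \<chi>\<^sub>0 cs v = e (Suc ?N)"
    by (simp add: E_col_def e_def f_def S_def color_correction_def)
  have fSuc: "f (Suc k) = S (cs ! k) (f k)" if "k < ?N" for k
    using that by (simp add: f_def take_Suc_conv_app_nth)
  have f0: "f 0 = (\<lambda>x. v x - ?P0 v x)" by (simp add: f_def)
  have P0V: "?P0 v \<in> V" using coarse_V proj_coarse(1)[OF v] by blast
  have fV: "f k \<in> V" if "k \<le> ?N" for k
    using that
  proof (induction k)
    case 0 show ?case unfolding f0 by (rule V_diff[OF v P0V])
  next
    case (Suc k)
    then have fk: "f k \<in> V" and eq: "f (Suc k) = S (cs ! k) (f k)" using fSuc by auto
    show ?case unfolding eq S_def by (rule V_diff[OF fk color_correction_V[OF fk]])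
  qed
  show EV: "E_col \<kappa> p \<gamma> \<gamma>\<^sub>D m l \<chi>\<^sub>0 cs v \<in> V" unfolding E using fV by (simp add: e_def)
  have wc: "w j \<in> V_local \<kappa> p m l j" if "j \<in> color_class m l \<chi>\<^sub>0 c" for j c
    using that by (intro w) (simp add: color_class_def)
  have tV: "t k \<in> V" if "k < Suc ?N" for k
    using that P0V fV color_correction_V by (auto simp: t_def split: nat.split)
  have yV: "y k \<in> V" if "k < Suc ?N" for k
  proof (cases k)
    case 0 then show ?thesis using v0 coarse_V by (simp add: y_def)
  next
    case (Suc k')
    have "(\<lambda>x. \<Sum>j\<in>color_class m l \<chi>\<^sub>0 (cs ! k'). w j x) \<in> V" by (rule V_sum[OF V_local_V[OF wc]])
    then show ?thesis using Suc by (simp add: y_def)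
  qed
  have step: "e (Suc k) = (\<lambda>x. e k x - t k x)" if "k < Suc ?N" for k
    using that fSuc by (cases k) (auto simp: e_def t_def f0 S_def)
  have ot: "A (e (Suc k)) (t k) = 0" if k: "k < Suc ?N" for k
  proof (cases k)
    case 0
    then show ?thesis using proj_coarse(2)[OF v proj_coarse(1)[OF v]] by (simp add: e_def t_def f0)
  next
    case (Suc k')
    then have fk: "f k' \<in> V" using k fV by simp
    have "A (\<lambda>x. f k' x - color_correction \<kappa> \<chi>\<^sub>0 (cs ! k') (f k') x)
        (\<lambda>x. \<Sum>j\<in>color_class m l \<chi>\<^sub>0 (cs ! k'). proj (V_local \<kappa> p m l j) (f k') x) = 0"
      by (rule color_correction_orthogonal[OF col(1) fk proj_local(1)[OF fk]])
    then show ?thesis using Suc k by (simp add: e_def t_def fSuc S_def color_correction_def[abs_def])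
  qed
  have oy: "A (e (Suc k)) (y k) = 0" if k: "k < Suc ?N" for k
  proof (cases k)
    case 0
    then show ?thesis using proj_coarse(2)[OF v v0] by (simp add: e_def y_def f0)
  next
    case (Suc k')
    then have fk: "f k' \<in> V" using k fV by simp
    have "A (\<lambda>x. f k' x - color_correction \<kappa> \<chi>\<^sub>0 (cs ! k') (f k') x)
        (\<lambda>x. \<Sum>j\<in>color_class m l \<chi>\<^sub>0 (cs ! k'). w j x) = 0"
      by (rule color_correction_orthogonal[OF col(1) fk wc])
    then show ?thesis using Suc k by (simp add: e_def y_def fSuc S_def)
  qed
  have sum_y: "v = (\<lambda>x. \<Sum>k<Suc ?N. y k x)"
  proof
    fix x
    have "(\<Sum>k<Suc ?N. y k x) = v0 x + (\<Sum>k<?N. \<Sum>j\<in>color_class m l \<chi>\<^sub>0 (cs ! k). w j x)"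
      by (subst sum.lessThan_Suc_shift) (simp add: y_def)
    then show "v x = (\<Sum>k<Suc ?N. y k x)" using sum_over_color_classes[OF col(2), of "\<lambda>j. w j x"] fun_cong[OF v_eq, of x]
      by (simp only:)
  qed
  have energy_y: "(\<Sum>k<Suc ?N. A (y k) (y k)) \<le> C * A v v"
  proof -
    have "(\<Sum>k<Suc ?N. A (y k) (y k)) = A v0 v0 + (\<Sum>k<?N. \<Sum>j\<in>color_class m l \<chi>\<^sub>0 (cs ! k). A (w j) (w j))"
      by (subst sum.lessThan_Suc_shift) (simp add: y_def color_sum_energy[OF col(1) wc])
    then show ?thesis using sum_over_color_classes[OF col(2), of "\<lambda>j. A (w j) (w j)"] energy
      by (simp only:)
  qed
  have "A v v \<le> real (Suc ?N * (Suc ?N + 1)) / 2 * C * (A v v - A (e (Suc ?N)) (e (Suc ?N)))"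
  proof (rule successive_corrections_bound[where t = t and w = y])
    show "0 \<le> C" using C by simp
    show "e 0 = v" by (simp add: e_def)
  qed (fact v tV yV step ot oy sum_y energy_y)+
  then have bound: "A v v \<le> real (Suc ?N * (Suc ?N + 1)) / 2 * C * (A v v - A (e (Suc ?N)) (e (Suc ?N)))" .
  have pos: "0 < real (Suc ?N * (Suc ?N + 1)) / 2"
    unfolding half_gt_zero_iff of_nat_0_less_iff by simp
  \<comment> \<open>The number of colors is replaced by its upper bound in the factor of the energy loss.\<close>
  have Tnn: "0 \<le> A v v - A (e (Suc ?N)) (e (Suc ?N))"
  proof (rule ccontr)
    assume "\<not> 0 \<le> A v v - A (e (Suc ?N)) (e (Suc ?N))"
    then have "real (Suc ?N * (Suc ?N + 1)) / 2 * C * (A v v - A (e (Suc ?N)) (e (Suc ?N))) < 0"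
      unfolding not_le by (rule mult_pos_neg[OF mult_pos_pos[OF pos C]])
    then show False using bound form_nonneg[OF v] by linarith
  qed
  have "real (Suc ?N * (Suc ?N + 1)) / 2 \<le> 2 * (real ?N)\<^sup>2 + 1" using triangular_le[of ?N] by simp
  also have "(real ?N)\<^sup>2 \<le> (2 ^ CARD('n) + 3 ^ CARD('n))\<^sup>2"
  proof (rule power_mono)
    have "real ?N \<le> real (2 ^ CARD('n) + 3 ^ CARD('n))" using number_of_colors[OF col] by (rule of_nat_mono)
    then show "real ?N \<le> 2 ^ CARD('n) + 3 ^ CARD('n)" by simp
  qed simp
  finally have "real (Suc ?N * (Suc ?N + 1)) / 2 \<le> 2 * (2 ^ CARD('n) + 3 ^ CARD('n))\<^sup>2 + 1" by simp
  then have "real (Suc ?N * (Suc ?N + 1)) / 2 * C * (A v v - A (e (Suc ?N)) (e (Suc ?N)))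
      \<le> (2 * (2 ^ CARD('n) + 3 ^ CARD('n))\<^sup>2 + 1) * C * (A v v - A (e (Suc ?N)) (e (Suc ?N)))"
    using C Tnn by (intro mult_right_mono) auto
  then show "A v v \<le> (2 * (2 ^ CARD('n) + 3 ^ CARD('n))\<^sup>2 + 1) * C *
      (A v v - A (E_col \<kappa> p \<gamma> \<gamma>\<^sub>D m l \<chi>\<^sub>0 cs v) (E_col \<kappa> p \<gamma> \<gamma>\<^sub>D m l \<chi>\<^sub>0 cs v))"
    using bound unfolding E by linarith
qed

text \<open>
  The constant one, extended by zero.
\<close>

lemma exists_nonzero: "\<exists>v\<in>V. A v v > 0"
proof
  define v where "v = (\<lambda>x. if x \<in> \<Omega>h then 1 else 0 :: real)"
  show vV: "v \<in> V"
  proof (rule V_spaceI)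
    fix z assume "z \<in> active"
    then have "v x = 1" if "x \<in> K z" for x using that cell_subset_Omega_h by (auto simp: v_def)
    then show "\<exists>q\<in>Q_poly p. \<forall>x\<in>K z. v x = q x" by (intro bexI[of _ "\<lambda>_. 1"] Q_poly_const) auto
  qed (simp add: v_def)
  obtain x where "x \<in> \<Omega>h" using Omega_ne Omega_subset by blast
  then have "v x \<noteq> 0" by (simp add: v_def)
  then have "v \<noteq> (\<lambda>_. 0)" by auto
  then have "A v v \<noteq> 0" using form_definite[OF vV] by blast
  then show "A v v > 0" using form_nonneg[OF vV] by simp
qed

text \<open>
  Bounding the square of the supremum from above takes its nonnegativity, which comes from the quotient
  \<open>0 / 0 = 0\<close> at the zero function, and that of \<open>1 - 1 / B\<close>, which comes from a function of positive energy.
\<close>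

lemma onorm_bound:
  assumes B: "0 < B" and E: "\<And>v. v \<in> V \<Longrightarrow> E v \<in> V"
    and bound: "\<And>v. v \<in> V \<Longrightarrow> A v v \<le> B * (A v v - A (E v) (E v))"
  shows "(A_onorm p \<gamma> \<gamma>\<^sub>D m l E)\<^sup>2 \<le> 1 - 1 / B"
proof -
  define \<theta> where "\<theta> = 1 - 1 / B"
  have contr: "A (E v) (E v) \<le> \<theta> * A v v" if "v \<in> V" for v
    using bound[OF that] B by (simp add: \<theta>_def field_simps)
  obtain u where u: "u \<in> V" "A u u > 0" using exists_nonzero by blast
  have "0 \<le> \<theta> * A u u" using contr[OF u(1)] form_nonneg[OF E[OF u(1)]] by linarith
  then have \<theta>: "0 \<le> \<theta>" using u(2) by (simp add: zero_le_mult_iff)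
  let ?r = "\<lambda>v. A_norm p \<gamma> \<gamma>\<^sub>D m l (E v) / A_norm p \<gamma> \<gamma>\<^sub>D m l v"
  have le: "?r v \<le> sqrt \<theta>" if v: "v \<in> V" for v
  proof (cases "A v v = 0")
    case True then show ?thesis using \<theta> by (simp add: A_norm_def)
  next
    case False
    then have pos: "A v v > 0" using form_nonneg[OF v] by simp
    have "sqrt (A (E v) (E v)) \<le> sqrt \<theta> * sqrt (A v v)"
      using contr[OF v] by (simp add: real_sqrt_mult[symmetric])
    then show ?thesis using pos by (simp add: A_norm_def pos_divide_le_eq)
  qed
  have ub: "A_onorm p \<gamma> \<gamma>\<^sub>D m l E \<le> sqrt \<theta>"
    unfolding A_onorm_def using u(1) le by (intro cSUP_least) auto
  have "?r (\<lambda>_. 0) \<le> A_onorm p \<gamma> \<gamma>\<^sub>D m l E"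
    unfolding A_onorm_def using V_zero le by (intro cSUP_upper) (auto simp: bdd_above_def)
  moreover have "?r (\<lambda>_. 0) = 0" using form_zero[OF V_zero] by (simp add: A_norm_def)
  ultimately have "0 \<le> A_onorm p \<gamma> \<gamma>\<^sub>D m l E" by simp
  then have "(A_onorm p \<gamma> \<gamma>\<^sub>D m l E)\<^sup>2 \<le> (sqrt \<theta>)\<^sup>2" using ub by (intro power_mono)
  then show ?thesis using \<theta> by (simp add: \<theta>_def)
qed

lemma A_norm_sq: "v \<in> V \<Longrightarrow> (A_norm p \<gamma> \<gamma>\<^sub>D m l v)\<^sup>2 = A v v"
  using form_nonneg by (simp add: A_norm_def)

end

theorem corollary3:
  fixes \<M> :: "('n::finite) config set"
    and \<kappa> :: local_kind
    and p :: nat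
    and \<gamma> \<gamma>\<^sub>D C\<^sub>s\<^sub>d :: real
  assumes "CARD('n) \<in> {2, 3}"
    and "p \<ge> 1"
    and "0 < \<gamma>" and "\<gamma> \<le> 1"
    and "\<forall>m\<in>\<M>. bounded_domain (Omega m) \<and> 0 < width0 m"
    and "\<forall>m\<in>\<M>. geometric_assumption m"
    and "cutfem_stability p \<gamma> \<gamma>\<^sub>D \<M>"
    and "\<forall>m\<in>\<M>. \<forall>l\<in>{1..finest m}. covering_assumption \<kappa> p m l"
    and "stable_decomposition_constant \<kappa> p \<gamma> \<gamma>\<^sub>D \<M> C\<^sub>s\<^sub>d"
  shows "(\<forall>m\<in>\<M>. \<forall>l\<in>{1..finest m}. \<forall>\<chi>\<^sub>0 cs.
      collar_coloring m l \<chi>\<^sub>0 \<and> color_order m l \<chi>\<^sub>0 cs \<longrightarrow>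
        (A_onorm p \<gamma> \<gamma>\<^sub>D m l (E_col \<kappa> p \<gamma> \<gamma>\<^sub>D m l \<chi>\<^sub>0 cs))\<^sup>2
          \<le> 1 - 1 / ((2 * (2 ^ CARD('n) + 3 ^ CARD('n))\<^sup>2 + 1) * C\<^sub>s\<^sub>d)) \<and>
      1 - 1 / ((2 * (2 ^ CARD('n) + 3 ^ CARD('n))\<^sup>2 + 1) * C\<^sub>s\<^sub>d) < 1"
proof (intro conjI ballI allI impI)
  let ?K = "(2 * (2 ^ CARD('n) + 3 ^ CARD('n))\<^sup>2 + 1) * C\<^sub>s\<^sub>d"
  have C: "0 < C\<^sub>s\<^sub>d" using assms(9) by (simp add: stable_decomposition_constant_def)
  then have K: "0 < ?K" by (intro mult_pos_pos add_nonneg_pos) auto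
  then show "1 - 1 / ?K < 1" by simp
  fix m l \<chi>\<^sub>0 cs
  assume m: "m \<in> \<M>" and l: "l \<in> {1..finest m}" and col: "collar_coloring m l \<chi>\<^sub>0 \<and> color_order m l \<chi>\<^sub>0 cs"
  obtain c\<^sub>A where c: "0 < c\<^sub>A" "\<And>m l v. m \<in> \<M> \<Longrightarrow> l \<le> finest m \<Longrightarrow> v \<in> V_space p m l \<Longrightarrow>
      c\<^sub>A * (N_norm p \<gamma> m l v)\<^sup>2 \<le> A_form p \<gamma> \<gamma>\<^sub>D m l v v"
    using assms(7) unfolding cutfem_stability_def by metis
  have "bounded_domain (Omega m)" "0 < width0 m" "C2_boundary (Omega m)" "CARD('n) \<ge> 2" "1 \<le> l" "l \<le> finest m"
    using assms(1,5,6) m l by (auto simp: geometric_assumption_def)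
  then interpret stable_mesh m l p \<gamma> \<gamma>\<^sub>D c\<^sub>A
    by (intro stable_mesh.intro cut_mesh.intro mesh.intro cut_mesh_axioms.intro stable_mesh_axioms.intro
        assms(2,3) c m)
  show "(A_onorm p \<gamma> \<gamma>\<^sub>D m l (E_col \<kappa> p \<gamma> \<gamma>\<^sub>D m l \<chi>\<^sub>0 cs))\<^sup>2 \<le> 1 - 1 / ?K"
  proof (rule onorm_bound[OF K])
    fix v assume v: "v \<in> V"
    have "\<exists>v\<^sub>0\<in>V_coarse p m l. \<exists>w. (\<forall>j\<in>admissible m l. w j \<in> V_local \<kappa> p m l j) \<and>
        v = (\<lambda>x. v\<^sub>0 x + (\<Sum>j\<in>admissible m l. w j x)) \<and>
        (A_norm p \<gamma> \<gamma>\<^sub>D m l v\<^sub>0)\<^sup>2 + (\<Sum>j\<in>admissible m l. (A_norm p \<gamma> \<gamma>\<^sub>D m l (w j))\<^sup>2)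
          \<le> C\<^sub>s\<^sub>d * (A_norm p \<gamma> \<gamma>\<^sub>D m l v)\<^sup>2"
      using conjunct2[OF assms(9)[unfolded stable_decomposition_constant_def], rule_format, OF m l v] .
    then obtain v\<^sub>0 w where v0: "v\<^sub>0 \<in> V_coarse p m l" and w_ball: "\<forall>j\<in>admissible m l. w j \<in> V_local \<kappa> p m l j"
      and v_eq: "v = (\<lambda>x. v\<^sub>0 x + (\<Sum>j\<in>admissible m l. w j x))"
      and en: "(A_norm p \<gamma> \<gamma>\<^sub>D m l v\<^sub>0)\<^sup>2 + (\<Sum>j\<in>admissible m l. (A_norm p \<gamma> \<gamma>\<^sub>D m l (w j))\<^sup>2)
          \<le> C\<^sub>s\<^sub>d * (A_norm p \<gamma> \<gamma>\<^sub>D m l v)\<^sup>2"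
      by (elim bexE exE conjE) (rule that)
    note w = bspec[OF w_ball]
    have "(\<Sum>j\<in>admissible m l. (A_norm p \<gamma> \<gamma>\<^sub>D m l (w j))\<^sup>2) = (\<Sum>j\<in>admissible m l. A (w j) (w j))"
      using w by (intro sum.cong refl A_norm_sq V_local_V)
    then have energy: "A v\<^sub>0 v\<^sub>0 + (\<Sum>j\<in>admissible m l. A (w j) (w j)) \<le> C\<^sub>s\<^sub>d * A v v"
      using en A_norm_sq[OF v] A_norm_sq[OF coarse_V[OF v0]] by simp
    note * = sweep_energy_bound[OF conjunct1[OF col] conjunct2[OF col] C v v0 w v_eq energy]
    show "E_col \<kappa> p \<gamma> \<gamma>\<^sub>D m l \<chi>\<^sub>0 cs v \<in> V" by (rule *(1))
    show "A v v \<le> ?K * (A v v - A (E_col \<kappa> p \<gamma> \<gamma>\<^sub>D m l \<chi>\<^sub>0 cs v) (E_col \<kappa> p \<gamma> \<gamma>\<^sub>D m l \<chi>\<^sub>0 cs v))"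
      by (rule *(2))
  qed
qed

end
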